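(* Let $G$ be a finitely generated metabelian group and let $\pi$ be a finite set of primes. Then either $G$ has a normal subgroup $N$ such that $G/N\in\mathcal{P}_\pi$, and so $G_\pi$ is not soluble, or $G_\pi$ is virtually nilpotent. (That is, either there is a normal subgroup $N$ of $G$ with $G/N\in\mathcal{P}_\pi$ and moreover $G_\pi$ is not soluble, or $G_\pi$ is virtually nilpotent.)
   Context: Let $\pi$ be a set of primes and let $\pi'$ be its complement in the set of all primes. For a nonzero integer $m$, write $m\in\pi'$ if all prime divisors of $m$ lie in $\pi'$. An element $x$ is an $m$-th root of $y$ if $x^m=y$. A group $G$ is $\pi$-local if the map $G\to G$, $x\mapsto x^q$, is bijective for every prime $q\notin\pi$. A $\pi$-localization of a group $G$ is a homomorphism $\phi_\pi: G\to G_\pi$ with $G_\pi$ a $\pi$-local group, such that for every homomorphism $\theta: G\to H$ with $H$ $\pi$-local there is a unique homomorphism $\theta_\pi: G_\pi\to H$ with $\theta_\pi\phi_\pi=\theta$. It always exists and is unique up to isomorphism. A group $G$ is a $\mathcal{U}_\pi$-group (written $G\in\mathcal{U}_\pi$) if the map $x\mapsto x^m$ on $G$ is injective whenever $m\in\pi'$. $\mathbb{Z}_\pi$ denotes the $\pi$-localization of $\mathbb{Z}$, i.e. the additive group of rationals $a/b$ with $a,b\in\mathbb{Z}$, $b\in\pi'$. For $x\in G$, $C_G(x)$ is the centralizer, $C_G(x)^g=g^{-1}C_G(x)g$, and $D_G(x)=\{g\in G\mid C_G(x)\cap C_G(x)^g\neq 1\}$. A subgroup $C\le G$ is malnormal if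 $C\cap C^g=1$ for all $g\in G\setminus C$. A group $G$ is in the class $\mathcal{P}_\pi$ if: (i) $G\in\mathcal{U}_\pi$; (ii) whenever $x\in G$ has no $m$-th root in $G$ for some $m\in\pi'$, the group $C_G(x)$ is torsion-free and one of the following holds: (a) $D_G(x)=C_G(x)$, so that $C_G(x)$ is malnormal; (b) $|D_G(x):C_G(x)|=2$ and $C_G(x)$ is isomorphic to a subgroup of $\mathbb{Z}_\pi$. A group is virtually nilpotent if it has a nilpotent subgroup of finite index. *)

theory Defs
  imports Complex_Main "HOL-Computational_Algebra.Primes" "HOL-Algebra.Solvable_Groups" "HOL-Algebra.Weak_Morphisms"
begin

section \<open>Finitely generated, metabelian and virtually nilpotent groups\<close>

definition finitely_generated_group :: "('a, 'm) monoid_scheme \<Rightarrow> bool" where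
  "finitely_generated_group G \<longleftrightarrow>
     group G \<and> (\<exists>S. finite S \<and> S \<subseteq> carrier G \<and> generate G S = carrier G)"

definition metabelian_group :: "('a, 'm) monoid_scheme \<Rightarrow> bool" where
  "metabelian_group G \<longleftrightarrow>
     group G \<and> comm_group (G\<lparr>carrier := derived G (carrier G)\<rparr>)"

fun lower_central :: "('a, 'm) monoid_scheme \<Rightarrow> nat \<Rightarrow> 'a set" where
  "lower_central G 0 = carrier G"
| "lower_central G (Suc n) =
     generate G {x \<otimes>\<^bsub>G\<^esub> y \<otimes>\<^bsub>G\<^esub> inv\<^bsub>G\<^esub> x \<otimes>\<^bsub>G\<^esub> inv\<^bsub>G\<^esub> y | x y. x \<in> lower_central G n \<and> y \<in> carrier G}"

definition nilpotent_group :: "('a, 'm) monoid_scheme \<Rightarrow> bool" where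
  "nilpotent_group G \<longleftrightarrow> group G \<and> (\<exists>n. lower_central G n = {\<one>\<^bsub>G\<^esub>})"

definition virtually_nilpotent :: "('a, 'm) monoid_scheme \<Rightarrow> bool" where
  "virtually_nilpotent G \<longleftrightarrow>
     group G \<and> (\<exists>K. subgroup K G \<and> finite (rcosets\<^bsub>G\<^esub> K) \<and> nilpotent_group (G\<lparr>carrier := K\<rparr>))"


section \<open>The class of groups P(\<pi>)\<close>

text \<open>Throughout, \<open>\<pi>\<close> is a set of primes, and \<open>pi'_integer \<pi> m\<close> is what is usually
  abbreviated as \<open>m \<in> \<pi>'\<close>.\<close>

definition pi'_integer :: "nat set \<Rightarrow> int \<Rightarrow> bool" where
  "pi'_integer \<pi> m \<longleftrightarrow> m \<noteq> 0 \<and> (\<forall>p::nat. prime p \<and> int p dvd m \<longrightarrow> p \<notin> \<pi>)"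

definition U_group :: "nat set \<Rightarrow> ('a, 'm) monoid_scheme \<Rightarrow> bool" where
  "U_group \<pi> G \<longleftrightarrow>
     group G \<and> (\<forall>m::int. pi'_integer \<pi> m \<longrightarrow> inj_on (\<lambda>x. x [^]\<^bsub>G\<^esub> m) (carrier G))"

definition Z_pi :: "nat set \<Rightarrow> rat monoid" where
  "Z_pi \<pi> = \<lparr>carrier = {of_int a / of_int b | a b. pi'_integer \<pi> b}, mult = (+), one = 0\<rparr>"

definition centralizer_of :: "('a, 'm) monoid_scheme \<Rightarrow> 'a \<Rightarrow> 'a set" where
  "centralizer_of G x = {g \<in> carrier G. g \<otimes>\<^bsub>G\<^esub> x = x \<otimes>\<^bsub>G\<^esub> g}"

definition conjugate_set :: "('a, 'm) monoid_scheme \<Rightarrow> 'a set \<Rightarrow> 'a \<Rightarrow> 'a set" where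
  "conjugate_set G C g = (\<lambda>c. inv\<^bsub>G\<^esub> g \<otimes>\<^bsub>G\<^esub> c \<otimes>\<^bsub>G\<^esub> g) ` C"

definition D_set :: "('a, 'm) monoid_scheme \<Rightarrow> 'a \<Rightarrow> 'a set" where
  "D_set G x = {g \<in> carrier G.
     centralizer_of G x \<inter> conjugate_set G (centralizer_of G x) g \<noteq> {\<one>\<^bsub>G\<^esub>}}"

definition malnormal :: "('a, 'm) monoid_scheme \<Rightarrow> 'a set \<Rightarrow> bool" where
  "malnormal G C \<longleftrightarrow>
     subgroup C G \<and> (\<forall>g \<in> carrier G - C. C \<inter> conjugate_set G C g = {\<one>\<^bsub>G\<^esub>})"

definition torsion_free_group :: "('a, 'm) monoid_scheme \<Rightarrow> bool" where
  "torsion_free_group G \<longleftrightarrow>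
     group G \<and> (\<forall>x \<in> carrier G. \<forall>n::nat. n > 0 \<and> x [^]\<^bsub>G\<^esub> n = \<one>\<^bsub>G\<^esub> \<longrightarrow> x = \<one>\<^bsub>G\<^esub>)"

text \<open>The index of \<open>C = centralizer_of G x\<close> in \<open>D = D_set G x\<close> being 2 is read as: \<open>D\<close> is a
  subgroup containing exactly two right cosets of \<open>C\<close>.  If \<open>x \<noteq> \<one>\<close>, then \<open>D\<close> is closed under
  inverses and a union of right, as well as of left, cosets of \<open>C\<close>; if there are just two of them,
  the one other than \<open>C\<close> is a right and a left coset, so \<open>D\<close> normalizes \<open>C\<close> and is a subgroup
  automatically.\<close>

definition P_group :: "nat set \<Rightarrow> ('a, 'm) monoid_scheme \<Rightarrow> bool" where
  "P_group \<pi> G \<longleftrightarrow>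
     U_group \<pi> G \<and>
     (\<forall>x \<in> carrier G.
        (\<exists>m::int. pi'_integer \<pi> m \<and> \<not> (\<exists>y \<in> carrier G. y [^]\<^bsub>G\<^esub> m = x)) \<longrightarrow>
        torsion_free_group (G\<lparr>carrier := centralizer_of G x\<rparr>) \<and>
        (D_set G x = centralizer_of G x \<or>
         subgroup (D_set G x) G \<and>
         card (rcosets\<^bsub>G\<lparr>carrier := D_set G x\<rparr>\<^esub> (centralizer_of G x)) = 2 \<and>
         (\<exists>K. subgroup K (Z_pi \<pi>) \<and>
              G\<lparr>carrier := centralizer_of G x\<rparr> \<cong> (Z_pi \<pi>)\<lparr>carrier := K\<rparr>)))"

lemma (in group) subgroup_centralizer_of:
  assumes x: "x \<in> carrier G"
  shows "subgroup (centralizer_of G x) G"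
proof (rule subgroupI)
  show "centralizer_of G x \<subseteq> carrier G" by (auto simp: centralizer_of_def)
  show "centralizer_of G x \<noteq> {}" using x by (auto simp: centralizer_of_def)
next
  fix a assume "a \<in> centralizer_of G x"
  then have a: "a \<in> carrier G" "a \<otimes> x = x \<otimes> a" by (auto simp: centralizer_of_def)
  have "inv a \<otimes> x = inv a \<otimes> (x \<otimes> a) \<otimes> inv a"
    using a(1) x by (simp add: m_assoc)
  also have "\<dots> = inv a \<otimes> (a \<otimes> x) \<otimes> inv a" using a by simp
  also have "\<dots> = x \<otimes> inv a"
    using a(1) x by (simp add: m_assoc[symmetric])
  finally show "inv a \<in> centralizer_of G x" using a by (simp add: centralizer_of_def)
next
  fix a b assume "a \<in> centralizer_of G x" "b \<in> centralizer_of G x"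
  then have a: "a \<in> carrier G" "a \<otimes> x = x \<otimes> a" and b: "b \<in> carrier G" "b \<otimes> x = x \<otimes> b"
    by (auto simp: centralizer_of_def)
  have "a \<otimes> b \<otimes> x = a \<otimes> (x \<otimes> b)" using a(1) b x by (simp add: m_assoc)
  also have "\<dots> = (a \<otimes> x) \<otimes> b" using a(1) b(1) x by (simp add: m_assoc)
  also have "\<dots> = x \<otimes> (a \<otimes> b)" using a b(1) x by (simp add: m_assoc)
  finally show "a \<otimes> b \<in> centralizer_of G x" using a b by (simp add: centralizer_of_def)
qed

lemma (in group) malnormal_centralizer_of:
  assumes "x \<in> carrier G" "D_set G x = centralizer_of G x"
  shows "malnormal G (centralizer_of G x)"
  using assms subgroup_centralizer_of by (auto simp: malnormal_def D_set_def)


section \<open>Localization\<close>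

definition pi_local :: "nat set \<Rightarrow> ('a, 'm) monoid_scheme \<Rightarrow> bool" where
  "pi_local \<pi> G \<longleftrightarrow>
     group G \<and>
     (\<forall>q::nat. prime q \<and> q \<notin> \<pi> \<longrightarrow> bij_betw (\<lambda>x. x [^]\<^bsub>G\<^esub> q) (carrier G) (carrier G))"

text \<open>A definition cannot quantify over types, so the test groups \<open>H\<close> of the universal property
  range over the groups whose elements are words in the elements of \<open>G\<close>, the elements of \<open>L\<close>
  and the natural numbers.  This loses no generality: by theorem
  \<open>pi_localization_universal\<close> below the universal property then holds for test groups
  over every type.  (It is essential that the type of \<open>L\<close> occurs here: a very large local simple
  group has only trivial homomorphisms to small groups.)  Uniqueness of \<open>\<psi>\<close> is uniqueness as
  a function on \<open>carrier L\<close>, whence \<open>extensional\<close>.\<close>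

definition pi_localization ::
  "nat set \<Rightarrow> ('a, 'm) monoid_scheme \<Rightarrow> ('b, 'n) monoid_scheme \<Rightarrow> ('a \<Rightarrow> 'b) \<Rightarrow> bool" where
  "pi_localization \<pi> G L \<phi> \<longleftrightarrow>
     pi_local \<pi> L \<and> \<phi> \<in> hom G L \<and>
     (\<forall>(H :: (nat + 'a + 'b) list monoid) \<theta>. pi_local \<pi> H \<and> \<theta> \<in> hom G H \<longrightarrow>
        (\<exists>!\<psi>. \<psi> \<in> hom L H \<inter> extensional (carrier L) \<and> (\<forall>x \<in> carrier G. \<psi> (\<phi> x) = \<theta> x)))"


subsection \<open>Existence of localizations\<close>

text \<open>The localization is constructed as the group given by the elements of \<open>G\<close> as generators, the
  multiplication table of \<open>G\<close> as relations, and formal \<open>q\<close>-th root operations.\<close>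

datatype 'a lterm =
  Gen 'a | One | Mul "'a lterm" "'a lterm" | Inv "'a lterm" | Root nat "'a lterm"

primrec tpow :: "nat \<Rightarrow> 'a lterm \<Rightarrow> 'a lterm" where
  "tpow 0 t = One"
| "tpow (Suc n) t = Mul (tpow n t) t"

inductive_set lterms :: "nat set \<Rightarrow> ('a, 'm) monoid_scheme \<Rightarrow> 'a lterm set"
  for \<pi> :: "nat set" and G :: "('a, 'm) monoid_scheme" where
  Gen: "x \<in> carrier G \<Longrightarrow> Gen x \<in> lterms \<pi> G"
| One: "One \<in> lterms \<pi> G"
| Mul: "s \<in> lterms \<pi> G \<Longrightarrow> t \<in> lterms \<pi> G \<Longrightarrow> Mul s t \<in> lterms \<pi> G"
| Inv: "t \<in> lterms \<pi> G \<Longrightarrow> Inv t \<in> lterms \<pi> G"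
| Root: "prime q \<Longrightarrow> q \<notin> \<pi> \<Longrightarrow> t \<in> lterms \<pi> G \<Longrightarrow> Root q t \<in> lterms \<pi> G"

inductive leqv :: "nat set \<Rightarrow> ('a, 'm) monoid_scheme \<Rightarrow> 'a lterm \<Rightarrow> 'a lterm \<Rightarrow> bool"
  for \<pi> :: "nat set" and G :: "('a, 'm) monoid_scheme" where
  refl: "t \<in> lterms \<pi> G \<Longrightarrow> leqv \<pi> G t t"
| sym: "leqv \<pi> G s t \<Longrightarrow> leqv \<pi> G t s"
| trans: "leqv \<pi> G s t \<Longrightarrow> leqv \<pi> G t u \<Longrightarrow> leqv \<pi> G s u"
| mul: "leqv \<pi> G s s' \<Longrightarrow> leqv \<pi> G t t' \<Longrightarrow> leqv \<pi> G (Mul s t) (Mul s' t')"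
| inv: "leqv \<pi> G s s' \<Longrightarrow> leqv \<pi> G (Inv s) (Inv s')"
| root: "prime q \<Longrightarrow> q \<notin> \<pi> \<Longrightarrow> leqv \<pi> G s s' \<Longrightarrow> leqv \<pi> G (Root q s) (Root q s')"
| assoc: "s \<in> lterms \<pi> G \<Longrightarrow> t \<in> lterms \<pi> G \<Longrightarrow> u \<in> lterms \<pi> G \<Longrightarrow>
    leqv \<pi> G (Mul (Mul s t) u) (Mul s (Mul t u))"
| l_one: "t \<in> lterms \<pi> G \<Longrightarrow> leqv \<pi> G (Mul One t) t"
| l_inv: "t \<in> lterms \<pi> G \<Longrightarrow> leqv \<pi> G (Mul (Inv t) t) One"
| gen: "x \<in> carrier G \<Longrightarrow> y \<in> carrier G \<Longrightarrow> leqv \<pi> G (Gen (x \<otimes>\<^bsub>G\<^esub> y)) (Mul (Gen x) (Gen y))"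
| pow_root: "prime q \<Longrightarrow> q \<notin> \<pi> \<Longrightarrow> t \<in> lterms \<pi> G \<Longrightarrow> leqv \<pi> G (tpow q (Root q t)) t"
| root_pow: "prime q \<Longrightarrow> q \<notin> \<pi> \<Longrightarrow> t \<in> lterms \<pi> G \<Longrightarrow> leqv \<pi> G (Root q (tpow q t)) t"

definition lrep :: "nat set \<Rightarrow> ('a, 'm) monoid_scheme \<Rightarrow> 'a lterm \<Rightarrow> 'a lterm" where
  "lrep \<pi> G t = (SOME s. leqv \<pi> G s t)"

definition term_localization :: "nat set \<Rightarrow> ('a, 'm) monoid_scheme \<Rightarrow> 'a lterm monoid" where
  "term_localization \<pi> G =
     \<lparr>carrier = lrep \<pi> G ` lterms \<pi> G, mult = (\<lambda>s t. lrep \<pi> G (Mul s t)), one = lrep \<pi> G One\<rparr>"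

lemma tpow_lterms: "t \<in> lterms \<pi> G \<Longrightarrow> tpow n t \<in> lterms \<pi> G"
  by (induction n) (auto intro: lterms.intros)

lemma leqv_lterms:
  assumes "group G" "leqv \<pi> G s t"
  shows "s \<in> lterms \<pi> G \<and> t \<in> lterms \<pi> G"
  using assms(2)
proof induction
  case (gen x y)
  then have "x \<otimes>\<^bsub>G\<^esub> y \<in> carrier G" using assms(1) by (simp add: group.is_monoid monoid.m_closed)
  then show ?case using gen by (simp add: lterms.intros)
qed (auto intro: lterms.intros tpow_lterms)

lemma lrep_leqv: "t \<in> lterms \<pi> G \<Longrightarrow> leqv \<pi> G (lrep \<pi> G t) t"
  unfolding lrep_def by (rule someI) (rule leqv.refl)

lemma lrep_eqI: "leqv \<pi> G s t \<Longrightarrow> lrep \<pi> G s = lrep \<pi> G t"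
  unfolding lrep_def by (rule arg_cong[where f = Eps]) (blast intro: leqv.sym leqv.trans)

lemma lrep_eqD:
  "lrep \<pi> G s = lrep \<pi> G t \<Longrightarrow> s \<in> lterms \<pi> G \<Longrightarrow> t \<in> lterms \<pi> G \<Longrightarrow> leqv \<pi> G s t"
  by (metis leqv.sym leqv.trans lrep_leqv)

lemma term_localization_mult:
  assumes "s \<in> lterms \<pi> G" "t \<in> lterms \<pi> G"
  shows "lrep \<pi> G s \<otimes>\<^bsub>term_localization \<pi> G\<^esub> lrep \<pi> G t = lrep \<pi> G (Mul s t)"
  using assms by (auto simp: term_localization_def intro!: lrep_eqI leqv.mul lrep_leqv)

lemma group_term_localization: "group (term_localization \<pi> G)"
proof (rule groupI)
  let ?T = "term_localization \<pi> G"
  have car: "\<exists>s \<in> lterms \<pi> G. x = lrep \<pi> G s" if "x \<in> carrier ?T" for x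
    using that by (auto simp: term_localization_def)
  have rep: "lrep \<pi> G s \<in> carrier ?T" if "s \<in> lterms \<pi> G" for s
    using that by (simp add: term_localization_def)
  have one: "\<one>\<^bsub>?T\<^esub> = lrep \<pi> G One" by (simp add: term_localization_def)
  show "\<one>\<^bsub>?T\<^esub> \<in> carrier ?T" unfolding one by (rule rep) (rule lterms.One)
  fix x assume "x \<in> carrier ?T"
  then obtain s where s: "s \<in> lterms \<pi> G" "x = lrep \<pi> G s" using car by blast
  show "\<one>\<^bsub>?T\<^esub> \<otimes>\<^bsub>?T\<^esub> x = x"
    unfolding one s(2) by (simp add: term_localization_mult s(1) lterms.One leqv.l_one lrep_eqI)
  show "\<exists>y \<in> carrier ?T. y \<otimes>\<^bsub>?T\<^esub> x = \<one>\<^bsub>?T\<^esub>"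
  proof
    show "lrep \<pi> G (Inv s) \<in> carrier ?T" by (rule rep) (rule lterms.Inv[OF s(1)])
    show "lrep \<pi> G (Inv s) \<otimes>\<^bsub>?T\<^esub> x = \<one>\<^bsub>?T\<^esub>"
      unfolding one s(2) by (simp add: term_localization_mult s(1) lterms.Inv leqv.l_inv lrep_eqI)
  qed
  fix y assume "y \<in> carrier ?T"
  then obtain t where t: "t \<in> lterms \<pi> G" "y = lrep \<pi> G t" using car by blast
  show "x \<otimes>\<^bsub>?T\<^esub> y \<in> carrier ?T"
    unfolding s(2) t(2) by (simp add: term_localization_mult s(1) t(1) rep lterms.Mul)
  fix z assume "z \<in> carrier ?T"
  then obtain u where u: "u \<in> lterms \<pi> G" "z = lrep \<pi> G u" using car by blast
  show "x \<otimes>\<^bsub>?T\<^esub> y \<otimes>\<^bsub>?T\<^esub> z = x \<otimes>\<^bsub>?T\<^esub> (y \<otimes>\<^bsub>?T\<^esub> z)"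
    unfolding s(2) t(2) u(2)
    by (simp add: term_localization_mult s(1) t(1) u(1) lterms.Mul leqv.assoc lrep_eqI)
qed

lemma term_localization_pow:
  assumes "t \<in> lterms \<pi> G"
  shows "lrep \<pi> G t [^]\<^bsub>term_localization \<pi> G\<^esub> (n::nat) = lrep \<pi> G (tpow n t)"
proof (induction n)
  case 0
  show ?case by (simp add: nat_pow_def) (simp add: term_localization_def)
next
  case (Suc n)
  have "lrep \<pi> G t [^]\<^bsub>term_localization \<pi> G\<^esub> Suc n =
      lrep \<pi> G t [^]\<^bsub>term_localization \<pi> G\<^esub> n \<otimes>\<^bsub>term_localization \<pi> G\<^esub> lrep \<pi> G t"
    by (simp add: nat_pow_def)
  then show ?case by (simp add: Suc term_localization_mult assms tpow_lterms)
qed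

lemma pi_local_term_localization: "pi_local \<pi> (term_localization \<pi> G)"
  unfolding pi_local_def
proof (intro conjI allI impI)
  let ?T = "term_localization \<pi> G"
  show "group ?T" by (rule group_term_localization)
  fix q :: nat assume q: "prime q \<and> q \<notin> \<pi>"
  have carr: "carrier ?T = lrep \<pi> G ` lterms \<pi> G" by (simp add: term_localization_def)
  show "bij_betw (\<lambda>x. x [^]\<^bsub>?T\<^esub> q) (carrier ?T) (carrier ?T)"
    unfolding bij_betw_def
  proof
    show "inj_on (\<lambda>x. x [^]\<^bsub>?T\<^esub> q) (carrier ?T)"
    proof (rule inj_onI, unfold carr, elim imageE)
      fix x y s t
      assume eq: "x [^]\<^bsub>?T\<^esub> q = y [^]\<^bsub>?T\<^esub> q"
        and s: "s \<in> lterms \<pi> G" "x = lrep \<pi> G s" and t: "t \<in> lterms \<pi> G" "y = lrep \<pi> G t"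
      have "leqv \<pi> G (tpow q s) (tpow q t)"
        using eq s t by (auto simp: term_localization_pow intro: lrep_eqD tpow_lterms)
      then have "leqv \<pi> G (Root q (tpow q s)) (Root q (tpow q t))"
        using q by (blast intro: leqv.root)
      then have "leqv \<pi> G s t"
        using q s(1) t(1) by (meson leqv.root_pow leqv.sym leqv.trans)
      then show "x = y" using s t lrep_eqI by metis
    qed
    show "(\<lambda>x. x [^]\<^bsub>?T\<^esub> q) ` carrier ?T = carrier ?T"
    proof
      show "(\<lambda>x. x [^]\<^bsub>?T\<^esub> q) ` carrier ?T \<subseteq> carrier ?T"
        using monoid.nat_pow_closed[OF group.is_monoid[OF group_term_localization]] by blast
      show "carrier ?T \<subseteq> (\<lambda>x. x [^]\<^bsub>?T\<^esub> q) ` carrier ?T"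
      proof (unfold carr, rule subsetI, elim imageE)
        fix x t assume t: "t \<in> lterms \<pi> G" "x = lrep \<pi> G t"
        have r: "Root q t \<in> lterms \<pi> G" using q t by (auto intro: lterms.Root)
        have "lrep \<pi> G (Root q t) [^]\<^bsub>?T\<^esub> q = x"
          using q t r by (simp add: term_localization_pow leqv.pow_root lrep_eqI)
        then show "x \<in> (\<lambda>x. x [^]\<^bsub>?T\<^esub> q) ` lrep \<pi> G ` lterms \<pi> G" using r by blast
      qed
    qed
  qed
qed

lemma term_localization_hom: "(\<lambda>x. lrep \<pi> G (Gen x)) \<in> hom G (term_localization \<pi> G)"
proof (rule homI)
  fix x assume x: "x \<in> carrier G"
  then show "lrep \<pi> G (Gen x) \<in> carrier (term_localization \<pi> G)"
    by (auto simp: term_localization_def intro: lterms.Gen)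
  fix y assume "y \<in> carrier G"
  with x show "lrep \<pi> G (Gen (x \<otimes>\<^bsub>G\<^esub> y)) =
      lrep \<pi> G (Gen x) \<otimes>\<^bsub>term_localization \<pi> G\<^esub> lrep \<pi> G (Gen y)"
    by (simp add: term_localization_mult lterms.Gen leqv.gen lrep_eqI)
qed

primrec leval :: "('b, 'n) monoid_scheme \<Rightarrow> ('a \<Rightarrow> 'b) \<Rightarrow> 'a lterm \<Rightarrow> 'b" where
  "leval H \<theta> (Gen x) = \<theta> x"
| "leval H \<theta> One = \<one>\<^bsub>H\<^esub>"
| "leval H \<theta> (Mul s t) = leval H \<theta> s \<otimes>\<^bsub>H\<^esub> leval H \<theta> t"
| "leval H \<theta> (Inv t) = inv\<^bsub>H\<^esub> leval H \<theta> t"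
| "leval H \<theta> (Root q t) = inv_into (carrier H) (\<lambda>x. x [^]\<^bsub>H\<^esub> q) (leval H \<theta> t)"

lemma leval_tpow: "leval H \<theta> (tpow n t) = leval H \<theta> t [^]\<^bsub>H\<^esub> n"
  by (induction n) (auto simp: nat_pow_def)

lemma leval_closed:
  assumes H: "pi_local \<pi> H" "\<theta> \<in> hom G H" and t: "t \<in> lterms \<pi> G"
  shows "leval H \<theta> t \<in> carrier H"
proof -
  interpret H: group H using H by (simp add: pi_local_def)
  show ?thesis using t
  proof induction
    case (Root q t)
    then have "(\<lambda>x. x [^]\<^bsub>H\<^esub> q) ` carrier H = carrier H"
      using H(1) by (simp add: pi_local_def bij_betw_def)
    then show ?case using Root by (simp add: inv_into_into)
  qed (use H(2) in \<open>auto simp: hom_def\<close>)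
qed

lemma leval_leqv:
  assumes G: "group G" and H: "pi_local \<pi> H" "\<theta> \<in> hom G H" and eq: "leqv \<pi> G s t"
  shows "leval H \<theta> s = leval H \<theta> t"
proof -
  interpret H: group H using H by (simp add: pi_local_def)
  have bij: "bij_betw (\<lambda>x. x [^]\<^bsub>H\<^esub> q) (carrier H) (carrier H)" if "prime q" "q \<notin> \<pi>" for q :: nat
    using H(1) that by (simp add: pi_local_def)
  note cl = leval_closed[OF H]
  show ?thesis using eq
  proof induction
    case (gen x y)
    then show ?case using H(2) by (simp add: hom_def)
  next
    case (pow_root q t)
    show ?case
      using bij_betw_inv_into_right[OF bij[OF pow_root(1,2)] cl[OF pow_root(3)]]
      by (simp add: leval_tpow)
  next
    case (root_pow q t)
    show ?case
      using bij_betw_inv_into_left[OF bij[OF root_pow(1,2)] cl[OF root_pow(3)]]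
      by (simp add: leval_tpow)
  qed (auto simp: cl H.m_assoc)
qed

lemma term_localization_lift:
  assumes G: "group G" and H: "pi_local \<pi> H" "\<theta> \<in> hom G H"
  shows "leval H \<theta> \<in> hom (term_localization \<pi> G) H"
    and "x \<in> carrier G \<Longrightarrow> leval H \<theta> (lrep \<pi> G (Gen x)) = \<theta> x"
proof -
  have rep: "leval H \<theta> (lrep \<pi> G t) = leval H \<theta> t" if "t \<in> lterms \<pi> G" for t
    using leval_leqv[OF G H lrep_leqv[OF that]] .
  show "leval H \<theta> \<in> hom (term_localization \<pi> G) H"
  proof (rule homI)
    fix x assume "x \<in> carrier (term_localization \<pi> G)"
    then obtain s where s: "s \<in> lterms \<pi> G" "x = lrep \<pi> G s"
      by (auto simp: term_localization_def)
    then show "leval H \<theta> x \<in> carrier H" using leval_closed[OF H] rep by simp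
    fix y assume "y \<in> carrier (term_localization \<pi> G)"
    then obtain t where t: "t \<in> lterms \<pi> G" "y = lrep \<pi> G t"
      by (auto simp: term_localization_def)
    show "leval H \<theta> (x \<otimes>\<^bsub>term_localization \<pi> G\<^esub> y) = leval H \<theta> x \<otimes>\<^bsub>H\<^esub> leval H \<theta> y"
      using s t by (simp add: term_localization_mult rep lterms.Mul)
  qed
  show "leval H \<theta> (lrep \<pi> G (Gen x)) = \<theta> x" if "x \<in> carrier G"
    using rep[OF lterms.Gen[OF that]] by simp
qed

lemma term_localization_unique:
  assumes H: "pi_local \<pi> H"
    and f: "f \<in> hom (term_localization \<pi> G) H" and g: "g \<in> hom (term_localization \<pi> G) H"
    and eq: "\<And>x. x \<in> carrier G \<Longrightarrow> f (lrep \<pi> G (Gen x)) = g (lrep \<pi> G (Gen x))"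
    and x: "x \<in> carrier (term_localization \<pi> G)"
  shows "f x = g x"
proof -
  let ?T = "term_localization \<pi> G"
  have T: "group ?T" by (rule group_term_localization)
  interpret H: group H using H by (simp add: pi_local_def)
  interpret f: group_hom ?T H f
    using T H.group_axioms f by (simp add: group_hom_def group_hom_axioms_def)
  interpret g: group_hom ?T H g
    using T H.group_axioms g by (simp add: group_hom_def group_hom_axioms_def)
  have rep: "lrep \<pi> G s \<in> carrier ?T" if "s \<in> lterms \<pi> G" for s
    using that by (simp add: term_localization_def)
  have "f (lrep \<pi> G t) = g (lrep \<pi> G t)" if "t \<in> lterms \<pi> G" for t
    using that
  proof induction
    case (Gen x)
    then show ?case by (rule eq)
  next
    case One
    have "lrep \<pi> G One = \<one>\<^bsub>?T\<^esub>" by (simp add: term_localization_def)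
    then show ?case by simp
  next
    case (Mul s t)
    then show ?case by (simp add: term_localization_mult[symmetric] rep)
  next
    case (Inv t)
    have "lrep \<pi> G (Inv t) \<otimes>\<^bsub>?T\<^esub> lrep \<pi> G t = \<one>\<^bsub>?T\<^esub>"
      using Inv(1)
      by (subst term_localization_mult)
         (auto simp: term_localization_def intro: lterms.Inv leqv.l_inv lrep_eqI)
    then have "lrep \<pi> G (Inv t) = inv\<^bsub>?T\<^esub> lrep \<pi> G t"
      using Inv(1) by (metis T group.inv_equality rep lterms.Inv)
    then show ?case using Inv by (simp add: rep)
  next
    case (Root q t)
    have r: "Root q t \<in> lterms \<pi> G" using Root by (auto intro: lterms.Root)
    have "lrep \<pi> G (Root q t) [^]\<^bsub>?T\<^esub> q = lrep \<pi> G t"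
      using Root r by (simp add: term_localization_pow leqv.pow_root lrep_eqI)
    then have "f (lrep \<pi> G (Root q t)) [^]\<^bsub>H\<^esub> q = g (lrep \<pi> G (Root q t)) [^]\<^bsub>H\<^esub> q"
      using Root.IH rep[OF r] by (metis f.hom_nat_pow g.hom_nat_pow)
    moreover have "inj_on (\<lambda>x. x [^]\<^bsub>H\<^esub> q) (carrier H)"
      using H Root by (simp add: pi_local_def bij_betw_def)
    ultimately show ?case using rep[OF r] by (auto dest: inj_onD)
  qed
  then show ?thesis using x by (auto simp: term_localization_def)
qed

lemma ex1_restrict_hom:
  assumes L: "group L" and f: "f \<in> hom L H" "\<And>x. x \<in> X \<Longrightarrow> f (\<phi> x) = \<theta> x"
    and \<phi>: "\<phi> ` X \<subseteq> carrier L"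
    and uniq: "\<And>g h y. g \<in> hom L H \<Longrightarrow> h \<in> hom L H \<Longrightarrow>
      (\<And>x. x \<in> X \<Longrightarrow> g (\<phi> x) = h (\<phi> x)) \<Longrightarrow> y \<in> carrier L \<Longrightarrow> g y = h y"
  shows "\<exists>!\<psi>. \<psi> \<in> hom L H \<inter> extensional (carrier L) \<and> (\<forall>x \<in> X. \<psi> (\<phi> x) = \<theta> x)"
proof (rule ex1I)
  interpret L: group L by fact
  show "restrict f (carrier L) \<in> hom L H \<inter> extensional (carrier L) \<and>
      (\<forall>x \<in> X. restrict f (carrier L) (\<phi> x) = \<theta> x)"
    using f \<phi> by (auto simp: hom_def)
  fix \<psi> assume \<psi>: "\<psi> \<in> hom L H \<inter> extensional (carrier L) \<and> (\<forall>x \<in> X. \<psi> (\<phi> x) = \<theta> x)"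
  show "\<psi> = restrict f (carrier L)"
  proof (rule extensionalityI[of _ "carrier L"])
    fix y assume y: "y \<in> carrier L"
    have "\<psi> y = f y" by (rule uniq) (use \<psi> f y in auto)
    then show "\<psi> y = restrict f (carrier L) y" using y by simp
  qed (use \<psi> in auto)
qed

theorem pi_localization_exists:
  assumes "group G"
  shows "pi_localization \<pi> G (term_localization \<pi> G) (\<lambda>x. lrep \<pi> G (Gen x))"
  unfolding pi_localization_def
proof (intro conjI allI impI pi_local_term_localization term_localization_hom)
  fix H :: "(nat + 'a + 'a lterm) list monoid" and \<theta>
  assume H: "pi_local \<pi> H \<and> \<theta> \<in> hom G H"
  show "\<exists>!\<psi>. \<psi> \<in> hom (term_localization \<pi> G) H \<inter> extensional (carrier (term_localization \<pi> G)) \<and>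
      (\<forall>x \<in> carrier G. \<psi> (lrep \<pi> G (Gen x)) = \<theta> x)"
  proof (rule ex1_restrict_hom[OF group_term_localization])
    show "leval H \<theta> \<in> hom (term_localization \<pi> G) H"
      using term_localization_lift(1)[OF assms] H by blast
    show "leval H \<theta> (lrep \<pi> G (Gen x)) = \<theta> x" if "x \<in> carrier G" for x
      using term_localization_lift(2)[OF assms] H that by blast
    show "(\<lambda>x. lrep \<pi> G (Gen x)) ` carrier G \<subseteq> carrier (term_localization \<pi> G)"
      using term_localization_hom[of \<pi> G] by (auto simp: hom_def)
  qed (use H term_localization_unique in blast)
qed


subsection \<open>The universal property with respect to groups over an arbitrary type\<close>

primrec lcode :: "'a lterm \<Rightarrow> (nat + 'a + 'b) list" where
  "lcode (Gen x) = [Inr (Inl x)]"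
| "lcode One = [Inl 0]"
| "lcode (Mul s t) = Inl 1 # lcode s @ lcode t"
| "lcode (Inv t) = Inl 2 # lcode t"
| "lcode (Root q t) = Inl (q + 3) # lcode t"

lemma lcode_append_inj: "lcode s @ u = lcode t @ v \<Longrightarrow> s = t \<and> u = v"
proof (induction s arbitrary: t u v)
  case (Gen x)
  then show ?case by (cases t) simp_all
next
  case One
  then show ?case by (cases t) simp_all
next
  case (Mul s1 s2)
  from Mul.prems obtain t1 t2 where t: "t = Mul t1 t2" by (cases t) simp_all
  have eq: "lcode s1 @ (lcode s2 @ u) = lcode t1 @ (lcode t2 @ v)" using Mul.prems t by simp
  from Mul.IH(1)[OF eq] Mul.IH(2) show ?case unfolding t by blast
next
  case (Inv s)
  from Inv.prems obtain t' where t: "t = Inv t'" by (cases t) simp_all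
  from Inv.prems Inv.IH show ?case unfolding t by simp
next
  case (Root q s)
  from Root.prems obtain t' where t: "t = Root q t'" by (cases t) simp_all
  from Root.prems Root.IH show ?case unfolding t by simp
qed

lemma inj_lcode: "inj lcode"
  by (rule injI) (use lcode_append_inj[where u = "[]" and v = "[]"] in simp)

lemma pi_local_image_group:
  assumes T: "pi_local \<pi> T" and e: "inj_on e (carrier T)"
  shows "pi_local \<pi> (image_group e T)" and "e \<in> iso T (image_group e T)"
proof -
  interpret T: group T using T by (simp add: pi_local_def)
  have mult: "e x \<otimes>\<^bsub>image_group e T\<^esub> e y = e (x \<otimes>\<^bsub>T\<^esub> y)"
    if "x \<in> carrier T" "y \<in> carrier T" for x y
    using that by (simp add: image_group_def inv_into_f_f[OF e])
  have e_car: "e x \<in> carrier (image_group e T)" if "x \<in> carrier T" for x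
    using that by (simp add: image_group_def)
  have e_one: "\<one>\<^bsub>image_group e T\<^esub> = e \<one>\<^bsub>T\<^esub>" by (simp add: image_group_def)
  have ex: "\<exists>x \<in> carrier T. a = e x" if "a \<in> carrier (image_group e T)" for a
    using that by (auto simp: image_group_def)
  show iso: "e \<in> iso T (image_group e T)"
    by (rule isoI, rule homI) (auto simp: e_car mult image_group_def inj_on_imp_bij_betw[OF e]
        inv_into_f_f[OF e])
  have grp: "group (image_group e T)"
  proof (rule groupI)
    show "\<one>\<^bsub>image_group e T\<^esub> \<in> carrier (image_group e T)" by (simp add: e_one e_car)
    fix a assume "a \<in> carrier (image_group e T)"
    then obtain x where x: "x \<in> carrier T" "a = e x" using ex by blast
    show "\<one>\<^bsub>image_group e T\<^esub> \<otimes>\<^bsub>image_group e T\<^esub> a = a" using x by (simp add: e_one mult)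
    show "\<exists>b \<in> carrier (image_group e T). b \<otimes>\<^bsub>image_group e T\<^esub> a = \<one>\<^bsub>image_group e T\<^esub>"
      using x by (intro bexI[of _ "e (inv\<^bsub>T\<^esub> x)"]) (simp_all add: e_one e_car mult)
    fix b assume "b \<in> carrier (image_group e T)"
    then obtain y where y: "y \<in> carrier T" "b = e y" using ex by blast
    show "a \<otimes>\<^bsub>image_group e T\<^esub> b \<in> carrier (image_group e T)"
      using x y by (simp add: mult e_car)
    fix c assume "c \<in> carrier (image_group e T)"
    then obtain z where z: "z \<in> carrier T" "c = e z" using ex by blast
    show "a \<otimes>\<^bsub>image_group e T\<^esub> b \<otimes>\<^bsub>image_group e T\<^esub> c =
        a \<otimes>\<^bsub>image_group e T\<^esub> (b \<otimes>\<^bsub>image_group e T\<^esub> c)"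
      using x y z by (simp add: mult T.m_assoc)
  qed
  have hom: "group_hom T (image_group e T) e"
  proof (intro group_hom.intro group_hom_axioms.intro T.group_axioms grp)
    show "e \<in> hom T (image_group e T)" using iso by (simp add: iso_def)
  qed
  have car: "carrier (image_group e T) = e ` carrier T" by (simp add: image_group_def)
  have "bij_betw (\<lambda>x. x [^]\<^bsub>image_group e T\<^esub> q) (e ` carrier T) (e ` carrier T)"
    if "prime q" "q \<notin> \<pi>" for q :: nat
  proof -
    have bij: "bij_betw (\<lambda>x. x [^]\<^bsub>T\<^esub> q) (carrier T) (carrier T)"
      using T that by (simp add: pi_local_def)
    have be: "bij_betw e (carrier T) (e ` carrier T)" using e by (rule inj_on_imp_bij_betw)
    have "bij_betw (e \<circ> (\<lambda>x. x [^]\<^bsub>T\<^esub> q) \<circ> inv_into (carrier T) e) (e ` carrier T) (e ` carrier T)"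
      by (intro bij_betw_trans[OF bij_betw_inv_into[OF be]] bij_betw_trans[OF bij be])
    moreover have "(e \<circ> (\<lambda>x. x [^]\<^bsub>T\<^esub> q) \<circ> inv_into (carrier T) e) y = y [^]\<^bsub>image_group e T\<^esub> q"
      if "y \<in> e ` carrier T" for y
      using that e by (auto simp: group_hom.hom_nat_pow[OF hom])
    ultimately show ?thesis by (rule bij_betw_cong[THEN iffD1, rotated])
  qed
  then show "pi_local \<pi> (image_group e T)" using grp by (simp add: pi_local_def car)
qed

lemma pi_localization_iso_term_localization:
  fixes G :: "('a, 'm) monoid_scheme" and L :: "('b, 'n) monoid_scheme"
  assumes G: "group G" and L: "pi_localization \<pi> G L \<phi>"
  obtains f where "f \<in> iso L (term_localization \<pi> G)"
    and "\<And>x. x \<in> carrier G \<Longrightarrow> f (\<phi> x) = lrep \<pi> G (Gen x)"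
proof -
  let ?T = "term_localization \<pi> G" and ?i = "\<lambda>x. lrep \<pi> G (Gen x)"
  have locL: "pi_local \<pi> L" and \<phi>: "\<phi> \<in> hom G L" using L by (auto simp: pi_localization_def)
  interpret G: group G by (rule G)
  interpret L: group L using locL by (simp add: pi_local_def)
  interpret T: group ?T by (rule group_term_localization)
  have \<phi>c: "\<phi> x \<in> carrier L" if "x \<in> carrier G" for x using \<phi> that by (auto simp: hom_def)
  have ex1: "\<exists>!\<psi>. \<psi> \<in> hom L H \<inter> extensional (carrier L) \<and> (\<forall>x \<in> carrier G. \<psi> (\<phi> x) = \<theta> x)"
    if "pi_local \<pi> H" "\<theta> \<in> hom G H" for H :: "(nat + 'a + 'b) list monoid" and \<theta>
    using L that by (simp add: pi_localization_def)
  define c where "c = (lcode :: 'a lterm \<Rightarrow> (nat + 'a + 'b) list)"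
  have c: "inj_on c (carrier ?T)" unfolding c_def using inj_lcode by (rule inj_on_subset) simp
  note cT = pi_local_image_group[OF pi_local_term_localization c]
  define d where "d = (\<lambda>y::'b. [Inr (Inr y) :: nat + 'a + 'b])"
  have d: "inj_on d (carrier L)" by (auto simp: d_def inj_on_def)
  note dL = pi_local_image_group[OF locL d]
  let ?cT = "image_group c ?T" and ?dL = "image_group d L"
  have "c \<circ> ?i \<in> hom G ?cT"
    using hom_compose[OF term_localization_hom] cT(2) by (auto simp: iso_def)
  from ex1[OF cT(1) this] obtain f0
    where f0: "f0 \<in> hom L ?cT" "\<And>x. x \<in> carrier G \<Longrightarrow> f0 (\<phi> x) = c (?i x)"
    by auto
  define f where "f = inv_into (carrier ?T) c \<circ> f0"
  have "inv_into (carrier ?T) c \<in> iso ?cT ?T" by (rule T.iso_set_sym[OF cT(2)])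
  then have f: "f \<in> hom L ?T" unfolding f_def using f0(1) by (auto simp: iso_def intro: hom_compose)
  have f\<phi>: "f (\<phi> x) = ?i x" if "x \<in> carrier G" for x
  proof -
    have "?i x \<in> carrier ?T" using that term_localization_hom[of \<pi> G] by (auto simp: hom_def)
    then show ?thesis using that f0(2) inv_into_f_f[OF c] by (simp add: f_def)
  qed
  define g where "g = leval L \<phi>"
  have g: "g \<in> hom ?T L" and gi: "g (?i x) = \<phi> x" if "x \<in> carrier G" for x
    unfolding g_def using term_localization_lift[OF G locL \<phi>] that by auto
  have g: "g \<in> hom ?T L" using g[OF G.one_closed] .
  have fg: "f (g x) = x" if "x \<in> carrier ?T" for x
  proof -
    have "id \<in> hom ?T ?T" by (auto simp: hom_def)
    then have "(f \<circ> g) x = id x"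
      by (rule term_localization_unique[OF pi_local_term_localization hom_compose[OF g f] _ _ that])
         (simp add: f\<phi> gi)
    then show ?thesis by simp
  qed
  have gf: "g (f y) = y" if y: "y \<in> carrier L" for y
  proof -
    have d\<phi>: "d \<circ> \<phi> \<in> hom G ?dL" and dh: "d \<in> hom L ?dL"
      using hom_compose[OF \<phi>] dL(2) by (auto simp: iso_def)
    have "d \<circ> (g \<circ> f) \<in> hom L ?dL" by (intro hom_compose[OF _ dh] hom_compose[OF f g])
    then have "restrict (d \<circ> (g \<circ> f)) (carrier L) \<in> hom L ?dL" "restrict d (carrier L) \<in> hom L ?dL"
      using dh by (auto simp: hom_def Pi_def)
    then have "restrict (d \<circ> (g \<circ> f)) (carrier L) = restrict d (carrier L)"
      using gi f\<phi> \<phi>c by (intro Uniq_D[OF conjunct2[OF iffD1[OF ex1_iff_ex_Uniq ex1[OF dL(1) d\<phi>]]]]) simp_all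
    then have "d (g (f y)) = d y" using y by (metis comp_apply restrict_apply')
    then show ?thesis by (simp add: d_def)
  qed
  have "bij_betw f (carrier L) (carrier ?T)"
    by (rule bij_betw_byWitness[of _ g]) (use fg gf f g in \<open>auto simp: hom_def\<close>)
  then show ?thesis using that f f\<phi> by (simp add: iso_def)
qed

theorem pi_localization_universal:
  assumes G: "group G" and L: "pi_localization \<pi> G L \<phi>"
    and H: "pi_local \<pi> H" "\<theta> \<in> hom G H"
  shows "\<exists>!\<psi>. \<psi> \<in> hom L H \<inter> extensional (carrier L) \<and> (\<forall>x \<in> carrier G. \<psi> (\<phi> x) = \<theta> x)"
proof -
  let ?T = "term_localization \<pi> G"
  have locL: "pi_local \<pi> L" and \<phi>: "\<phi> \<in> hom G L" using L by (auto simp: pi_localization_def)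
  interpret L: group L using locL by (simp add: pi_local_def)
  obtain f where f: "f \<in> iso L ?T" and f\<phi>: "\<And>x. x \<in> carrier G \<Longrightarrow> f (\<phi> x) = lrep \<pi> G (Gen x)"
    using pi_localization_iso_term_localization[OF G L] by blast
  define k where "k = inv_into (carrier L) f"
  have k: "k \<in> iso ?T L" unfolding k_def by (rule L.iso_set_sym[OF f])
  have kf: "k (f y) = y" if "y \<in> carrier L" for y
    using f that unfolding k_def iso_def by (blast intro: bij_betw_inv_into_left)
  have \<phi>c: "\<phi> x \<in> carrier L" if "x \<in> carrier G" for x using \<phi> that by (auto simp: hom_def)
  show ?thesis
  proof (rule ex1_restrict_hom[OF L.group_axioms])
    show "leval H \<theta> \<circ> f \<in> hom L H"
      using f term_localization_lift(1)[OF G H] by (auto simp: iso_def intro: hom_compose)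
    show "(leval H \<theta> \<circ> f) (\<phi> x) = \<theta> x" if "x \<in> carrier G" for x
      using that f\<phi> term_localization_lift(2)[OF G H] by simp
    show "\<phi> ` carrier G \<subseteq> carrier L" using \<phi>c by blast
    fix g h y
    assume g: "g \<in> hom L H" and h: "h \<in> hom L H" and y: "y \<in> carrier L"
      and eq: "\<And>x. x \<in> carrier G \<Longrightarrow> g (\<phi> x) = h (\<phi> x)"
    have kh: "k \<in> hom ?T L" using k by (simp add: iso_def)
    have "(g \<circ> k) (f y) = (h \<circ> k) (f y)"
    proof (rule term_localization_unique[OF H(1) hom_compose[OF kh g] hom_compose[OF kh h]])
      show "f y \<in> carrier ?T" using f y by (auto simp: iso_def hom_def)
      fix x assume x: "x \<in> carrier G"
      show "(g \<circ> k) (lrep \<pi> G (Gen x)) = (h \<circ> k) (lrep \<pi> G (Gen x))"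
        using x by (simp add: f\<phi>[symmetric] kf \<phi>c eq)
    qed
    then show "g y = h y" using y by (simp add: kf)
  qed
qed

hide_const (open) Gen One Mul Inv Root

end

theory Submission
  imports Defs "HOL-Algebra.Algebraic_Closure_Type"
begin

text \<open>The trivial quotient of \<open>G\<close> is a \<open>P_group\<close>, so the point is that a soluble localization \<open>L\<close> is
  virtually nilpotent. Let \<open>T\<close> be the image of \<open>G\<close> in \<open>L\<close> and \<open>A\<close> its derived subgroup, an abelian group on
  which \<open>T\<close> acts by conjugation.

  If powers of the generators of \<open>T\<close> act unipotently on \<open>A\<close>, then \<open>T\<close> has a nilpotent normal subgroup of
  finite index. The root closure of the latter in \<open>L\<close> is nilpotent and of finite index in the subgroup it
  generates with \<open>T\<close>; this subgroup is root-closed, so it is \<open>L\<close>.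

  Otherwise some generator \<open>t\<close> has no power acting unipotently. As roots are unique in \<open>L\<close>, the norms
  \<open>1 + g + \<dots> + g\<^bsup>q - 1\<^esup>\<close>, where \<open>q\<close> is a prime not in \<open>\<pi>\<close>, are injective on \<open>A\<close>. A proper submodule \<open>N\<close>
  that is maximal among those for which all norms and all \<open>t\<^sup>n - 1\<close> are injective on \<open>A / N\<close> makes \<open>A / N\<close>
  a torsion-free module of rank one over a domain. This yields a character \<open>\<chi>\<close> of \<open>G\<close> in an algebraically
  closed field \<open>K\<close> and, from the commutators with \<open>t\<close>, a derivation \<open>\<delta>\<close> with respect to \<open>\<chi>\<close>.

  The image of \<open>\<chi>\<close> is finitely generated, of infinite exponent and without torsion prime to \<open>\<pi>\<close>. So it
  has an element \<open>\<chi>(x)\<close> without a \<open>q\<close>-th root, and if \<open>s\<close> is a \<open>q\<close>-th root in \<open>K\<close> and \<open>\<zeta>\<close> a primitive \<open>q\<close>-th root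
  of unity, then some local group \<open>Y\<close> of pairs of elements of \<open>K\<close> contains \<open>(s, \<zeta> s)\<close> and all \<open>(\<chi>(g), \<chi>(g))\<close>.
  Let \<open>(y, y')\<close> act on \<open>1 + u M\<^sub>2(K[[u]])\<close> by \<open>u \<mapsto> y u\<close> and conjugation with \<open>diag(1, y' / y)\<close>. The semidirect
  product with \<open>Y\<close> is local, as can be checked degree by degree. It contains a representation
  \<open>g \<mapsto> (1 + \<delta>(g) u E, (\<chi>(g), \<chi>(g)))\<close> of \<open>G\<close> with \<open>E\<^sup>2 = 0\<close>, in which the \<open>q\<close>-th root of \<open>x\<close> conjugates
  \<open>1 + c u E\<close> out of the elementary subgroup. Two different conjugate elementary subgroups generate a group
  without nontrivial abelian normal subgroups, so \<open>L\<close> is not soluble.\<close>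

hide_const (open) Divisibility.prime

section \<open>Local hulls in divisible abelian groups\<close>

lemma subgroup_nat_pow_closed:
  "subgroup H G \<Longrightarrow> x \<in> H \<Longrightarrow> x [^]\<^bsub>G\<^esub> (n::nat) \<in> H"
  by (induction n) (auto simp: subgroup.one_closed subgroup.m_closed)

lemma pi_local_subgroupI:
  assumes "group G" "subgroup Y G"
    and "\<And>q x y. prime (q::nat) \<Longrightarrow> q \<notin> \<pi> \<Longrightarrow> x \<in> Y \<Longrightarrow> y \<in> Y \<Longrightarrow> x [^]\<^bsub>G\<^esub> q = y [^]\<^bsub>G\<^esub> q \<Longrightarrow> x = y"
    and "\<And>q x. prime (q::nat) \<Longrightarrow> q \<notin> \<pi> \<Longrightarrow> x \<in> Y \<Longrightarrow> \<exists>y \<in> Y. y [^]\<^bsub>G\<^esub> q = x"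
  shows "pi_local \<pi> (G\<lparr>carrier := Y\<rparr>)"
proof -
  interpret G: group G by fact
  have pow: "x [^]\<^bsub>G\<lparr>carrier := Y\<rparr>\<^esub> (q::nat) = x [^]\<^bsub>G\<^esub> q" for x q
    by (simp add: nat_pow_def)
  have "bij_betw (\<lambda>x. x [^]\<^bsub>G\<^esub> q) Y Y" if q: "prime q" "q \<notin> \<pi>" for q :: nat
    unfolding bij_betw_def
  proof
    show "inj_on (\<lambda>x. x [^]\<^bsub>G\<^esub> q) Y" using assms(3)[OF q] by (auto intro: inj_onI)
    have "x [^]\<^bsub>G\<^esub> q \<in> Y" if "x \<in> Y" for x
      using that assms(2) by (rule subgroup_nat_pow_closed[rotated])
    then show "(\<lambda>x. x [^]\<^bsub>G\<^esub> q) ` Y = Y" using assms(4)[OF q] by (fastforce simp: image_iff)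
  qed
  then show ?thesis
    using G.subgroup_imp_group[OF assms(2)] by (simp add: pi_local_def pow)
qed

text \<open>If \<open>r\<close> divides \<open>i\<close>, the element lies in \<open>Y\<close>.
  Otherwise its \<open>r\<close>-th power lies in \<open>Y\<close> and is torsion, hence trivial; a
  Bezout relation between \<open>i\<close> and \<open>r\<close> then writes \<open>z [^] r\<close>
  as the \<open>r\<close>-th power of an element of \<open>Y\<close>, against
  \<open>no_root\<close>.\<close>

lemma (in comm_group) adjoin_root_torsion_free:
  assumes Y: "subgroup Y G" and r: "prime (r::nat)" "r \<notin> \<pi>"
    and z: "z \<in> carrier G" "z [^] r \<in> Y"
    and no_root: "\<not> (\<exists>w \<in> Y. w [^] r = z [^] r)"
    and tf: "\<And>q x. prime (q::nat) \<Longrightarrow> q \<notin> \<pi> \<Longrightarrow> x \<in> Y \<Longrightarrow> x [^] q = \<one> \<Longrightarrow> x = \<one>"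
    and q: "prime (q::nat)" "q \<notin> \<pi>"
    and y: "y \<in> Y" and tor: "(y \<otimes> z [^] (i::int)) [^] q = \<one>"
  shows "y \<otimes> z [^] i = \<one>"
proof -
  interpret Y: subgroup Y G by fact
  have yc: "y \<in> carrier G" using y by simp
  have zr: "z [^] (int r * j) \<in> Y" for j :: int
  proof -
    have "z [^] (int r * j) = (z [^] r) [^] j" using z by (simp add: int_pow_pow int_pow_int[symmetric])
    then show ?thesis using z(2) Y by (simp add: subgroup_int_pow_closed)
  qed
  show ?thesis
  proof (cases "int r dvd i")
    case True
    then obtain j where "i = int r * j" by blast
    then have "y \<otimes> z [^] i \<in> Y" using y zr[of j] by simp
    then show ?thesis using tf[OF q] tor by blast
  next
    case False
    have "(y \<otimes> z [^] i) [^] r = y [^] r \<otimes> z [^] (int r * i)"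
    proof -
      have "(y \<otimes> z [^] i) [^] r = y [^] r \<otimes> (z [^] i) [^] r"
        using yc z(1) by (simp add: nat_pow_distrib)
      then show ?thesis using z(1) by (simp add: int_pow_int[symmetric] int_pow_pow mult.commute)
    qed
    moreover have "y [^] r \<in> Y"
      using y Y by (simp add: subgroup_nat_pow_closed)
    ultimately have mem: "(y \<otimes> z [^] i) [^] r \<in> Y" using zr[of i] by simp
    have "((y \<otimes> z [^] i) [^] r) [^] q = ((y \<otimes> z [^] i) [^] q) [^] r"
      using yc z(1) by (simp add: nat_pow_pow mult.commute)
    then have "((y \<otimes> z [^] i) [^] r) [^] q = \<one>" using tor by simp
    then have one: "(y \<otimes> z [^] i) [^] r = \<one>" using tf[OF q mem] by blast
    have "coprime i (int r)" using False r(1) by (metis coprime_commute prime_imp_coprime prime_nat_int_transfer)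
    then obtain u v where uv: "u * i + v * int r = 1" by (metis bezout_int coprime_imp_gcd_eq_1)
    define w where "w = inv (y [^] u) \<otimes> (z [^] r) [^] v"
    have w: "w \<in> Y" unfolding w_def using y z(2) Y by (simp add: subgroup_int_pow_closed Y.m_inv_closed)
    have "z [^] r = z [^] (int r * (u * i + v * int r))" using uv z by (simp add: int_pow_int)
    also have "\<dots> = (z [^] i) [^] (u * int r) \<otimes> ((z [^] r) [^] v) [^] r"
      using z(1) by (simp add: int_pow_int[symmetric] int_pow_pow int_pow_mult[symmetric] algebra_simps)
    also have "(z [^] i) [^] (u * int r) = inv (y [^] u) [^] r"
    proof -
      have "z [^] i = inv y \<otimes> (y \<otimes> z [^] i)" using yc z(1) by (simp add: m_assoc[symmetric])
      then have "(z [^] i) [^] (u * int r) = inv y [^] (u * int r) \<otimes> (y \<otimes> z [^] i) [^] (u * int r)"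
        using yc z(1) by (metis int_pow_distrib int_pow_closed inv_closed m_closed)
      also have "(y \<otimes> z [^] i) [^] (u * int r) = ((y \<otimes> z [^] i) [^] r) [^] u"
        using yc z(1) by (simp add: int_pow_int[symmetric] int_pow_pow mult.commute)
      also have "\<dots> = \<one>" using one by simp
      also have "inv y [^] (u * int r) = inv (y [^] u) [^] r"
        using yc by (simp add: int_pow_int[symmetric] int_pow_pow int_pow_inv)
      finally show ?thesis using yc by simp
    qed
    also have "inv (y [^] u) [^] r \<otimes> ((z [^] r) [^] v) [^] r = w [^] r"
      unfolding w_def using yc z(1) by (simp add: nat_pow_distrib)
    finally show ?thesis using w no_root by metis
  qed
qed

lemma (in comm_group) subgroup_adjoin:
  assumes Y: "subgroup Y G" and z: "z \<in> carrier G"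
  defines "Y' \<equiv> {y \<otimes> z [^] (i::int) | y i. y \<in> Y}"
  shows "subgroup Y' G" and "Y \<subseteq> Y'" and "z \<in> Y'"
proof -
  interpret Y: subgroup Y G by fact
  show "subgroup Y' G"
  proof (rule subgroupI)
    show "Y' \<subseteq> carrier G" using z by (auto simp: Y'_def)
    show "Y' \<noteq> {}" unfolding Y'_def using Y.one_closed by blast
    fix a assume "a \<in> Y'"
    then obtain y i where a: "y \<in> Y" "a = y \<otimes> z [^] (i::int)" by (auto simp: Y'_def)
    then have "inv a = inv y \<otimes> z [^] (-i)" using z by (simp add: inv_mult int_pow_neg)
    then show "inv a \<in> Y'" using a(1) Y.m_inv_closed unfolding Y'_def by blast
    fix b assume "b \<in> Y'"
    then obtain y' j where b: "y' \<in> Y" "b = y' \<otimes> z [^] (j::int)" by (auto simp: Y'_def)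
    have "a \<otimes> b = (y \<otimes> y') \<otimes> z [^] (i + j)"
      using a b z by (simp add: int_pow_mult m_ac)
    then show "a \<otimes> b \<in> Y'" using a(1) b(1) Y.m_closed unfolding Y'_def by blast
  qed
  show "Y \<subseteq> Y'"
  proof
    fix y assume "y \<in> Y"
    then show "y \<in> Y'" unfolding Y'_def by (force intro!: exI[of _ y] exI[of _ "0::int"])
  qed
  show "z \<in> Y'"
    unfolding Y'_def using z by (intro CollectI exI[of _ \<one>] exI[of _ "1::int"]) simp
qed

text \<open>By Zorn's lemma, \<open>Y\<close> is maximal among the subgroups over \<open>B\<close>
  without \<open>q\<close>-torsion for primes \<open>q \<notin> \<pi>\<close> whose elements have
  positive powers in \<open>B\<close>. A root missing in \<open>Y\<close> exists in
  \<open>G\<close>, and adjoining it would enlarge \<open>Y\<close>. In an abelian group, absence of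
  torsion makes roots unique.\<close>

lemma (in comm_group) local_hull:
  assumes B: "subgroup B G"
    and div: "\<And>q x. prime (q::nat) \<Longrightarrow> q \<notin> \<pi> \<Longrightarrow> x \<in> carrier G \<Longrightarrow> \<exists>y \<in> carrier G. y [^] q = x"
    and tf: "\<And>q x. prime (q::nat) \<Longrightarrow> q \<notin> \<pi> \<Longrightarrow> x \<in> B \<Longrightarrow> x [^] q = \<one> \<Longrightarrow> x = \<one>"
  obtains Y where "subgroup Y G" "B \<subseteq> Y" "pi_local \<pi> (G\<lparr>carrier := Y\<rparr>)"
    and "\<And>y. y \<in> Y \<Longrightarrow> \<exists>n::nat. n > 0 \<and> y [^] n \<in> B"
proof -
  define \<Y> where "\<Y> = {Y. subgroup Y G \<and> B \<subseteq> Y \<and>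
    (\<forall>q x. prime (q::nat) \<and> q \<notin> \<pi> \<and> x \<in> Y \<and> x [^] q = \<one> \<longrightarrow> x = \<one>) \<and>
    (\<forall>y \<in> Y. \<exists>n::nat. n > 0 \<and> y [^] n \<in> B)}"
  have "B \<in> \<Y>"
    unfolding \<Y>_def using B tf subgroup.mem_carrier[OF B] by (auto intro!: exI[of _ "1::nat"])
  have "\<Union>\<C> \<in> \<Y>" if \<C>: "\<C> \<noteq> {}" "subset.chain \<Y> \<C>" for \<C>
  proof -
    have sub: "\<And>Y. Y \<in> \<C> \<Longrightarrow> Y \<in> \<Y>" and lin: "\<And>A B. A \<in> \<C> \<Longrightarrow> B \<in> \<C> \<Longrightarrow> A \<subseteq> B \<or> B \<subseteq> A"
      using \<C>(2) by (auto simp: subset.chain_def)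
    have sg: "\<And>Y. Y \<in> \<C> \<Longrightarrow> subgroup Y G" using sub by (simp add: \<Y>_def)
    have "subgroup (\<Union>\<C>) G"
    proof (rule subgroupI)
      show "\<Union>\<C> \<subseteq> carrier G" using subgroup.subset[OF sg] by blast
      obtain A where "A \<in> \<C>" using \<C>(1) by blast
      then show "\<Union>\<C> \<noteq> {}" using subgroup.one_closed[OF sg] by blast
      show "\<And>a. a \<in> \<Union>\<C> \<Longrightarrow> inv a \<in> \<Union>\<C>" using subgroup.m_inv_closed[OF sg] by blast
      fix a b assume "a \<in> \<Union>\<C>" "b \<in> \<Union>\<C>"
      then obtain A B where "A \<in> \<C>" "B \<in> \<C>" "a \<in> A" "b \<in> B" by blast
      then obtain C where "C \<in> \<C>" "a \<in> C" "b \<in> C" using lin by blast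
      then show "a \<otimes> b \<in> \<Union>\<C>" using subgroup.m_closed[OF sg] by blast
    qed
    moreover have "B \<subseteq> \<Union>\<C>" using sub \<C>(1) unfolding \<Y>_def by blast
    moreover have "x = \<one>" if "prime q" "q \<notin> \<pi>" "x \<in> \<Union>\<C>" "x [^] q = \<one>" for q :: nat and x
      using that sub unfolding \<Y>_def by blast
    moreover have "\<exists>n::nat. n > 0 \<and> y [^] n \<in> B" if "y \<in> \<Union>\<C>" for y
      using that sub unfolding \<Y>_def by blast
    ultimately show ?thesis unfolding \<Y>_def by blast
  qed
  with subset_Zorn_nonempty[of \<Y>] \<open>B \<in> \<Y>\<close> obtain Y where Y: "Y \<in> \<Y>"
    and max: "\<And>Y'. Y' \<in> \<Y> \<Longrightarrow> Y \<subseteq> Y' \<Longrightarrow> Y' = Y" by (metis empty_iff)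
  have sY: "subgroup Y G" and BY: "B \<subseteq> Y"
    and tfY: "\<And>q x. prime (q::nat) \<Longrightarrow> q \<notin> \<pi> \<Longrightarrow> x \<in> Y \<Longrightarrow> x [^] q = \<one> \<Longrightarrow> x = \<one>"
    and rad: "\<And>y. y \<in> Y \<Longrightarrow> \<exists>n::nat. n > 0 \<and> y [^] n \<in> B"
    using Y by (auto simp: \<Y>_def)
  interpret Y: subgroup Y G by fact
  have root: "\<exists>w \<in> Y. w [^] r = y0" if r: "prime r" "r \<notin> \<pi>" and y0: "y0 \<in> Y" for r :: nat and y0
  proof (rule ccontr)
    assume no: "\<not> (\<exists>w \<in> Y. w [^] r = y0)"
    obtain z where z: "z \<in> carrier G" "z [^] r = y0" using div[OF r, of y0] y0 by auto
    define Y' where "Y' = {y \<otimes> z [^] (i::int) | y i. y \<in> Y}"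
    have sY': "subgroup Y' G" and "Y \<subseteq> Y'" and "z \<in> Y'"
      using subgroup_adjoin[OF sY z(1)] unfolding Y'_def by blast+
    have "Y' \<in> \<Y>"
    proof -
      have "x = \<one>" if "prime q" "q \<notin> \<pi>" "x \<in> Y'" "x [^] q = \<one>" for q :: nat and x
        using that adjoin_root_torsion_free[OF sY r z(1)] z(2) no y0 tfY
        unfolding Y'_def by blast
      moreover have "\<exists>n::nat. n > 0 \<and> x [^] n \<in> B" if x: "x \<in> Y'" for x
      proof -
        obtain y i where a: "y \<in> Y" "x = y \<otimes> z [^] (i::int)" using x by (auto simp: Y'_def)
        have "x [^] r = y [^] r \<otimes> y0 [^] i"
        proof -
          have "x [^] r = y [^] r \<otimes> (z [^] i) [^] r"
            using a z by (simp add: nat_pow_distrib)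
          then show ?thesis
            using z(1) unfolding z(2)[symmetric] by (simp add: int_pow_int[symmetric] int_pow_pow mult.commute)
        qed
        moreover have "y [^] r \<in> Y"
          using a sY by (simp add: subgroup_nat_pow_closed)
        ultimately have "x [^] r \<in> Y" using y0 sY by (simp add: subgroup_int_pow_closed)
        then obtain n :: nat where "n > 0" "(x [^] r) [^] n \<in> B" using rad by blast
        moreover have "x \<in> carrier G" using a z by auto
        ultimately show ?thesis using r(1) prime_gt_0_nat by (intro exI[of _ "r * n"]) (simp add: nat_pow_pow)
      qed
      ultimately show ?thesis using sY' BY \<open>Y \<subseteq> Y'\<close> unfolding \<Y>_def by blast
    qed
    then have "Y' = Y" using max \<open>Y \<subseteq> Y'\<close> by blast
    then show False using no z \<open>z \<in> Y'\<close> by blast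
  qed
  show ?thesis
  proof (rule that[OF sY BY _ rad])
    show "pi_local \<pi> (G\<lparr>carrier := Y\<rparr>)"
    proof (rule pi_local_subgroupI[OF group_axioms sY])
      fix q :: nat and x y assume q: "prime q" "q \<notin> \<pi>" and xy: "x \<in> Y" "y \<in> Y" "x [^] q = y [^] q"
      have "(x \<otimes> inv y) [^] q = x [^] q \<otimes> inv (y [^] q)"
        using xy by (simp add: nat_pow_distrib nat_pow_inv)
      then have "(x \<otimes> inv y) [^] q = \<one>" using xy by simp
      then have "x \<otimes> inv y = \<one>" using tfY[OF q] xy by (simp add: Y.m_inv_closed)
      then show "x = y" using xy by (metis Y.mem_carrier inv_equality inv_inv inv_closed)
    qed (use root in blast)
  qed
qed

section \<open>Skew products with groups of power series\<close>

unbundle fps_syntax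

text \<open>As the constant coefficients are 1, the coefficient of degree \<open>k\<close> of a
  product is \<open>f $ k + g $ k\<close> plus products of lower coefficients, and these
  cancel.\<close>

lemma fps_mult_nth_agree:
  fixes f g f' g' :: "'r::ring_1 fps"
  assumes "f $ 0 = 1" "g $ 0 = 1" "f' $ 0 = 1" "g' $ 0 = 1" "k > 0"
    and f: "\<And>j. j < k \<Longrightarrow> f $ j = f' $ j" and g: "\<And>j. j < k \<Longrightarrow> g $ j = g' $ j"
  shows "(f * g) $ k - (f' * g') $ k = (f $ k - f' $ k) + (g $ k - g' $ k)"
proof -
  have split: "(p * q) $ k = q $ k + p $ k + (\<Sum>i = 1..<k. p $ i * q $ (k - i))"
    if "p $ 0 = 1" "q $ 0 = 1" for p q :: "'r fps"
  proof -
    have "{0..k} = insert 0 (insert k {1..<k})" using \<open>k > 0\<close> by auto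
    then show ?thesis using that \<open>k > 0\<close> by (simp add: fps_mult_nth add.assoc)
  qed
  have "(\<Sum>i = 1..<k. f $ i * g $ (k - i)) = (\<Sum>i = 1..<k. f' $ i * g' $ (k - i))"
    by (rule sum.cong) (auto simp: f g)
  then show ?thesis using assms(1-4) by (simp add: split)
qed

lemma fps_mult_nth_agree_less:
  fixes f g f' g' :: "'r::ring_1 fps"
  assumes "\<And>j. j < k \<Longrightarrow> f $ j = f' $ j" "\<And>j. j < k \<Longrightarrow> g $ j = g' $ j" "j < k"
  shows "(f * g) $ j = (f' * g') $ j"
  unfolding fps_mult_nth by (rule sum.cong) (use assms in auto)

text \<open>\<open>a y n\<close> is the action of \<open>y\<close> in degree \<open>n\<close>. The
  axioms make the coefficientwise action on power series one by ring automorphisms.\<close>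

locale graded_action = group Y for Y (structure) +
  fixes a :: "'a \<Rightarrow> nat \<Rightarrow> 'r::ring_1 \<Rightarrow> 'r"
  assumes a_add: "y \<in> carrier Y \<Longrightarrow> a y n (r + s) = a y n r + a y n s"
    and a_mult: "y \<in> carrier Y \<Longrightarrow> a y (m + n) (r * s) = a y m r * a y n s"
    and a_unit: "y \<in> carrier Y \<Longrightarrow> a y 0 1 = 1"
    and a_comp: "x \<in> carrier Y \<Longrightarrow> y \<in> carrier Y \<Longrightarrow> a (x \<otimes> y) n r = a x n (a y n r)"
    and a_id: "a \<one> n r = r"
begin

definition act :: "'a \<Rightarrow> 'r fps \<Rightarrow> 'r fps" where
  "act y f = Abs_fps (\<lambda>n. a y n (f $ n))"

definition skew_group :: "('r fps \<times> 'a) monoid" where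
  "skew_group = \<lparr>carrier = {f. f $ 0 = 1} \<times> carrier Y,
     mult = (\<lambda>(f, x) (g, y). (f * act x g, x \<otimes> y)), one = (1, \<one>)\<rparr>"

text \<open>The first component of the \<open>n\<close>-th power of \<open>(f, y)\<close> in
  \<open>skew_group\<close>, a noncommutative norm.\<close>

primrec norm_pow :: "'a \<Rightarrow> nat \<Rightarrow> 'r fps \<Rightarrow> 'r fps" where
  "norm_pow y 0 f = 1"
| "norm_pow y (Suc n) f = norm_pow y n f * act (y [^] n) f"

lemma act_nth [simp]: "act y f $ n = a y n (f $ n)"
  by (simp add: act_def)

lemma a_zero [simp]: "y \<in> carrier Y \<Longrightarrow> a y n 0 = 0"
  using a_add[of y n 0 0] by simp

lemma a_diff: "y \<in> carrier Y \<Longrightarrow> a y n (r - s) = a y n r - a y n s"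
  using a_add[of y n "r - s" s] by (simp add: algebra_simps)

lemma a_sum: "y \<in> carrier Y \<Longrightarrow> a y n (sum h I) = (\<Sum>i\<in>I. a y n (h i))"
  by (induction I rule: infinite_finite_induct) (auto simp: a_add)

lemma act_mult: "y \<in> carrier Y \<Longrightarrow> act y (f * g) = act y f * act y g"
proof (rule fps_ext)
  fix n assume y: "y \<in> carrier Y"
  have "a y n (f $ i * g $ (n - i)) = a y i (f $ i) * a y (n - i) (g $ (n - i))" if "i \<le> n" for i
    using a_mult[OF y, of i "n - i"] that by simp
  then show "act y (f * g) $ n = (act y f * act y g) $ n"
    using y by (simp add: fps_mult_nth a_sum)
qed

lemma act_one: "y \<in> carrier Y \<Longrightarrow> act y 1 = 1"
  by (rule fps_ext) (simp add: fps_one_def a_unit)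

lemma act_comp: "x \<in> carrier Y \<Longrightarrow> y \<in> carrier Y \<Longrightarrow> act (x \<otimes> y) f = act x (act y f)"
  by (rule fps_ext) (simp add: a_comp)

lemma act_id: "act \<one> f = f"
  by (rule fps_ext) (simp add: a_id)

lemma skew_group_simps [simp]:
  "carrier skew_group = {f. f $ 0 = 1} \<times> carrier Y"
  "(f, x) \<otimes>\<^bsub>skew_group\<^esub> (g, y) = (f * act x g, x \<otimes> y)"
  "\<one>\<^bsub>skew_group\<^esub> = (1, \<one>)"
  by (simp_all add: skew_group_def)

lemma group_skew_group: "group skew_group"
proof (rule groupI)
  fix p assume p: "p \<in> carrier skew_group"
  obtain f x where fx: "p = (f, x)" by fastforce
  then have f: "f $ 0 = 1" and x: "x \<in> carrier Y" using p by auto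
  show "\<one>\<^bsub>skew_group\<^esub> \<otimes>\<^bsub>skew_group\<^esub> p = p" using x by (simp add: fx act_id)
  define g where "g = fps_left_inverse f 1"
  have gf: "g * f = 1" using fps_left_inverse[of 1 f] f by (simp add: g_def)
  have g: "g $ 0 = 1" by (simp add: g_def)
  show "\<exists>q \<in> carrier skew_group. q \<otimes>\<^bsub>skew_group\<^esub> p = \<one>\<^bsub>skew_group\<^esub>"
  proof
    show "(act (inv x) g, inv x) \<in> carrier skew_group" using g x by (simp add: a_unit)
    show "(act (inv x) g, inv x) \<otimes>\<^bsub>skew_group\<^esub> p = \<one>\<^bsub>skew_group\<^esub>"
      using x by (simp add: fx act_mult[symmetric] gf act_one)
  qed
qed (auto simp: a_unit act_mult act_comp m_assoc mult.assoc)

lemma norm_pow_nth_0: "y \<in> carrier Y \<Longrightarrow> f $ 0 = 1 \<Longrightarrow> norm_pow y n f $ 0 = 1"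
  by (induction n) (auto simp: a_unit)

lemma skew_group_pow:
  "(f, y) [^]\<^bsub>skew_group\<^esub> (n::nat) = (norm_pow y n f, y [^] n)"
  by (induction n) simp_all

text \<open>In the lowest degree where two series differ, their norms differ by a linear function of
  the difference. This allows equations for the norm to be solved degree by degree.\<close>

lemma norm_pow_agree:
  assumes y: "y \<in> carrier Y" and f0: "f $ 0 = 1" "f' $ 0 = 1" and k: "k > 0"
    and f: "\<And>j. j < k \<Longrightarrow> f $ j = f' $ j"
  shows "j < k \<Longrightarrow> norm_pow y n f $ j = norm_pow y n f' $ j"
    and "norm_pow y n f $ k - norm_pow y n f' $ k = (\<Sum>i<n. a (y [^] i) k (f $ k - f' $ k))"
proof (induction n arbitrary: j)
  case (Suc n)
  {
    case 1
    show ?case unfolding norm_pow.simps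
      by (rule fps_mult_nth_agree_less[of k]) (use Suc.IH(1) f 1 in auto)
  next
    case 2
    have "norm_pow y (Suc n) f $ k - norm_pow y (Suc n) f' $ k =
      (norm_pow y n f $ k - norm_pow y n f' $ k) + (act (y [^] n) f $ k - act (y [^] n) f' $ k)"
      unfolding norm_pow.simps
      by (rule fps_mult_nth_agree) (use Suc.IH(1) f f0 y k in \<open>auto simp: norm_pow_nth_0 a_unit\<close>)
    then show ?case using Suc.IH(2) y by (simp add: a_diff)
  }
qed simp_all

text \<open>A \<open>q\<close>-th root of \<open>(g, z)\<close> is found by taking the root
  \<open>y\<close> of \<open>z\<close> in \<open>Y\<close> and solving
  \<open>norm_pow y q f = g\<close> degree by degree: in each positive degree the unknown
  coefficient enters through the bijection in \<open>bij\<close>. The same argument gives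
  uniqueness.\<close>

lemma pi_local_skew_group:
  assumes loc: "pi_local \<pi> Y"
    and bij: "\<And>q y n. prime (q::nat) \<Longrightarrow> q \<notin> \<pi> \<Longrightarrow> y \<in> carrier Y \<Longrightarrow> n > 0 \<Longrightarrow>
      bij (\<lambda>r. \<Sum>i<q. a (y [^] i) n r)"
  shows "pi_local \<pi> skew_group"
  unfolding pi_local_def
proof (intro conjI allI impI group_skew_group, elim conjE)
  fix q :: nat assume q: "prime q" "q \<notin> \<pi>"
  have bijY: "bij_betw (\<lambda>x. x [^] q) (carrier Y) (carrier Y)" using loc q by (simp add: pi_local_def)
  have agree: "f $ j = f' $ j"
    if y: "y \<in> carrier Y" and f0: "f $ 0 = 1" "f' $ 0 = 1"
      and eq: "\<And>j. j < k \<Longrightarrow> norm_pow y q f $ j = norm_pow y q f' $ j" and "j < k" for y f f' k j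
    using \<open>j < k\<close>
  proof (induction j rule: less_induct)
    case (less j)
    show ?case
    proof (cases "j = 0")
      case False
      have fj: "\<And>i. i < j \<Longrightarrow> f $ i = f' $ i" using less by simp
      have "(\<Sum>i<q. a (y [^] i) j (f $ j - f' $ j)) = 0"
        using norm_pow_agree(2)[where n = q and k = j, OF y f0 _ fj] False eq[OF less.prems] by simp
      also have "\<dots> = (\<Sum>i<q. a (y [^] i) j 0)" using y by simp
      finally have "f $ j - f' $ j = 0" using bij[OF q y, of j] False by (meson bij_def injD not_gr0)
      then show ?thesis by simp
    qed (use f0 in simp)
  qed
  have approx: "\<exists>f. f $ 0 = 1 \<and> (\<forall>j<k. norm_pow y q f $ j = g $ j)"
    if y: "y \<in> carrier Y" and g: "g $ 0 = 1" for y g k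
  proof (induction k)
    case 0
    show ?case by (intro exI[of _ 1]) simp
  next
    case (Suc k)
    then obtain f where f: "f $ 0 = 1" "\<And>j. j < k \<Longrightarrow> norm_pow y q f $ j = g $ j" by blast
    show ?case
    proof (cases "k = 0")
      case True
      then show ?thesis using f y g by (intro exI[of _ f]) (auto simp: norm_pow_nth_0)
    next
      case False
      then have "k > 0" by simp
      \<comment> \<open>The correction in degree \<open>k\<close> that makes up for the error of the
        norm of \<open>f\<close> there.\<close>
      obtain e where e: "(\<Sum>i<q. a (y [^] i) k e) = g $ k - norm_pow y q f $ k"
        using surjD[OF bij_is_surj[OF bij[OF q y \<open>k > 0\<close>]], of "g $ k - norm_pow y q f $ k"] by metis
      define f' where "f' = Abs_fps (\<lambda>n. if n = k then f $ k + e else f $ n)"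
      have f'0: "f' $ 0 = 1" and f'k: "f' $ k - f $ k = e" and f'j: "\<And>j. j < k \<Longrightarrow> f' $ j = f $ j"
        using False f by (auto simp: f'_def)
      have "norm_pow y q f' $ j = g $ j" if "j < k" for j
        using norm_pow_agree(1)[OF y f'0 f(1) \<open>k > 0\<close> f'j that] f(2)[OF that] by simp
      moreover have "norm_pow y q f' $ k = g $ k"
        using norm_pow_agree(2)[where n = q, OF y f'0 f(1) \<open>k > 0\<close> f'j] e f'k by simp
      ultimately show ?thesis using f'0 by (intro exI[of _ f']) (auto simp: less_Suc_eq)
    qed
  qed
  have solve: "\<exists>f. f $ 0 = 1 \<and> norm_pow y q f = g" if y: "y \<in> carrier Y" and g: "g $ 0 = 1" for y g
  proof -
    obtain F where F: "\<And>k. F k $ 0 = 1" "\<And>k j. j < k \<Longrightarrow> norm_pow y q (F k) $ j = g $ j"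
      using approx[OF y g] by metis
    \<comment> \<open>The approximations agree with each other in low degrees by
      \<open>agree\<close>, so the limit takes its coefficient of degree \<open>n\<close> from the
      first one that is exact there.\<close>
    define f where "f = Abs_fps (\<lambda>n. F (Suc n) $ n)"
    have f0: "f $ 0 = 1" by (simp add: f_def F)
    have fF: "f $ j = F k $ j" if "j < k" for j k
      unfolding f_def fps_nth_Abs_fps
      by (rule agree[OF y F(1) F(1), of "Suc j"]) (use F(2) that in auto)
    have "norm_pow y q f $ n = g $ n" for n
      using norm_pow_agree(1)[where k = "Suc n" and n = q and j = n, OF y f0 F(1)[of "Suc n"]] fF[of _ "Suc n"] F(2)[of n "Suc n"] by simp
    then show ?thesis using f0 by (auto intro: fps_ext)
  qed
  show "bij_betw (\<lambda>p. p [^]\<^bsub>skew_group\<^esub> q) (carrier skew_group) (carrier skew_group)"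
    unfolding bij_betw_def
  proof
    show "inj_on (\<lambda>p. p [^]\<^bsub>skew_group\<^esub> q) (carrier skew_group)"
    proof (rule inj_onI)
      fix p p' assume pp: "p \<in> carrier skew_group" "p' \<in> carrier skew_group"
        "p [^]\<^bsub>skew_group\<^esub> q = p' [^]\<^bsub>skew_group\<^esub> q"
      obtain f y f' y' where p: "p = (f, y)" "p' = (f', y')" by fastforce
      have "y [^] q = y' [^] q" and eq: "norm_pow y q f = norm_pow y' q f'"
        using pp(3) by (simp_all add: p skew_group_pow)
      then have yy: "y = y'" using bijY pp by (auto simp: p bij_betw_def dest: inj_onD)
      have "f $ j = f' $ j" for j
        by (rule agree[of y _ _ "Suc j"]) (use pp eq yy in \<open>auto simp: p\<close>)
      then show "p = p'" using yy by (simp add: p fps_eq_iff)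
    qed
    show "(\<lambda>p. p [^]\<^bsub>skew_group\<^esub> q) ` carrier skew_group = carrier skew_group"
    proof
      show "(\<lambda>p. p [^]\<^bsub>skew_group\<^esub> q) ` carrier skew_group \<subseteq> carrier skew_group"
        using monoid.nat_pow_closed[OF group.is_monoid[OF group_skew_group]] by blast
      show "carrier skew_group \<subseteq> (\<lambda>p. p [^]\<^bsub>skew_group\<^esub> q) ` carrier skew_group"
      proof
        fix p assume p: "p \<in> carrier skew_group"
        obtain g z where gz: "p = (g, z)" by fastforce
        then have "z \<in> (\<lambda>x. x [^] q) ` carrier Y" using p bijY by (simp add: bij_betw_def)
        then obtain y where y: "y \<in> carrier Y" "y [^] q = z" by blast
        obtain f where "f $ 0 = 1" "norm_pow y q f = g" using solve[OF y(1), of g] p gz by auto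
        then show "p \<in> (\<lambda>p. p [^]\<^bsub>skew_group\<^esub> q) ` carrier skew_group"
          using y by (intro image_eqI[of _ _ "(f, y)"]) (simp_all add: gz skew_group_pow)
      qed
    qed
  qed
qed

end

section \<open>Two by two matrices\<close>

text \<open>A ring type of its own, so that power series with matrix coefficients can be
  formed.\<close>

datatype 'k mat2 = Mat2 (m11: 'k) (m12: 'k) (m21: 'k) (m22: 'k)

instantiation mat2 :: (comm_ring_1) ring_1
begin

definition "0 = Mat2 0 0 0 0"
definition "1 = Mat2 1 0 0 1"
definition "A + B = Mat2 (m11 A + m11 B) (m12 A + m12 B) (m21 A + m21 B) (m22 A + m22 B)"
definition "A - B = Mat2 (m11 A - m11 B) (m12 A - m12 B) (m21 A - m21 B) (m22 A - m22 B)"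
definition "- A = Mat2 (- m11 A) (- m12 A) (- m21 A) (- m22 A)"
definition "A * B = Mat2 (m11 A * m11 B + m12 A * m21 B) (m11 A * m12 B + m12 A * m22 B)
  (m21 A * m11 B + m22 A * m21 B) (m21 A * m12 B + m22 A * m22 B)"

instance
  by standard
    (simp_all add: zero_mat2_def one_mat2_def plus_mat2_def minus_mat2_def uminus_mat2_def
      times_mat2_def algebra_simps)

end

lemmas mat2_defs = zero_mat2_def one_mat2_def plus_mat2_def minus_mat2_def uminus_mat2_def times_mat2_def

lemma mat2_sel_simps [simp]:
  "m11 0 = 0" "m12 0 = 0" "m21 0 = 0" "m22 0 = 0"
  "m11 1 = 1" "m12 1 = 0" "m21 1 = 0" "m22 1 = 1"
  "m11 (A + B) = m11 A + m11 B" "m12 (A + B) = m12 A + m12 B"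
  "m21 (A + B) = m21 A + m21 B" "m22 (A + B) = m22 A + m22 B"
  by (simp_all add: mat2_defs)

lemma mat2_sel_sum:
  "m11 (sum h I) = (\<Sum>i\<in>I. m11 (h i))" "m12 (sum h I) = (\<Sum>i\<in>I. m12 (h i))"
  "m21 (sum h I) = (\<Sum>i\<in>I. m21 (h i))" "m22 (sum h I) = (\<Sum>i\<in>I. m22 (h i))"
  by (induction I rule: infinite_finite_induct) simp_all

definition det2 :: "'k::comm_ring_1 mat2 \<Rightarrow> 'k" where
  "det2 A = m11 A * m22 A - m12 A * m21 A"

lemma det2_mult: "det2 (A * B) = det2 A * det2 B"
  by (simp add: det2_def times_mat2_def algebra_simps)

text \<open>Identifies power series over matrices with matrices over power series; the latter have a
  determinant, and entries in a domain if the coefficients lie in one.\<close>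

definition mat_fps :: "'k::comm_ring_1 mat2 fps \<Rightarrow> 'k fps mat2" where
  "mat_fps f = Mat2 (Abs_fps (\<lambda>n. m11 (f $ n))) (Abs_fps (\<lambda>n. m12 (f $ n)))
     (Abs_fps (\<lambda>n. m21 (f $ n))) (Abs_fps (\<lambda>n. m22 (f $ n)))"

lemma mat_fps_mult: "mat_fps (f * g) = mat_fps f * mat_fps g"
  by (simp add: mat_fps_def times_mat2_def fps_eq_iff fps_mult_nth mat2_sel_sum sum.distrib)

lemma mat_fps_one: "mat_fps 1 = 1"
  by (simp add: mat_fps_def one_mat2_def fps_eq_iff fps_one_def)

lemma mat_fps_inject: "mat_fps f = mat_fps g \<longleftrightarrow> f = g"
  by (auto simp: mat_fps_def fps_eq_iff mat2.expand)

text \<open>The matrix \<open>nil2 c w\<close> is \<open>c\<close> times the product of the column \<open>(1, w)\<close> and the row \<open>(w, -1)\<close>; up to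
  a scalar it is conjugate to \<open>nil2 c 1\<close> by \<open>diag(1, w)\<close>.\<close>

definition nil2 :: "'k::comm_ring_1 \<Rightarrow> 'k \<Rightarrow> 'k mat2" where
  "nil2 c w = Mat2 (c * w) (- c) (c * w * w) (- (c * w))"

definition lin_fps :: "'r::ring_1 \<Rightarrow> 'r fps" where
  "lin_fps A = 1 + fps_const A * fps_X"

lemma lin_fps_nth: "lin_fps A $ n = (if n = 0 then 1 else if n = 1 then A else 0)"
  by (simp add: lin_fps_def)

lemma lin_fps_mult:
  assumes "A * B = 0"
  shows "lin_fps A * lin_fps B = lin_fps (A + B)"
proof -
  have "fps_const A * fps_X * (fps_const B * fps_X) = fps_const A * fps_const B * fps_X * fps_X"
    by (metis fps_mult_fps_X_commute mult.assoc)
  then have "fps_const A * fps_X * (fps_const B * fps_X) = 0" using assms by simp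
  then show ?thesis by (simp add: lin_fps_def algebra_simps flip: fps_const_add)
qed

lemma mat_fps_lin_nil2:
  "mat_fps (lin_fps (nil2 c w)) = 1 + nil2 (fps_const c * fps_X) (fps_const w)"
  by (auto simp: mat_fps_def nil2_def mat2_defs fps_eq_iff lin_fps_nth fps_one_def fps_X_def)

lemma nil2_mult: "nil2 c w * nil2 d w = 0"
  by (simp add: nil2_def mat2_defs algebra_simps)

lemma nil2_add: "nil2 c w + nil2 d w = nil2 (c + d) w"
  by (simp add: nil2_def mat2_defs algebra_simps)

lemma nil2_minus: "- nil2 c w = nil2 (- c) w"
  by (simp add: nil2_def mat2_defs)

lemma det2_one_plus_nil2: "det2 (1 + nil2 c w) = 1"
  by (simp add: det2_def nil2_def mat2_defs algebra_simps)

text \<open>The relation says that \<open>b\<close> commutes with its conjugate by the unipotent \<open>1 + z N\<close>, where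
  \<open>N = nil2 1 w\<close>. The difference of both sides is a multiple of \<open>z\<close> of degree two in \<open>z\<close>, so two
  values of \<open>z\<close> determine its coefficients.\<close>

lemma commuting_unipotent_conjugates:
  fixes b :: "'k::idom mat2"
  assumes x: "x \<noteq> 0" "y \<noteq> 0" "x \<noteq> y"
    and comm: "\<And>z. z \<in> {x, y} \<Longrightarrow>
      b * ((1 + nil2 z w) * b * (1 - nil2 z w)) = ((1 + nil2 z w) * b * (1 - nil2 z w)) * b"
  shows "m21 b = - (w * w * m12 b)" and "w * w * (m11 b - m22 b) = 2 * w * m21 b"
proof -
  obtain p q r v where b: "b = Mat2 p q r v" by (cases b)
  \<comment> \<open>With \<open>N = nil2 1 w\<close> and \<open>C = N * b - b * N\<close>, the
    scalar \<open>k\<close> satisfies \<open>N * b * N = k N\<close>, and \<open>c\<close>,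
    \<open>c12\<close>, \<open>c21\<close> are entries of \<open>C\<close>. The commutator of
    \<open>b\<close> and its conjugate is then \<open>z (b C - C b + z k C)\<close>.\<close>
  define k where "k = w * p + w * w * q - r - w * v"
  define c where "c = - r - q * w * w"
  define c12 where "c12 = 2 * w * q + p - v"
  define c21 where "c21 = w * w * (p - v) - 2 * w * r"
  note cs = k_def c_def c12_def c21_def
  have e: "q * c21 - r * c12 + z * k * c = 0" "2 * r * c + (v - p) * c21 + z * k * c21 = 0"
    if "z \<in> {x, y}" for z
  proof -
    have z: "z \<noteq> 0" using that x by auto
    define M where "M = (1 + nil2 z w) * b * (1 - nil2 z w)"
    have "m11 (b * M) - m11 (M * b) = z * (q * c21 - r * c12 + z * k * c)"
      "m21 (b * M) - m21 (M * b) = z * (2 * r * c + (v - p) * c21 + z * k * c21)"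
      unfolding M_def b nil2_def mat2_defs mat2.sel cs by (simp_all add: algebra_simps)
    then show "q * c21 - r * c12 + z * k * c = 0" "2 * r * c + (v - p) * c21 + z * k * c21 = 0"
      using z comm[OF that] by (simp_all add: M_def)
  qed
  have kc: "k * c = 0" "k * c21 = 0"
  proof -
    have mem: "x \<in> {x, y}" "y \<in> {x, y}" by simp_all
    have "(x - y) * (k * c) = (q * c21 - r * c12 + x * k * c) - (q * c21 - r * c12 + y * k * c)"
      by (simp add: algebra_simps)
    moreover have "(x - y) * (k * c21) =
        (2 * r * c + (v - p) * c21 + x * k * c21) - (2 * r * c + (v - p) * c21 + y * k * c21)"
      by (simp add: algebra_simps)
    ultimately have "(x - y) * (k * c) = 0" "(x - y) * (k * c21) = 0"
      unfolding e[OF mem(1)] e[OF mem(2)] by simp_all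
    then show "k * c = 0" "k * c21 = 0" using x by simp_all
  qed
  have "c = 0 \<and> c21 = 0"
  proof (cases "k = 0")
    \<comment> \<open>Without the term in \<open>k\<close>, the second relation reduces to
      \<open>c * c = 0\<close>.\<close>
    case True
    then have wr: "w * (p - v) = r - w * w * q" by (simp add: k_def algebra_simps)
    have "c21 = w * (w * (p - v)) - 2 * w * r" by (simp add: c21_def)
    then have c21: "c21 = w * c" unfolding wr by (simp add: c_def algebra_simps)
    have "2 * r * c + (v - p) * c21 = c * (2 * r - w * (p - v))" unfolding c21 by (simp add: algebra_simps)
    also have "\<dots> = - (c * c)" unfolding wr by (simp add: c_def algebra_simps)
    finally have "c * c = 0" using e(2)[of x] True by simp
    then show ?thesis using c21 by simp
  qed (use kc in simp)
  moreover have "r = - c - w * w * q" "w * w * (p - v) = c21 + 2 * w * r"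
    by (simp_all add: c_def c21_def algebra_simps)
  ultimately show "m21 b = - (w * w * m12 b)" "w * w * (m11 b - m22 b) = 2 * w * m21 b"
    by (simp_all add: b)
qed

text \<open>The directions \<open>1\<close> and \<open>w\<close> force
  \<open>m21 b = - m12 b\<close> and \<open>m21 b = - (w * w * m12 b)\<close>, so the off-diagonal
  entries vanish. The difference of the diagonal entries is \<open>2 * m21 b\<close>.\<close>

lemma scalar_if_commuting_unipotent_conjugates:
  fixes b :: "'k::idom mat2"
  assumes "x \<noteq> 0" "y \<noteq> 0" "x \<noteq> y" "x' \<noteq> 0" "y' \<noteq> 0" "x' \<noteq> y'" and w: "w * w \<noteq> 1"
    and "\<And>z. z \<in> {x, y} \<Longrightarrow>
      b * ((1 + nil2 z 1) * b * (1 - nil2 z 1)) = ((1 + nil2 z 1) * b * (1 - nil2 z 1)) * b"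
    and "\<And>z. z \<in> {x', y'} \<Longrightarrow>
      b * ((1 + nil2 z w) * b * (1 - nil2 z w)) = ((1 + nil2 z w) * b * (1 - nil2 z w)) * b"
  shows "b = Mat2 (m11 b) 0 0 (m11 b)"
proof -
  have 1: "m21 b = - m12 b" "m11 b - m22 b = 2 * m21 b"
    using commuting_unipotent_conjugates[of x y b 1] assms by simp_all
  have "m21 b = - (w * w * m12 b)"
    using commuting_unipotent_conjugates(1)[of x' y' b w] assms by blast
  then have "(w * w - 1) * m12 b = 0" using 1 by (simp add: algebra_simps)
  then have "m12 b = 0" using w by simp
  then show ?thesis using 1 by (intro mat2.expand) simp
qed

section \<open>Groups whose localization is not soluble\<close>

text \<open>\<open>b\<close> is taken from the last nontrivial term of the derived series of
  \<open>H\<close>, which is abelian and normalized by \<open>H\<close>.\<close>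

lemma (in group) solvable_seq_commuting_conjugates:
  assumes H: "solvable_seq G H" "H \<noteq> {\<one>}"
  obtains b where "b \<in> H" "b \<noteq> \<one>"
    and "\<And>g. g \<in> H \<Longrightarrow> (g \<otimes> b \<otimes> inv g) \<otimes> b = b \<otimes> (g \<otimes> b \<otimes> inv g)"
proof -
  have sH: "subgroup H G" using solvable_imp_subgroup[OF H(1)] .
  define D where "D n = (derived G ^^ n) H" for n
  have sD: "subgroup (D n) G" for n unfolding D_def by (rule exp_of_derived_is_subgroup[OF sH])
  have ex: "\<exists>n. D n = {\<one>}" using solvable_imp_trivial_derived_seq[OF H(1)] by (simp add: D_def)
  define n where "n = (LEAST n. D n = {\<one>})"
  have n: "D n = {\<one>}" unfolding n_def using ex by (rule LeastI_ex)
  have "n \<noteq> 0" using n H(2) by (metis D_def funpow_0)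
  then obtain k where k: "n = Suc k" by (cases n) auto
  have nk: "D k \<noteq> {\<one>}" using not_less_Least[of k "\<lambda>n. D n = {\<one>}"] k by (auto simp: n_def)
  then obtain b where b: "b \<in> D k" "b \<noteq> \<one>" using subgroup.one_closed[OF sD] by blast
  have DH: "D m \<subseteq> H" for m
  proof (induction m)
    case (Suc m)
    then show ?case using derived_incl[OF Suc sH] by (simp add: D_def)
  qed (simp add: D_def)
  have conj: "g \<otimes> x \<otimes> inv g \<in> D m" if "g \<in> H" "x \<in> D m" for g x m
    using that(2)
  proof (induction m arbitrary: x)
    case 0
    then show ?case
      using that(1) by (simp add: D_def subgroup.m_closed[OF sH] subgroup.m_inv_closed[OF sH])
  next
    case (Suc m)
    have g: "g \<in> carrier G" using that(1) subgroup.mem_carrier[OF sH] by blast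
    define c where "c = (\<lambda>x. g \<otimes> x \<otimes> inv g)"
    have "c \<in> hom G G"
    proof (rule homI)
      fix x y assume "x \<in> carrier G" "y \<in> carrier G"
      then have "c x \<otimes> c y = g \<otimes> x \<otimes> (inv g \<otimes> g) \<otimes> y \<otimes> inv g"
        using g unfolding c_def by (simp only: m_assoc m_closed inv_closed)
      then show "c (x \<otimes> y) = c x \<otimes> c y"
        using g \<open>x \<in> carrier G\<close> \<open>y \<in> carrier G\<close> by (simp add: c_def m_assoc)
    qed (simp add: c_def g)
    then interpret c: group_hom G G c
      by (simp add: group_hom_def group_hom_axioms_def group_axioms)
    have "c ` D (Suc m) = derived G (c ` D m)"
      using c.derived_img[OF subgroup.subset[OF sD[of m]]] by (simp add: D_def)
    also have "\<dots> \<subseteq> derived G (D m)" using Suc.IH by (intro mono_derived) (auto simp: c_def)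
    finally show ?case using Suc.prems by (auto simp: c_def D_def)
  qed
  have comm: "x \<otimes> y = y \<otimes> x" if xy: "x \<in> D k" "y \<in> D k" for x y
  proof -
    have c: "x \<in> carrier G" "y \<in> carrier G" using xy subgroup.mem_carrier[OF sD] by auto
    have "x \<otimes> y \<otimes> inv x \<otimes> inv y \<in> derived G (D k)"
      unfolding derived_def using xy by (blast intro: generate.incl)
    then have "x \<otimes> y \<otimes> inv x \<otimes> inv y = \<one>" using n k by (simp add: D_def)
    then show ?thesis using c by (metis inv_closed inv_equality inv_inv inv_mult_group m_assoc m_closed)
  qed
  show ?thesis
    by (rule that[of b]) (use b DH comm conj in auto)
qed

lemma finite_last_failure:
  assumes "finite F" "Q F" "\<not> Q {}"
  shows "\<exists>A g. insert g A \<subseteq> F \<and> Q (insert g A) \<and> \<not> Q A"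
  using assms
proof (induction F rule: finite_induct)
  case (insert g F)
  then show ?case by (cases "Q F") blast+
qed blast

lemma (in comm_group) generate_insert:
  assumes "A \<subseteq> carrier G" "g \<in> carrier G"
  shows "generate G (insert g A) = {x \<otimes> g [^] (i::int) | x i. x \<in> generate G A}"
proof
  note adj = subgroup_adjoin[OF generate_is_subgroup[OF assms(1)] assms(2)]
  have "A \<subseteq> generate G A" by (blast intro: generate.incl)
  then show "generate G (insert g A) \<subseteq> {x \<otimes> g [^] (i::int) | x i. x \<in> generate G A}"
    using adj by (intro generate_subgroup_incl) auto
  have s: "subgroup (generate G (insert g A)) G" using assms by (intro generate_is_subgroup) auto
  have "x \<otimes> g [^] i \<in> generate G (insert g A)" if "x \<in> generate G A" for x and i :: int
    using that mono_generate[of A "insert g A"] s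
    by (intro subgroup.m_closed[OF s] subgroup_int_pow_closed[OF s]) (auto intro: generate.incl)
  then show "{x \<otimes> g [^] (i::int) | x i. x \<in> generate G A} \<subseteq> generate G (insert g A)" by blast
qed

text \<open>Adjoin the generators one after the other to the trivial subgroup: \<open>t\<close> is the first one that makes the
  exponent of the quotient finite.\<close>

lemma (in comm_group) infinite_exponent_imp_cyclic_section:
  assumes F: "finite F" "F \<subseteq> carrier G"
    and exp: "\<And>m::nat. m > 0 \<Longrightarrow> \<exists>x \<in> generate G F. x [^] m \<noteq> \<one>"
  obtains W t m where "subgroup W G" "t \<in> generate G F" "(m::nat) > 0"
    and "\<And>i::int. t [^] i \<in> W \<Longrightarrow> i = 0"
    and "\<And>x. x \<in> generate G F \<Longrightarrow> \<exists>w \<in> W. \<exists>i::int. x [^] m = w \<otimes> t [^] i"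
proof -
  define Q where "Q A \<longleftrightarrow> (\<exists>m::nat. m > 0 \<and> (\<forall>x \<in> generate G F. x [^] m \<in> generate G A))" for A
  have gF: "generate G F \<subseteq> carrier G" using generate_incl[OF F(2)] .
  have "Q F" unfolding Q_def by (rule exI[of _ 1]) (use gF in auto)
  moreover have "\<not> Q {}" unfolding Q_def using exp generate_empty by (metis singletonD)
  ultimately obtain A t where A: "insert t A \<subseteq> F" "Q (insert t A)" "\<not> Q A"
    using finite_last_failure[OF F(1), of Q] by blast
  have tA: "t \<in> carrier G" "A \<subseteq> carrier G" using A(1) F(2) by auto
  define W where "W = generate G A"
  have W: "subgroup W G" unfolding W_def by (rule generate_is_subgroup[OF tA(2)])
  obtain m :: nat where m: "m > 0" "\<And>x. x \<in> generate G F \<Longrightarrow> x [^] m \<in> generate G (insert t A)"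
    using A(2) unfolding Q_def by blast
  have dec: "\<exists>w \<in> W. \<exists>i::int. x [^] m = w \<otimes> t [^] i" if "x \<in> generate G F" for x
    using m(2)[OF that] unfolding generate_insert[OF tA(2,1)] W_def by blast
  \<comment> \<open>Otherwise the exponent \<open>m * n\<close> would carry the whole group into
    \<open>W\<close>, against the choice of \<open>A\<close>.\<close>
  have no: "\<not> t [^] n \<in> W" if "n > 0" for n :: nat
  proof
    assume tn: "t [^] n \<in> W"
    have "x [^] (m * n) \<in> W" if x: "x \<in> generate G F" for x
    proof -
      obtain w i where w: "w \<in> W" "x [^] m = w \<otimes> t [^] (i::int)" using dec[OF x] by blast
      have wc: "w \<in> carrier G" using w(1) by (rule subgroup.mem_carrier[OF W])
      have "x \<in> carrier G" using x gF by blast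
      then have "x [^] (m * n) = (x [^] m) [^] n" by (simp add: nat_pow_pow)
      also have "\<dots> = w [^] n \<otimes> (t [^] i) [^] n" using w wc tA by (simp add: nat_pow_distrib)
      also have "(t [^] i) [^] n = (t [^] n) [^] i"
        using tA by (simp add: int_pow_int[symmetric] int_pow_pow mult.commute)
      finally show ?thesis
        using w(1) tn W by (simp add: subgroup.m_closed subgroup_nat_pow_closed subgroup_int_pow_closed)
    qed
    then have "Q A" unfolding Q_def W_def using m(1) that by (intro exI[of _ "m * n"]) simp
    then show False using A(3) by blast
  qed
  have "i = 0" if "t [^] i \<in> W" for i :: int
  proof (rule ccontr)
    assume "i \<noteq> 0"
    have "t [^] nat \<bar>i\<bar> = t [^] \<bar>i\<bar>" by (rule pow_nat) simp
    moreover have "\<bar>i\<bar> = i \<or> \<bar>i\<bar> = - i" by linarith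
    ultimately have "t [^] nat \<bar>i\<bar> = t [^] i \<or> t [^] nat \<bar>i\<bar> = inv (t [^] i)"
      using int_pow_neg[OF tA(1), of i] by metis
    then have "t [^] nat \<bar>i\<bar> \<in> W" using that subgroup.m_inv_closed[OF W] by metis
    then show False using no[of "nat \<bar>i\<bar>"] \<open>i \<noteq> 0\<close> by simp
  qed
  moreover have "t \<in> generate G F" using A(1) by (auto intro: generate.incl)
  ultimately show ?thesis using that[OF W _ m(1) _ dec] by blast
qed

section \<open>Roots of unity, and local groups of pairs of units\<close>

text \<open>A root of \<open>1 + z + ... + z^(q-1)\<close> differs from 1, where this sum has the
  nonzero value \<open>q\<close>.\<close>

lemma primitive_root_exists:
  assumes q: "prime (q::nat)" and char: "of_nat q \<noteq> (0 :: 'k::alg_closed_field)"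
  shows "\<exists>z::'k. z ^ q = 1 \<and> z \<noteq> 1"
proof -
  have q1: "q > 1" using q by (rule prime_gt_1_nat)
  obtain z :: 'k where "(\<Sum>k\<le>q - 1. 1 * z ^ k) = 0"
    using alg_closed[of "q - 1" "\<lambda>_. 1 :: 'k"] q1 by auto
  then have z: "(\<Sum>k<q. z ^ k) = 0"
    using q1 by (metis (no_types, lifting) Suc_diff_1 lessThan_Suc_atMost mult_1 sum.cong zero_less_one less_trans)
  have "z \<noteq> 1" using z char by auto
  moreover have "z ^ q - 1 = (z - 1) * (\<Sum>k<q. z ^ k)" by (rule power_diff_1_eq)
  ultimately show ?thesis using z by auto
qed

text \<open>The character of \<open>G\<close> will take its values on the diagonal; pairs leave room
  for roots off the diagonal.\<close>

definition units_pair :: "('k::field \<times> 'k) monoid" where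
  "units_pair = \<lparr>carrier = {x. fst x \<noteq> 0 \<and> snd x \<noteq> 0},
     mult = (\<lambda>x y. (fst x * fst y, snd x * snd y)), one = (1, 1)\<rparr>"

lemma units_pair_simps [simp]:
  "x \<in> carrier units_pair \<longleftrightarrow> fst x \<noteq> 0 \<and> snd x \<noteq> 0"
  "x \<otimes>\<^bsub>units_pair\<^esub> y = (fst x * fst y, snd x * snd y)"
  "\<one>\<^bsub>units_pair\<^esub> = (1, 1)"
  by (simp_all add: units_pair_def)

lemma comm_group_units_pair: "comm_group (units_pair :: ('k::field \<times> 'k) monoid)"
proof (rule comm_groupI)
  fix x :: "'k \<times> 'k" assume "x \<in> carrier units_pair"
  then show "\<exists>y \<in> carrier units_pair. y \<otimes>\<^bsub>units_pair\<^esub> x = \<one>\<^bsub>units_pair\<^esub>"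
    by (intro bexI[of _ "(inverse (fst x), inverse (snd x))"]) auto
qed (auto simp: mult.assoc mult.commute)

lemma units_pair_pow: "x [^]\<^bsub>units_pair\<^esub> (n::nat) = (fst x ^ n, snd x ^ n)"
  by (induction n) (simp_all add: mult.commute)

text \<open>The coefficient of \<open>u\<^sup>n\<close> is multiplied by \<open>(fst y)\<^sup>n\<close> and conjugated with \<open>diag(1, snd y / fst y)\<close>.\<close>

definition mat_act :: "'k::field \<times> 'k \<Rightarrow> nat \<Rightarrow> 'k mat2 \<Rightarrow> 'k mat2" where
  "mat_act y n A = Mat2 (fst y ^ n * m11 A) (fst y ^ Suc n / snd y * m12 A)
     (fst y ^ n * snd y / fst y * m21 A) (fst y ^ n * m22 A)"

lemma graded_action_mat_act:
  fixes Y :: "('k::field \<times> 'k) set"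
  assumes "subgroup Y units_pair"
  shows "graded_action (units_pair\<lparr>carrier := Y\<rparr>) mat_act"
proof -
  interpret U: comm_group "units_pair :: ('k::field \<times> 'k) monoid" by (rule comm_group_units_pair)
  interpret Y: subgroup Y "units_pair :: ('k::field \<times> 'k) monoid" by fact
  show ?thesis
  proof (intro graded_action.intro graded_action_axioms.intro U.subgroup_imp_group assms)
    fix y n m and r s :: "'k mat2" assume "y \<in> carrier (units_pair\<lparr>carrier := Y\<rparr>)"
    then have y: "fst y \<noteq> 0" "snd y \<noteq> 0" using Y.subset by auto
    show "mat_act y n (r + s) = mat_act y n r + mat_act y n s"
      by (simp add: mat_act_def plus_mat2_def algebra_simps add_divide_distrib)
    show "mat_act y (m + n) (r * s) = mat_act y m r * mat_act y n s"
      using y by (simp add: mat_act_def times_mat2_def field_simps power_add)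
    show "mat_act y 0 1 = 1" by (simp add: mat_act_def one_mat2_def)
  next
    fix x y n and r :: "'k mat2"
    assume "x \<in> carrier (units_pair\<lparr>carrier := Y\<rparr>)" "y \<in> carrier (units_pair\<lparr>carrier := Y\<rparr>)"
    then have "fst y \<noteq> 0" "snd y \<noteq> 0" "fst x \<noteq> 0" "snd x \<noteq> 0"
      using Y.mem_carrier[of x] Y.mem_carrier[of y] by simp_all
    then show "mat_act (x \<otimes>\<^bsub>units_pair\<lparr>carrier := Y\<rparr>\<^esub> y) n r = mat_act x n (mat_act y n r)"
      by (simp add: mat_act_def field_simps power_mult_distrib)
  qed (simp add: mat_act_def)
qed

text \<open>The operator is diagonal with respect to the four matrix entries, and its eigenvalues
  are the geometric sums in \<open>sum\<close>.\<close>

lemma bij_norm_mat_act: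
  fixes y :: "'k::field \<times> 'k"
  assumes y: "fst y \<noteq> 0" "snd y \<noteq> 0"
    and sum: "\<And>w. w \<in> {fst y ^ n, fst y ^ Suc n / snd y, fst y ^ n * snd y / fst y} \<Longrightarrow> (\<Sum>i<q. w ^ i) \<noteq> 0"
  shows "bij (\<lambda>A. \<Sum>i<q. mat_act (y [^]\<^bsub>units_pair\<^esub> i) n A)"
proof -
  define u where "u w = (\<Sum>i<q. w ^ i)" for w :: 'k
  define a b c where "a = u (fst y ^ n)" and "b = u (fst y ^ Suc n / snd y)"
    and "c = u (fst y ^ n * snd y / fst y)"
  have nz: "a \<noteq> 0" "b \<noteq> 0" "c \<noteq> 0" using sum by (auto simp: a_def b_def c_def u_def)
  have pw: "fst (y [^]\<^bsub>units_pair\<^esub> i) = fst y ^ i" "snd (y [^]\<^bsub>units_pair\<^esub> i) = snd y ^ i"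
    "(fst y ^ i) ^ n = (fst y ^ n) ^ i" for i :: nat
    by (simp_all add: units_pair_pow mult.commute flip: power_mult)
  have "(\<Sum>i<q. mat_act (y [^]\<^bsub>units_pair\<^esub> i) n A) = Mat2 (a * m11 A) (b * m12 A) (c * m21 A) (a * m22 A)" for A
    by (rule mat2.expand) (simp add: mat2_sel_sum mat_act_def pw a_def b_def c_def u_def sum_distrib_right
        power_divide power_mult_distrib)
  then have eq: "(\<lambda>A. \<Sum>i<q. mat_act (y [^]\<^bsub>units_pair\<^esub> i) n A) =
      (\<lambda>A. Mat2 (a * m11 A) (b * m12 A) (c * m21 A) (a * m22 A))" by blast
  show ?thesis
    unfolding eq
  proof (rule bijI)
    show "inj (\<lambda>A. Mat2 (a * m11 A) (b * m12 A) (c * m21 A) (a * m22 A))"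
      using nz by (auto intro!: injI mat2.expand)
    show "surj (\<lambda>A. Mat2 (a * m11 A) (b * m12 A) (c * m21 A) (a * m22 A))"
      by (rule surjI[where f = "\<lambda>A. Mat2 (m11 A / a) (m12 A / b) (m21 A / c) (m22 A / a)"]) (use nz in simp)
  qed
qed

text \<open>If the sum vanishes, \<open>w\<close> is a \<open>q\<close>-th root of unity different
  from 1; but \<open>w ^ e = 1\<close> with \<open>e\<close> coprime to \<open>q\<close> gives
  \<open>w = 1\<close>.\<close>

lemma geometric_sum_nonzero:
  fixes w :: "'k::field"
  assumes char: "of_nat q \<noteq> (0::'k)" and e: "coprime e q"
    and ord: "w ^ q = 1 \<Longrightarrow> w ^ e = 1"
  shows "(\<Sum>i<q. w ^ i) \<noteq> 0"
proof
  assume 0: "(\<Sum>i<q. w ^ i) = 0"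
  have "w ^ q - 1 = (w - 1) * (\<Sum>i<q. w ^ i)" by (rule power_diff_1_eq)
  then have wq: "w ^ q = 1" using 0 by simp
  have "w \<noteq> 1" using 0 char by auto
  have we: "w ^ e = 1" using ord[OF wq] .
  have "e \<noteq> 0 \<or> q = 1" using e by (cases "e = 0") simp_all
  moreover have "q \<noteq> 1" using 0 by auto
  ultimately have "e \<noteq> 0" by simp
  then obtain x y where "e * x = q * y + 1" using bezout_nat[of e q] e by (auto simp: coprime_iff_gcd_eq_1)
  then have "w ^ (e * x) = w ^ (q * y) * w" by simp
  then have "w = 1" using we wq by (simp add: power_mult)
  then show False using \<open>w \<noteq> 1\<close> by simp
qed

text \<open>The least exponent works: a factor \<open>q\<close> in it could be cancelled, since
  \<open>q\<close>-th powers are injective.\<close>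

lemma pi_local_torsion_coprime:
  assumes H: "pi_local \<pi> H" and y: "y \<in> carrier H" and d: "d > 0" "y [^]\<^bsub>H\<^esub> (d::nat) = \<one>\<^bsub>H\<^esub>"
    and q: "prime (q::nat)" "q \<notin> \<pi>"
  obtains e :: nat where "e > 0" "y [^]\<^bsub>H\<^esub> e = \<one>\<^bsub>H\<^esub>" "coprime e q"
proof -
  interpret H: group H using H by (simp add: pi_local_def)
  define e where "e = (LEAST e. e > 0 \<and> y [^]\<^bsub>H\<^esub> (e::nat) = \<one>\<^bsub>H\<^esub>)"
  have e: "e > 0 \<and> y [^]\<^bsub>H\<^esub> e = \<one>\<^bsub>H\<^esub>" unfolding e_def by (rule LeastI[of _ d]) (use d in simp)
  have "\<not> q dvd e"
  proof
    assume "q dvd e"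
    then obtain k where k: "e = k * q" by (metis dvd_def mult.commute)
    have "(y [^]\<^bsub>H\<^esub> k) [^]\<^bsub>H\<^esub> q = \<one>\<^bsub>H\<^esub> [^]\<^bsub>H\<^esub> q" using e y by (simp add: k H.nat_pow_pow)
    moreover have "inj_on (\<lambda>x. x [^]\<^bsub>H\<^esub> q) (carrier H)" using H q by (simp add: pi_local_def bij_betw_def)
    ultimately have "y [^]\<^bsub>H\<^esub> k = \<one>\<^bsub>H\<^esub>"
      using inj_onD[of "\<lambda>x. x [^]\<^bsub>H\<^esub> q" "carrier H" "y [^]\<^bsub>H\<^esub> k" "\<one>\<^bsub>H\<^esub>"] y by simp
    moreover have "k > 0" "k < e" using e k prime_gt_1_nat[OF q(1)] by auto
    ultimately show False using not_less_Least[of k] unfolding e_def by blast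
  qed
  then have "coprime e q" using prime_imp_coprime[OF q(1)] coprime_commute by blast
  then show ?thesis using that e by blast
qed

lemma exists_prime_avoiding:
  assumes "finite \<pi>"
  shows "\<exists>q::nat. prime q \<and> q \<notin> \<pi> \<and> q > n"
proof -
  have "infinite ({p::nat. prime p} - ({..n} \<union> \<pi>))"
    using primes_infinite assms by (intro Diff_infinite_finite) simp_all
  then obtain q where "q \<in> {p::nat. prime p} - ({..n} \<union> \<pi>)"
    by (metis finite.emptyI ex_in_conv)
  then show ?thesis by (intro exI[of _ q]) auto
qed

text \<open>A \<open>q\<close>-th root \<open>s\<close> of \<open>t\<close> off the diagonal is
  adjoined to the diagonal group \<open>B\<close>. As \<open>t\<close> has no \<open>q\<close>-th
  root in \<open>B\<close>, this creates no torsion of prime order outside \<pi>, and the local hull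
  can be taken.\<close>

lemma units_pair_hull:
  fixes F :: "('k::alg_closed_field \<times> 'k) set"
  defines "B \<equiv> generate units_pair F"
  assumes F: "finite F" "F \<subseteq> carrier units_pair" and \<pi>: "finite \<pi>"
    and diag: "\<And>x. x \<in> B \<Longrightarrow> fst x = snd x"
    and char: "\<And>q. prime (q::nat) \<Longrightarrow> q \<notin> \<pi> \<Longrightarrow> of_nat q \<noteq> (0::'k)"
    and tf: "\<And>q x. prime (q::nat) \<Longrightarrow> q \<notin> \<pi> \<Longrightarrow> x \<in> B \<Longrightarrow> fst x ^ q = 1 \<Longrightarrow> fst x = 1"
    and exp: "\<And>m::nat. m > 0 \<Longrightarrow> \<exists>x \<in> B. fst x ^ m \<noteq> 1"
  obtains Y q t s where "subgroup Y units_pair" "pi_local \<pi> (units_pair\<lparr>carrier := Y\<rparr>)" "B \<subseteq> Y"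
    and "prime (q::nat)" "q \<notin> \<pi>" "t \<in> B" "fst t \<noteq> 1" "s \<in> Y" "s [^]\<^bsub>units_pair\<^esub> q = t"
    and "(snd s / fst s) * (snd s / fst s) \<noteq> 1"
    and "\<And>y. y \<in> Y \<Longrightarrow> \<exists>n>0. y [^]\<^bsub>units_pair\<^esub> (n::nat) \<in> B"
proof -
  let ?U = "units_pair :: ('k \<times> 'k) monoid"
  interpret U: comm_group ?U by (rule comm_group_units_pair)
  have sB: "subgroup B ?U" unfolding B_def by (rule U.generate_is_subgroup[OF F(2)])
  have "\<exists>x \<in> generate ?U F. x [^]\<^bsub>?U\<^esub> m \<noteq> \<one>\<^bsub>?U\<^esub>" if "m > 0" for m :: nat
    using exp[OF that] by (auto simp: B_def units_pair_pow)
  from U.infinite_exponent_imp_cyclic_section[OF F this]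
  obtain W t m where W: "subgroup W ?U" and t: "t \<in> B" and m: "(m::nat) > 0"
    and tW: "\<And>i::int. t [^]\<^bsub>?U\<^esub> i \<in> W \<Longrightarrow> i = 0"
    and dec: "\<And>x. x \<in> B \<Longrightarrow> \<exists>w \<in> W. \<exists>i::int. x [^]\<^bsub>?U\<^esub> m = w \<otimes>\<^bsub>?U\<^esub> t [^]\<^bsub>?U\<^esub> i"
    unfolding B_def by metis
  have tc: "t \<in> carrier ?U" using t sB by (rule subgroup.mem_carrier[rotated])
  \<comment> \<open>\<open>q > m\<close> keeps \<open>t\<close> from having a \<open>q\<close>-th
    root in \<open>B\<close>, and \<open>q > 2\<close> ensures \<open>z * z \<noteq> 1\<close>
    below.\<close>
  obtain q :: nat where q: "prime q" "q \<notin> \<pi>" "q > max m 2"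
    using exists_prime_avoiding[OF \<pi>] by blast
  \<comment> \<open>For a root \<open>x\<close>, the decomposition \<open>x^m = w t^i\<close> would
    put \<open>t^(m - i q)\<close> into \<open>W\<close>, so that \<open>q\<close> would divide
    \<open>m\<close>.\<close>
  have no_root: "\<not> (\<exists>x \<in> B. x [^]\<^bsub>?U\<^esub> q = t)"
  proof
    assume "\<exists>x \<in> B. x [^]\<^bsub>?U\<^esub> q = t"
    then obtain x where x: "x \<in> B" "x [^]\<^bsub>?U\<^esub> q = t" by blast
    have xc: "x \<in> carrier ?U" using x(1) sB by (rule subgroup.mem_carrier[rotated])
    obtain w i where w: "w \<in> W" "x [^]\<^bsub>?U\<^esub> m = w \<otimes>\<^bsub>?U\<^esub> t [^]\<^bsub>?U\<^esub> (i::int)" using dec[OF x(1)] by blast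
    have wc: "w \<in> carrier ?U" using w(1) W by (rule subgroup.mem_carrier[rotated])
    have "t [^]\<^bsub>?U\<^esub> int m = (x [^]\<^bsub>?U\<^esub> m) [^]\<^bsub>?U\<^esub> q"
      unfolding x(2)[symmetric] int_pow_int using xc by (simp only: U.nat_pow_pow mult.commute)
    also have "\<dots> = w [^]\<^bsub>?U\<^esub> q \<otimes>\<^bsub>?U\<^esub> (t [^]\<^bsub>?U\<^esub> i) [^]\<^bsub>?U\<^esub> q"
      unfolding w(2) using wc tc U.int_pow_closed U.nat_pow_distrib by blast
    also have "(t [^]\<^bsub>?U\<^esub> i) [^]\<^bsub>?U\<^esub> q = t [^]\<^bsub>?U\<^esub> (i * int q)"
      unfolding int_pow_int[symmetric] using tc by (rule U.int_pow_pow)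
    finally have "t [^]\<^bsub>?U\<^esub> int m \<otimes>\<^bsub>?U\<^esub> inv\<^bsub>?U\<^esub> (t [^]\<^bsub>?U\<^esub> (i * int q)) = w [^]\<^bsub>?U\<^esub> q"
      using tc wc by (simp only: U.inv_solve_right' U.int_pow_closed U.nat_pow_closed U.m_closed)
    then have "t [^]\<^bsub>?U\<^esub> (int m - i * int q) \<in> W"
      using tc w(1) W by (simp only: U.int_pow_diff subgroup_nat_pow_closed)
    then have "int m = i * int q" using tW by fastforce
    then have "q dvd m" by (metis dvd_triv_right int_dvd_int_iff)
    then show False using m q(3) by (auto dest: dvd_imp_le)
  qed
  have root: "\<exists>y \<in> carrier ?U. y [^]\<^bsub>?U\<^esub> r = x"
    if r: "prime r" "r \<notin> \<pi>" and x: "x \<in> carrier ?U" for r :: nat and x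
  proof -
    have r0: "r > 0" using r(1) by (rule prime_gt_0_nat)
    obtain u v where "u ^ r = fst x" "v ^ r = snd x"
      using nth_root_exists[OF r0] by metis
    then show ?thesis using x r0
      by (intro bexI[of _ "(u, v)"]) (auto simp: units_pair_pow power_0_left)
  qed
  obtain u where u: "u ^ q = fst t" using nth_root_exists[of q "fst t"] prime_gt_0_nat[OF q(1)] by metis
  obtain z :: 'k where z: "z ^ q = 1" "z \<noteq> 1" using primitive_root_exists[OF q(1) char[OF q(1,2)]] by blast
  \<comment> \<open>The factor \<open>z\<close> moves \<open>s\<close> off the diagonal and does not
    affect its \<open>q\<close>-th power.\<close>
  define s where "s = (u, z * u)"
  have q0: "q > 0" using q(3) by simp
  have nz: "u \<noteq> 0" "z \<noteq> 0" using u z q0 tc by (auto simp: power_0_left)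
  have s: "s \<in> carrier ?U" "s [^]\<^bsub>?U\<^esub> q = t"
    using nz u z diag[OF t] by (auto simp: s_def units_pair_pow power_mult_distrib prod_eq_iff)
  have z2: "z * z \<noteq> 1"
  proof
    assume "z * z = 1"
    have "odd q" using prime_odd_nat[OF q(1)] q(3) by simp
    then obtain k where "q = 2 * k + 1" by (rule oddE)
    then have "z ^ q = (z * z) ^ k * z" by (simp add: power_mult power2_eq_square)
    then show False using z \<open>z * z = 1\<close> by simp
  qed
  define B' where "B' = {x \<otimes>\<^bsub>?U\<^esub> s [^]\<^bsub>?U\<^esub> (i::int) | x i. x \<in> B}"
  note adj = U.subgroup_adjoin[OF sB s(1), folded B'_def]
  have tfB: "x = \<one>\<^bsub>?U\<^esub>" if "prime r" "r \<notin> \<pi>" "x \<in> B" "x [^]\<^bsub>?U\<^esub> r = \<one>\<^bsub>?U\<^esub>" for r :: nat and x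
    using tf[OF that(1-3)] that(4) diag[OF that(3)] by (simp add: units_pair_pow prod_eq_iff)
  have tfB': "x = \<one>\<^bsub>?U\<^esub>" if r: "prime r" "r \<notin> \<pi>" and x: "x \<in> B'" "x [^]\<^bsub>?U\<^esub> r = \<one>\<^bsub>?U\<^esub>" for r :: nat and x
  proof -
    obtain y i where y: "y \<in> B" "x = y \<otimes>\<^bsub>?U\<^esub> s [^]\<^bsub>?U\<^esub> (i::int)" using x(1) by (auto simp only: B'_def)
    show ?thesis
      unfolding y(2)
      by (rule U.adjoin_root_torsion_free[OF sB q(1,2) s(1) _ _ _ r y(1) x(2)[unfolded y(2)]])
        (use s(2) t no_root tfB in simp_all)
  qed
  obtain Y where Y: "subgroup Y ?U" "B' \<subseteq> Y" "pi_local \<pi> (?U\<lparr>carrier := Y\<rparr>)"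
    and rad: "\<And>y. y \<in> Y \<Longrightarrow> \<exists>n::nat. n > 0 \<and> y [^]\<^bsub>?U\<^esub> n \<in> B'"
  proof (rule U.local_hull[OF adj(1), where \<pi> = \<pi>], goal_cases)
    case (1 r x)
    show ?case by (rule root[OF 1(2-4)])
  next
    case (2 r x)
    show ?case by (rule tfB'[OF 2(2-5)])
  next
    case (3 Y)
    show ?case by (rule 3(1)[OF 3(2-5)])
  qed
  have "\<exists>n>0. y [^]\<^bsub>?U\<^esub> (n::nat) \<in> B" if yY: "y \<in> Y" for y
  proof -
    obtain n :: nat where n: "n > 0" "y [^]\<^bsub>?U\<^esub> n \<in> B'" using rad[OF yY] by blast
    obtain x i where x: "x \<in> B" "y [^]\<^bsub>?U\<^esub> n = x \<otimes>\<^bsub>?U\<^esub> s [^]\<^bsub>?U\<^esub> (i::int)"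
      using n(2) by (auto simp only: B'_def)
    have xc: "x \<in> carrier ?U" using x(1) sB by (rule subgroup.mem_carrier[rotated])
    have yc: "y \<in> carrier ?U" using yY Y(1) by (rule subgroup.mem_carrier[rotated])
    have "y [^]\<^bsub>?U\<^esub> (n * q) = (y [^]\<^bsub>?U\<^esub> n) [^]\<^bsub>?U\<^esub> q" using yc by (simp only: U.nat_pow_pow)
    also have "\<dots> = x [^]\<^bsub>?U\<^esub> q \<otimes>\<^bsub>?U\<^esub> (s [^]\<^bsub>?U\<^esub> i) [^]\<^bsub>?U\<^esub> q"
      unfolding x(2) using xc s(1) U.int_pow_closed U.nat_pow_distrib by blast
    also have "(s [^]\<^bsub>?U\<^esub> i) [^]\<^bsub>?U\<^esub> q = t [^]\<^bsub>?U\<^esub> i"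
      unfolding s(2)[symmetric] int_pow_int[symmetric] using s(1)
      by (simp only: U.int_pow_pow mult.commute)
    finally have "y [^]\<^bsub>?U\<^esub> (n * q) \<in> B"
      using x(1) t sB
      by (simp only: subgroup.m_closed[OF sB] subgroup_nat_pow_closed U.subgroup_int_pow_closed)
    then show ?thesis using n(1) q0 by (intro exI[of _ "n * q"]) simp
  qed
  moreover have "fst t \<noteq> 1"
  proof
    assume "fst t = 1"
    then have "t = \<one>\<^bsub>?U\<^esub>" using diag[OF t] by (simp add: prod_eq_iff)
    then have "t [^]\<^bsub>?U\<^esub> (1::int) \<in> W" using subgroup.one_closed[OF W] by simp
    then show False using tW by force
  qed
  moreover have "(snd s / fst s) * (snd s / fst s) \<noteq> 1" using nz z2 by (simp add: s_def)
  ultimately show ?thesis using that[of Y q t s] Y adj q t s by blast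
qed

text \<open>By \<open>rad\<close>, each eigenvalue ratio \<open>w\<close> satisfies
  \<open>w ^ N = fst y ^ (n * N)\<close> for some \<open>N > 0\<close>. If \<open>w ^ q = 1\<close>,
  then \<open>y\<close> is torsion; as \<open>Y\<close> is local, an exponent coprime to
  \<open>q\<close> kills \<open>y\<close> and with it \<open>w\<close>, so the geometric sum does
  not vanish.\<close>

lemma pi_local_skew_group_units_pair:
  fixes Y :: "('k::field \<times> 'k) set"
  assumes Y: "subgroup Y units_pair" "pi_local \<pi> (units_pair\<lparr>carrier := Y\<rparr>)"
    and rad: "\<And>y. y \<in> Y \<Longrightarrow> \<exists>n>0. fst y ^ n = snd y ^ (n::nat)"
    and char: "\<And>q. prime (q::nat) \<Longrightarrow> q \<notin> \<pi> \<Longrightarrow> of_nat q \<noteq> (0::'k)"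
  shows "pi_local \<pi> (graded_action.skew_group (units_pair\<lparr>carrier := Y\<rparr>) mat_act)"
proof -
  let ?Y = "units_pair\<lparr>carrier := Y\<rparr>"
  interpret graded_action ?Y mat_act by (rule graded_action_mat_act[OF Y(1)])
  have pow: "y [^]\<^bsub>?Y\<^esub> (i::nat) = y [^]\<^bsub>units_pair\<^esub> i" for y i by (simp add: nat_pow_def)
  show ?thesis
  proof (rule pi_local_skew_group[OF Y(2)])
    fix q n :: nat and y assume q: "prime q" "q \<notin> \<pi>" and yY: "y \<in> carrier ?Y" and n: "n > 0"
    have y: "fst y \<noteq> 0" "snd y \<noteq> 0" using yY subgroup.mem_carrier[OF Y(1), of y] by simp_all
    obtain N :: nat where N: "N > 0" "fst y ^ N = snd y ^ N" using rad[of y] yY by auto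
    show "bij (\<lambda>r. \<Sum>i<q. mat_act (y [^]\<^bsub>?Y\<^esub> i) n r)"
      unfolding pow
    proof (rule bij_norm_mat_act[OF y])
      fix w assume w: "w \<in> {fst y ^ n, fst y ^ Suc n / snd y, fst y ^ n * snd y / fst y}"
      have wN: "w ^ N = fst y ^ (n * N)"
        using w N y
        by (auto simp: power_divide power_mult_distrib power_add simp flip: power_mult)
      obtain e where "coprime e q" "w ^ q = 1 \<longrightarrow> w ^ e = 1"
      proof (cases "w ^ q = 1")
        case True
        have "fst y ^ (n * N * q) = 1"
          using True wN by (metis mult.commute power_mult power_one)
        moreover from this have "snd y ^ (n * N * q) = 1"
          using N(2) by (metis mult.commute mult.left_commute power_mult)
        ultimately have "y [^]\<^bsub>?Y\<^esub> (n * N * q) = \<one>\<^bsub>?Y\<^esub>" by (simp add: pow units_pair_pow)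
        then obtain e :: nat where e: "e > 0" "y [^]\<^bsub>?Y\<^esub> e = \<one>\<^bsub>?Y\<^esub>" "coprime e q"
          using pi_local_torsion_coprime[OF Y(2) yY _ _ q] n N(1) prime_gt_0_nat[OF q(1)]
          by (metis mult_pos_pos)
        have ye: "fst y ^ e = 1" "snd y ^ e = 1" using e(2) by (simp_all add: pow units_pair_pow)
        have "(fst y ^ n) ^ e = 1" using ye by (metis mult.commute power_mult power_one)
        then have "w ^ e = 1"
          using w ye by (auto simp: power_divide power_mult_distrib)
        then show ?thesis using that e(3) by blast
      next
        case False
        then show ?thesis using that[of 1] by simp
      qed
      then show "(\<Sum>i<q. w ^ i) \<noteq> 0" using geometric_sum_nonzero[OF char[OF q]] by blast
    qed
  qed
qed

section \<open>Representing \<open>G\<close> in a local skew group\<close>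

lemma pi_localization_lift:
  assumes "group G" "pi_localization \<pi> G L \<phi>" "pi_local \<pi> H" "\<theta> \<in> hom G H"
  obtains \<psi> where "group_hom L H \<psi>" "\<And>x. x \<in> carrier G \<Longrightarrow> \<psi> (\<phi> x) = \<theta> x"
proof -
  obtain \<psi> where "\<psi> \<in> hom L H" "\<And>x. x \<in> carrier G \<Longrightarrow> \<psi> (\<phi> x) = \<theta> x"
    using pi_localization_universal[OF assms] by blast
  moreover have "group L" "group H" using assms(2,3) by (auto simp: pi_localization_def pi_local_def)
  ultimately show ?thesis using that by (simp add: group_hom_def group_hom_axioms_def)
qed

lemma lin_fps_0: "lin_fps 0 = 1"
  by (simp add: lin_fps_def)

lemma lin_fps_minus: "lin_fps (nil2 c w) * lin_fps (nil2 (- c) w) = 1"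
  by (simp add: lin_fps_mult nil2_mult nil2_add) (simp add: nil2_def lin_fps_0 flip: zero_mat2_def)

lemma fps_scalar_square_one:
  fixes p :: "'k::idom fps"
  assumes "p * p = 1" "p $ 0 = 1"
  shows "p = 1"
proof -
  have "(p - 1) * (p + 1) = 0" using assms(1) by (simp add: algebra_simps)
  then have "p = 1 \<or> p = - 1" by (auto simp: add_eq_0_iff2)
  then show ?thesis
  proof
    \<comment> \<open>Comparison of constant coefficients shows that this requires
      \<open>- 1 = 1\<close>.\<close>
    assume p: "p = - 1"
    then have "(- 1 :: 'k) = 1" using assms(2) by simp
    then have "(- 1 :: 'k fps) = 1" by (metis fps_const_1_eq_1 fps_const_neg)
    then show ?thesis using p by simp
  qed
qed

text \<open>Over the domain of power series the relations make \<open>mat_fps f\<close> scalar.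
  Determinant 1 gives a scalar of square 1, and its constant coefficient is 1.\<close>

lemma mat_fps_unique_commuting:
  fixes f :: "'k::field mat2 fps"
  assumes f0: "f $ 0 = 1" and det: "det2 (mat_fps f) = 1"
    and c: "c \<noteq> 0" "d \<noteq> 0" "c \<noteq> d" "c' \<noteq> 0" "d' \<noteq> 0" "c' \<noteq> d'" and w: "w * w \<noteq> 1"
    and comm: "\<And>e v. (e, v) \<in> {(c, 1), (d, 1), (c', w), (d', w)} \<Longrightarrow>
      (lin_fps (nil2 e v) * f * lin_fps (nil2 (- e) v)) * f = f * (lin_fps (nil2 e v) * f * lin_fps (nil2 (- e) v))"
  shows "f = 1"
proof -
  let ?u = "\<lambda>e. fps_const e * (fps_X :: 'k fps)"
  have conj: "mat_fps f * ((1 + nil2 (?u e) (fps_const v)) * mat_fps f * (1 - nil2 (?u e) (fps_const v))) =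
      ((1 + nil2 (?u e) (fps_const v)) * mat_fps f * (1 - nil2 (?u e) (fps_const v))) * mat_fps f"
    if "(e, v) \<in> {(c, 1), (d, 1), (c', w), (d', w)}" for e v
  proof -
    have neg: "mat_fps (lin_fps (nil2 (- e) v)) = 1 - nil2 (?u e) (fps_const v)"
      unfolding mat_fps_lin_nil2 by (simp add: nil2_minus[symmetric] flip: fps_const_neg)
    show ?thesis
      using arg_cong[OF comm[OF that], of mat_fps]
      unfolding mat_fps_mult unfolding neg unfolding mat_fps_lin_nil2 by simp
  qed
  have u: "?u e \<noteq> 0" if "e \<noteq> 0" for e using that by simp
  have uu: "?u e \<noteq> ?u e'" if "e \<noteq> e'" for e e'
  proof
    assume "?u e = ?u e'"
    then have "?u e $ 1 = ?u e' $ 1" by simp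
    then show False using that by simp
  qed
  have w': "fps_const w * fps_const w \<noteq> 1" 
  proof
    assume "fps_const w * fps_const w = 1"
    then have "(fps_const w * fps_const w) $ 0 = (1 :: 'k fps) $ 0" by (rule arg_cong)
    then show False using w by simp
  qed
  have M: "mat_fps f = Mat2 (m11 (mat_fps f)) 0 0 (m11 (mat_fps f))"
    by (rule scalar_if_commuting_unipotent_conjugates[of "?u c" "?u d" "?u c'" "?u d'" "fps_const w"])
       (use c u uu w' conj[of c 1] conj[of d 1] conj[of c' w] conj[of d' w] in \<open>auto simp del: fps_const_mult\<close>)
  define p where "p = m11 (mat_fps f)"
  have "p * p = 1" using det M unfolding p_def[symmetric] by (simp add: det2_def)
  moreover have "p $ 0 = 1" using f0 by (simp add: p_def mat_fps_def)
  ultimately have "p = 1" by (rule fps_scalar_square_one)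
  then have "mat_fps f = mat_fps 1" using M unfolding p_def[symmetric] by (simp add: mat_fps_one one_mat2_def)
  then show ?thesis by (simp add: mat_fps_inject)
qed

text \<open>The representation \<open>\<theta>\<close> of \<open>G\<close> in a local skew group
  extends to \<open>L\<close>. The image of \<open>L\<close> contains \<open>(1, s)\<close> and
  therefore, in \<open>\<Gamma>\<close>, unipotent elements for both directions \<open>1\<close> and
  \<open>w\<close>. If \<open>L\<close> were soluble, some nontrivial \<open>b\<close> in
  \<open>\<Gamma>\<close> would commute with all its conjugates under \<open>\<Gamma>\<close>, which
  \<open>mat_fps_unique_commuting\<close> excludes.\<close>

theorem localization_not_solvable:
  fixes \<chi> \<delta> :: "'a \<Rightarrow> 'k::alg_closed_field"
  assumes G: "group G" and S: "finite S" "S \<subseteq> carrier G" "generate G S = carrier G"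
    and \<pi>: "finite \<pi>" and loc: "pi_localization \<pi> G L \<phi>"
    and \<chi>: "\<And>x y. x \<in> carrier G \<Longrightarrow> y \<in> carrier G \<Longrightarrow> \<chi> (x \<otimes>\<^bsub>G\<^esub> y) = \<chi> x * \<chi> y"
      "\<And>x. x \<in> carrier G \<Longrightarrow> \<chi> x \<noteq> 0"
    and \<delta>: "\<And>x y. x \<in> carrier G \<Longrightarrow> y \<in> carrier G \<Longrightarrow> \<delta> (x \<otimes>\<^bsub>G\<^esub> y) = \<delta> x + \<chi> x * \<delta> y"
    and char: "\<And>q. prime (q::nat) \<Longrightarrow> q \<notin> \<pi> \<Longrightarrow> of_nat q \<noteq> (0::'k)"
    and tf: "\<And>q x. prime (q::nat) \<Longrightarrow> q \<notin> \<pi> \<Longrightarrow> x \<in> carrier G \<Longrightarrow> \<chi> x ^ q = 1 \<Longrightarrow> \<chi> x = 1"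
    and exp: "\<And>m::nat. m > 0 \<Longrightarrow> \<exists>x \<in> carrier G. \<chi> x ^ m \<noteq> 1"
    and a: "a \<in> carrier G" "\<chi> a = 1" "\<delta> a \<noteq> 0"
  shows "\<not> solvable L"
proof
  assume sol: "solvable L"
  interpret G: group G by (rule G)
  have locL: "pi_local \<pi> L" and \<phi>: "\<phi> \<in> hom G L" using loc by (auto simp: pi_localization_def)
  have \<phi>c: "\<phi> x \<in> carrier L" if "x \<in> carrier G" for x using \<phi> that by (auto simp: hom_def)
  let ?U = "units_pair :: ('k \<times> 'k) monoid"
  interpret U: comm_group ?U by (rule comm_group_units_pair)
  define dg where "dg x = (\<chi> x, \<chi> x)" for x
  interpret dg: group_hom G ?U dg
    using \<chi> by (auto simp: group_hom_def group_hom_axioms_def G U.group_axioms dg_def hom_def)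
  define F where "F = dg ` S"
  have F: "finite F" "F \<subseteq> carrier ?U" using S dg.hom_closed by (auto simp: F_def simp del: units_pair_simps)
  have gen: "generate ?U F = dg ` carrier G" unfolding F_def dg.generate_img[OF S(2)] S(3) ..
  have gdiag: "fst x = snd x" if "x \<in> generate ?U F" for x using that by (auto simp: gen dg_def)
  have gtf: "fst x = 1" if "prime q" "q \<notin> \<pi>" "x \<in> generate ?U F" "fst x ^ q = 1" for q :: nat and x
    using that tf by (auto simp: gen dg_def)
  have gexp: "\<exists>x \<in> generate ?U F. fst x ^ m \<noteq> 1" if "m > 0" for m :: nat
    using exp[OF that] by (auto simp: gen dg_def)
  obtain Y q t s where Y: "subgroup Y ?U" "pi_local \<pi> (?U\<lparr>carrier := Y\<rparr>)" "generate ?U F \<subseteq> Y"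
    and q: "prime (q::nat)" "q \<notin> \<pi>" and t: "t \<in> generate ?U F" "fst t \<noteq> 1"
    and s: "s \<in> Y" "s [^]\<^bsub>?U\<^esub> q = t"
    and s2: "(snd s / fst s) * (snd s / fst s) \<noteq> 1"
    and rad: "\<And>y. y \<in> Y \<Longrightarrow> \<exists>n>0. y [^]\<^bsub>?U\<^esub> (n::nat) \<in> generate ?U F"
  proof (rule units_pair_hull[OF F \<pi>], goal_cases)
    case (1 x)
    show ?case by (rule gdiag[OF 1(2)])
  next
    case (2 q)
    show ?case by (rule char[OF 2(2,3)])
  next
    case (3 q x)
    show ?case by (rule gtf[OF 3(2-5)])
  next
    case (4 m)
    show ?case by (rule gexp[OF 4(2)])
  next
    case (5 Y q t s)
    show ?case by (rule 5(1)[OF 5(2-12)])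
  qed
  obtain t' where t': "t' \<in> carrier G" "t = dg t'" using t(1) gen by auto
  have \<chi>t: "\<chi> t' \<noteq> 1" using t(2) t' by (simp add: dg_def)
  let ?Y = "?U\<lparr>carrier := Y\<rparr>"
  interpret A: graded_action ?Y mat_act by (rule graded_action_mat_act[OF Y(1)])
  let ?H = A.skew_group
  have nz: "fst y \<noteq> 0" "snd y \<noteq> 0" if "y \<in> Y" for y
    using subgroup.mem_carrier[OF Y(1) that] by simp_all
  have locH: "pi_local \<pi> ?H"
  proof (rule pi_local_skew_group_units_pair[OF Y(1,2) _ char])
    fix y assume "y \<in> Y"
    then obtain n :: nat where "n > 0" "y [^]\<^bsub>?U\<^esub> n \<in> generate ?U F" using rad by blast
    then show "\<exists>n>0. fst y ^ n = snd y ^ n" using gdiag by (fastforce simp: units_pair_pow)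
  qed
  interpret H: group ?H by (rule A.group_skew_group)
  have dgY: "dg x \<in> Y" if "x \<in> carrier G" for x using that Y(3) gen by blast
  have act_lin: "A.act y (lin_fps M) = lin_fps (mat_act y 1 M)" if "y \<in> Y" for y M
  proof (rule fps_ext)
    fix n
    have y: "y \<in> carrier ?Y" using that by simp
    show "A.act y (lin_fps M) $ n = lin_fps (mat_act y 1 M) $ n"
      using A.a_unit[OF y] A.a_zero[OF y, of n] by (simp add: lin_fps_nth)
  qed
  \<comment> \<open>Subtracting an inner derivation achieves \<open>\<delta>' t' = 0\<close> and
    keeps the value at \<open>a\<close>, where \<open>\<chi> a = 1\<close>.\<close>
  define v where "v = \<delta> t' / (1 - \<chi> t')"
  define \<delta>' where "\<delta>' x = \<delta> x - (1 - \<chi> x) * v" for x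
  have \<delta>': "\<delta>' (x \<otimes>\<^bsub>G\<^esub> y) = \<delta>' x + \<chi> x * \<delta>' y" if "x \<in> carrier G" "y \<in> carrier G" for x y
    using \<delta>[OF that] \<chi>(1)[OF that] by (simp add: \<delta>'_def algebra_simps)
  have \<delta>'t: "\<delta>' t' = 0" using \<chi>t by (simp add: \<delta>'_def v_def)
  have \<delta>'a: "\<delta>' a \<noteq> 0" using a by (simp add: \<delta>'_def)
  define \<theta> where "\<theta> x = (lin_fps (nil2 (\<delta>' x) 1), dg x)" for x
  have "\<theta> \<in> hom G ?H"
  proof (rule homI)
    fix x assume x: "x \<in> carrier G"
    then show "\<theta> x \<in> carrier ?H" using dgY by (simp add: \<theta>_def lin_fps_nth)
    fix y assume y: "y \<in> carrier G"
    have "mat_act (dg x) 1 (nil2 (\<delta>' y) 1) = nil2 (\<chi> x * \<delta>' y) 1"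
      using \<chi>(2)[OF x] by (simp add: mat_act_def nil2_def dg_def)
    then show "\<theta> (x \<otimes>\<^bsub>G\<^esub> y) = \<theta> x \<otimes>\<^bsub>?H\<^esub> \<theta> y"
      using x y act_lin[OF dgY[OF x]] dg.hom_mult[OF x y]
      by (simp add: \<theta>_def \<delta>' lin_fps_mult nil2_mult nil2_add)
  qed
  then obtain \<psi> where \<psi>: "group_hom L ?H \<psi>" and \<psi>\<phi>: "\<And>x. x \<in> carrier G \<Longrightarrow> \<psi> (\<phi> x) = \<theta> x"
    using pi_localization_lift[OF G loc locH] by blast
  interpret \<psi>: group_hom L ?H \<psi> by (rule \<psi>)
  have \<theta>im: "\<theta> x \<in> \<psi> ` carrier L" if "x \<in> carrier G" for x
    using \<psi>\<phi>[OF that] \<phi>c[OF that] by (metis imageI)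
  \<comment> \<open>A \<open>q\<close>-th root of \<open>\<phi> t'\<close> in \<open>L\<close> is
    mapped to a \<open>q\<close>-th root of \<open>\<theta> t' = (1, t)\<close>. Another one is
    \<open>(1, s)\<close>, and roots in the skew group are unique.\<close>
  have sim: "(1, s) \<in> \<psi> ` carrier L"
  proof -
    have "\<phi> t' \<in> (\<lambda>x. x [^]\<^bsub>L\<^esub> q) ` carrier L"
      using locL q \<phi>c[OF t'(1)] by (simp add: pi_local_def bij_betw_def)
    then obtain l where l: "l \<in> carrier L" "\<phi> t' = l [^]\<^bsub>L\<^esub> q" by blast
    have "\<psi> l [^]\<^bsub>?H\<^esub> q = \<theta> t'" using l \<psi>\<phi>[OF t'(1)] by (simp only: \<psi>.hom_nat_pow)
    also have "\<dots> = (1, t)" using \<delta>'t t'(2) by (simp add: \<theta>_def nil2_def lin_fps_0 flip: zero_mat2_def)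
    also have "\<dots> = (1, s) [^]\<^bsub>?H\<^esub> q"
    proof -
      have "A.norm_pow s n 1 = 1" for n
        using s(1) A.act_one[OF A.nat_pow_closed, of s] by (induction n) simp_all
      moreover have "s [^]\<^bsub>?Y\<^esub> q = t" using s(2) by (simp add: nat_pow_def)
      ultimately show ?thesis by (simp add: A.skew_group_pow)
    qed
    finally have eq: "\<psi> l [^]\<^bsub>?H\<^esub> q = (1, s) [^]\<^bsub>?H\<^esub> q" .
    have inj: "inj_on (\<lambda>x. x [^]\<^bsub>?H\<^esub> q) (carrier ?H)" using locH q by (simp add: pi_local_def bij_betw_def)
    have "\<psi> l = (1, s)" using inj_onD[OF inj eq \<psi>.hom_closed[OF l(1)]] s(1) by simp
    then show ?thesis using l(1) by (metis imageI)
  qed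
  have sI: "subgroup (\<psi> ` carrier L) ?H" using \<psi>.subgroup_img_is_subgroup \<psi>.G.subgroup_self by blast
  \<comment> \<open>On this subgroup products are those of power series, and determinant 1 will
    leave no scalar but 1.\<close>
  define \<Lambda> where "\<Lambda> = {p \<in> carrier ?H. snd p = (1, 1) \<and> det2 (mat_fps (fst p)) = 1}"
  have one_mult: "(f, (1,1)) \<otimes>\<^bsub>?H\<^esub> (g, y) = (f * g, y)" for f g y
    using A.act_id[of g] by simp
  have s\<Lambda>: "subgroup \<Lambda> ?H"
  proof (rule H.subgroupI)
    show "\<Lambda> \<subseteq> carrier ?H" by (auto simp: \<Lambda>_def)
    have "\<one>\<^bsub>?H\<^esub> \<in> \<Lambda>" using H.one_closed unfolding \<Lambda>_def by (simp add: mat_fps_one det2_def)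
    then show "\<Lambda> \<noteq> {}" by blast
  next
    fix p p' assume p: "p \<in> \<Lambda>" "p' \<in> \<Lambda>"
    obtain f g where fg: "p = (f, (1,1))" "p' = (g, (1,1))" using p by (auto simp: \<Lambda>_def)
    have "p \<otimes>\<^bsub>?H\<^esub> p' = (f * g, (1,1))" unfolding fg by (rule one_mult)
    moreover have "p \<otimes>\<^bsub>?H\<^esub> p' \<in> carrier ?H" using p by (intro H.m_closed) (auto simp only: \<Lambda>_def)
    ultimately show "p \<otimes>\<^bsub>?H\<^esub> p' \<in> \<Lambda>"
      using p by (simp add: \<Lambda>_def fg mat_fps_mult det2_mult)
  next
    fix p assume p: "p \<in> \<Lambda>"
    then have pc: "p \<in> carrier ?H" by (simp only: \<Lambda>_def mem_Collect_eq)
    obtain f where f: "p = (f, (1,1))" using p by (auto simp: \<Lambda>_def)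
    obtain g y where g: "inv\<^bsub>?H\<^esub> p = (g, y)" by (rule prod.exhaust)
    have "(f, (1,1)) \<otimes>\<^bsub>?H\<^esub> (g, y) = (1, (1,1))" using H.r_inv[OF pc] by (simp add: g[symmetric] f[symmetric])
    then have gy: "f * g = 1" "y = (1,1)" unfolding one_mult by simp_all
    then have "det2 (mat_fps f) * det2 (mat_fps g) = 1"
      by (simp add: det2_mult[symmetric] mat_fps_mult[symmetric]) (simp add: mat_fps_one det2_def)
    then have "det2 (mat_fps g) = 1" using p f by (simp add: \<Lambda>_def)
    then show "inv\<^bsub>?H\<^esub> p \<in> \<Lambda>" using H.inv_closed[OF pc] gy g by (simp add: \<Lambda>_def)
  qed
  define \<Gamma> where "\<Gamma> = \<psi> ` carrier L \<inter> \<Lambda>"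
  have s\<Gamma>: "subgroup \<Gamma> ?H" unfolding \<Gamma>_def using sI s\<Lambda> by (rule H.subgroups_Inter_pair)
  have sol\<Gamma>: "solvable_seq ?H \<Gamma>"
  proof -
    have "solvable_seq ?H (\<psi> ` carrier L)"
      using sol unfolding solvable_def by (rule \<psi>.solvable_imp_solvable_img)
    then obtain n where n: "(derived ?H ^^ n) (\<psi> ` carrier L) = {\<one>\<^bsub>?H\<^esub>}"
      using H.solvable_imp_trivial_derived_seq by blast
    have "(derived ?H ^^ n) \<Gamma> \<subseteq> {\<one>\<^bsub>?H\<^esub>}"
      using H.mono_exp_of_derived[of \<Gamma> "\<psi> ` carrier L" n] n by (simp add: \<Gamma>_def)
    moreover have "\<one>\<^bsub>?H\<^esub> \<in> (derived ?H ^^ n) \<Gamma>"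
      using subgroup.one_closed[OF H.exp_of_derived_is_subgroup[OF s\<Gamma>]] .
    ultimately have "(derived ?H ^^ n) \<Gamma> = {\<one>\<^bsub>?H\<^esub>}" by blast
    then show ?thesis by (rule H.trivial_derived_seq_imp_solvable[OF s\<Gamma>])
  qed
  have lin\<Lambda>: "(lin_fps (nil2 c w), (1,1)) \<in> \<Lambda>" for c w
    using A.one_closed by (simp add: \<Lambda>_def lin_fps_nth mat_fps_lin_nil2 det2_one_plus_nil2)
  \<comment> \<open>\<open>d\<close> belongs to the conjugate of \<open>a\<close> by
    \<open>t'\<close>; two different values are needed for each direction.\<close>
  define c d where "c = \<delta>' a" and "d = \<chi> t' * \<delta>' a"
  have cd: "c \<noteq> 0" "d \<noteq> 0" "c \<noteq> d" using \<delta>'a \<chi>t \<chi>(2)[OF t'(1)] by (auto simp: c_def d_def)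
  have 1: "(lin_fps (nil2 c 1), (1,1)) \<in> \<psi> ` carrier L"
    using \<theta>im[OF a(1)] a(2) by (simp add: \<theta>_def dg_def c_def)
  have 2: "(lin_fps (nil2 d 1), (1,1)) \<in> \<psi> ` carrier L"
  proof -
    let ?b = "t' \<otimes>\<^bsub>G\<^esub> a \<otimes>\<^bsub>G\<^esub> inv\<^bsub>G\<^esub> t'"
    have bG: "?b \<in> carrier G" using t'(1) a(1) by simp
    have eq: "?b \<otimes>\<^bsub>G\<^esub> t' = t' \<otimes>\<^bsub>G\<^esub> a" using t'(1) a(1) by (simp add: G.m_assoc)
    have "\<chi> ?b * \<chi> t' = \<chi> t'" using \<chi>(1)[OF bG t'(1)] \<chi>(1)[OF t'(1) a(1)] a(2) unfolding eq by simp
    then have "\<chi> ?b = 1" using \<chi>(2)[OF t'(1)] by simp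
    moreover have "\<delta>' ?b = d"
      using \<delta>'[OF bG t'(1)] \<delta>'[OF t'(1) a(1)] unfolding eq by (simp add: \<delta>'t d_def)
    ultimately show ?thesis using \<theta>im[OF bG] by (simp add: \<theta>_def dg_def)
  qed
  \<comment> \<open>Conjugation by \<open>(1, s)\<close> turns the direction \<open>1\<close> into
    \<open>w\<close> and rescales by \<open>k\<close>.\<close>
  define w where "w = snd s / fst s"
  define k where "k = fst s * fst s / snd s"
  have k: "k \<noteq> 0" using nz[OF s(1)] by (simp add: k_def)
  have conj: "(lin_fps (nil2 (k * e) w), (1,1)) \<in> \<psi> ` carrier L"
    if e: "(lin_fps (nil2 e 1), (1,1)) \<in> \<psi> ` carrier L" for e
  proof -
    have "mat_act s 1 (nil2 e 1) = nil2 (k * e) w"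
      using nz[OF s(1)] by (simp add: mat_act_def nil2_def k_def w_def field_simps)
    then have "(1, s) \<otimes>\<^bsub>?H\<^esub> (lin_fps (nil2 e 1), (1,1)) = (lin_fps (nil2 (k * e) w), s)"
      using act_lin[OF s(1)] by simp
    also have "\<dots> = (lin_fps (nil2 (k * e) w), (1,1)) \<otimes>\<^bsub>?H\<^esub> (1, s)" unfolding one_mult by simp
    finally have "(lin_fps (nil2 (k * e) w), (1,1)) = (1, s) \<otimes>\<^bsub>?H\<^esub> (lin_fps (nil2 e 1), (1,1)) \<otimes>\<^bsub>?H\<^esub> inv\<^bsub>?H\<^esub> (1, s)"
      using lin\<Lambda> subgroup.mem_carrier[OF s\<Lambda>] subgroup.mem_carrier[OF sI] sim e
      by (metis H.inv_solve_right H.m_closed)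
    also have "\<dots> \<in> \<psi> ` carrier L"
      using subgroup.m_closed[OF sI] subgroup.m_inv_closed[OF sI] sim e by blast
    finally show ?thesis .
  qed
  have lin\<Gamma>: "(lin_fps (nil2 e v), (1,1)) \<in> \<Gamma>" if "(e, v) \<in> {(c, 1), (d, 1), (k * c, w), (k * d, w)}" for e v
    using that 1 2 conj[OF 1] conj[OF 2] lin\<Lambda> unfolding \<Gamma>_def by blast
  have "\<Gamma> \<noteq> {\<one>\<^bsub>?H\<^esub>}"
  proof
    assume "\<Gamma> = {\<one>\<^bsub>?H\<^esub>}"
    then have "lin_fps (nil2 c 1) = 1" using lin\<Gamma>[of c 1] by simp
    then have "nil2 c 1 = 0" by (metis lin_fps_nth fps_one_nth one_neq_zero)
    then show False using cd(1) by (simp add: nil2_def zero_mat2_def)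
  qed
  then obtain b where b: "b \<in> \<Gamma>" "b \<noteq> \<one>\<^bsub>?H\<^esub>"
    and comm: "\<And>g. g \<in> \<Gamma> \<Longrightarrow> (g \<otimes>\<^bsub>?H\<^esub> b \<otimes>\<^bsub>?H\<^esub> inv\<^bsub>?H\<^esub> g) \<otimes>\<^bsub>?H\<^esub> b = b \<otimes>\<^bsub>?H\<^esub> (g \<otimes>\<^bsub>?H\<^esub> b \<otimes>\<^bsub>?H\<^esub> inv\<^bsub>?H\<^esub> g)"
    using H.solvable_seq_commuting_conjugates[OF sol\<Gamma>] by blast
  obtain f where f: "b = (f, (1,1))" using b(1) by (auto simp: \<Gamma>_def \<Lambda>_def)
  have f0: "f $ 0 = 1" and det: "det2 (mat_fps f) = 1" using b(1) by (auto simp: \<Gamma>_def \<Lambda>_def f)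
  have "f = 1"
  proof (rule mat_fps_unique_commuting[OF f0 det cd])
    show "k * c \<noteq> 0" "k * d \<noteq> 0" "k * c \<noteq> k * d" using cd k by simp_all
    show "w * w \<noteq> 1" using s2 by (simp add: w_def)
    fix e v assume ev: "(e, v) \<in> {(c, 1), (d, 1), (k * c, w), (k * d, w)}"
    let ?g = "(lin_fps (nil2 e v), (1,1)) :: 'k mat2 fps \<times> 'k \<times> 'k"
    have inv: "inv\<^bsub>?H\<^esub> ?g = (lin_fps (nil2 (- e) v), (1,1))"
    proof (rule H.inv_equality)
      show "(lin_fps (nil2 (- e) v), (1,1)) \<otimes>\<^bsub>?H\<^esub> ?g = \<one>\<^bsub>?H\<^esub>"
        unfolding one_mult using lin_fps_minus[of "- e" v] by simp
    qed (use lin\<Lambda> subgroup.mem_carrier[OF s\<Lambda>] in blast)+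
    show "(lin_fps (nil2 e v) * f * lin_fps (nil2 (- e) v)) * f = f * (lin_fps (nil2 e v) * f * lin_fps (nil2 (- e) v))"
      using comm[OF lin\<Gamma>[OF ev]] unfolding inv f one_mult by simp
  qed
  then show False using b(2) f by simp
qed

section \<open>Characters and derivations from a congruence of ring terms\<close>

text \<open>Terms for elements of the integral group ring of a group over \<open>'a\<close>. The
  ring laws are left to congruences, so that the type does not depend on the group.\<close>

datatype 'a rterm = RZero | ROne | RGen 'a | RAdd "'a rterm" "'a rterm" | RMul "'a rterm" "'a rterm" | RNeg "'a rterm"

primrec rpow :: "nat \<Rightarrow> 'a rterm \<Rightarrow> 'a rterm" where
  "rpow 0 e = ROne"
| "rpow (Suc n) e = RMul e (rpow n e)"

primrec rgeo :: "nat \<Rightarrow> 'a rterm \<Rightarrow> 'a rterm" where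
  "rgeo 0 e = RZero"
| "rgeo (Suc n) e = RAdd (rgeo n e) (rpow n e)"

locale domain_congruence =
  fixes r :: "'a rterm \<Rightarrow> 'a rterm \<Rightarrow> bool"
  assumes equivp: "equivp r"
    and add_cong: "r e e' \<Longrightarrow> r f f' \<Longrightarrow> r (RAdd e f) (RAdd e' f')"
    and mul_cong: "r e e' \<Longrightarrow> r f f' \<Longrightarrow> r (RMul e f) (RMul e' f')"
    and neg_cong: "r e e' \<Longrightarrow> r (RNeg e) (RNeg e')"
    and add_assoc: "r (RAdd (RAdd e f) g) (RAdd e (RAdd f g))"
    and add_comm: "r (RAdd e f) (RAdd f e)"
    and add_zero: "r (RAdd RZero e) e"
    and add_neg: "r (RAdd (RNeg e) e) RZero"
    and mul_assoc: "r (RMul (RMul e f) g) (RMul e (RMul f g))"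
    and mul_comm: "r (RMul e f) (RMul f e)"
    and mul_one: "r (RMul ROne e) e"
    and distrib: "r (RMul (RAdd e f) g) (RAdd (RMul e g) (RMul f g))"
    and zero_one: "\<not> r RZero ROne"
    and no_zero_divisors: "r (RMul e f) RZero \<Longrightarrow> r e RZero \<or> r f RZero"

text \<open>Modulo \<open>r\<close>, the terms \<open>RGen x\<close> form a character of \<open>G\<close>, and the fractions \<open>num x / den x\<close> a
  derivation with respect to this character.\<close>

locale obstruction = group G for G :: "'a monoid" (structure) +
  fixes \<pi> :: "nat set" and r :: "'a rterm \<Rightarrow> 'a rterm \<Rightarrow> bool"
    and S :: "'a set" and num den :: "'a \<Rightarrow> 'a rterm" and a :: 'a
  assumes S: "finite S" "S \<subseteq> carrier G" "generate G S = carrier G"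
    and finite_primes: "finite \<pi>"
    and solvable_localization: "solvable (term_localization \<pi> G)"
    and gen_mult: "x \<in> carrier G \<Longrightarrow> y \<in> carrier G \<Longrightarrow> r (RGen (x \<otimes> y)) (RMul (RGen x) (RGen y))"
    and gen_one: "r (RGen \<one>) ROne"
    and norm: "prime q \<Longrightarrow> q \<notin> \<pi> \<Longrightarrow> x \<in> carrier G \<Longrightarrow> \<not> r (rgeo q (RGen x)) RZero"
    and exponent: "m > 0 \<Longrightarrow> \<exists>x \<in> carrier G. \<not> r (rpow m (RGen x)) ROne"
    and den: "x \<in> carrier G \<Longrightarrow> \<not> r (den x) RZero"
    and num_mult: "x \<in> carrier G \<Longrightarrow> y \<in> carrier G \<Longrightarrow> r (RMul (num (x \<otimes> y)) (RMul (den x) (den y)))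
        (RMul (den (x \<otimes> y)) (RAdd (RMul (num x) (den y)) (RMul (RGen x) (RMul (num y) (den x)))))"
    and a: "a \<in> carrier G" "r (RGen a) ROne" "\<not> r (num a) RZero"

text \<open>This evaluation provides a domain congruence over every type, so that the choice of
  \<open>the_congruence\<close> is never void.\<close>

primrec int_of_rterm :: "'a rterm \<Rightarrow> int" where
  "int_of_rterm RZero = 0"
| "int_of_rterm ROne = 1"
| "int_of_rterm (RGen x) = 0"
| "int_of_rterm (RAdd e f) = int_of_rterm e + int_of_rterm f"
| "int_of_rterm (RMul e f) = int_of_rterm e * int_of_rterm f"
| "int_of_rterm (RNeg e) = - int_of_rterm e"

lemma domain_congruence_int: "domain_congruence (\<lambda>e f. int_of_rterm e = int_of_rterm f)"
  by unfold_locales (auto simp: algebra_simps intro!: equivpI reflpI sympI transpI)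

text \<open>A type cannot depend on the group at hand. As obstructions are to be refuted, it suffices to have the
  domain of one of them available as a type, and Hilbert's choice selects this one.\<close>

definition obstructed :: "('a rterm \<Rightarrow> 'a rterm \<Rightarrow> bool) \<Rightarrow> bool" where
  "obstructed r \<longleftrightarrow> (\<exists>(G :: 'a monoid) \<pi> S num den a. obstruction G \<pi> r S num den a)"

definition the_congruence :: "'a rterm \<Rightarrow> 'a rterm \<Rightarrow> bool" where
  "the_congruence = (SOME r. domain_congruence r \<and>
     ((\<exists>r' :: 'a rterm \<Rightarrow> 'a rterm \<Rightarrow> bool. domain_congruence r' \<and> obstructed r') \<longrightarrow> obstructed r))"

text \<open>The implication built into the choice passes the property of being obstructed from any
  \<open>r'\<close> to the chosen congruence.\<close>

lemma the_congruence:
  fixes r' :: "'a rterm \<Rightarrow> 'a rterm \<Rightarrow> bool"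
  shows "domain_congruence (the_congruence :: 'a rterm \<Rightarrow> 'a rterm \<Rightarrow> bool)"
    and "domain_congruence r' \<Longrightarrow> obstructed r' \<Longrightarrow> obstructed (the_congruence :: 'a rterm \<Rightarrow> 'a rterm \<Rightarrow> bool)"
proof -
  have ex: "\<exists>r :: 'a rterm \<Rightarrow> 'a rterm \<Rightarrow> bool. domain_congruence r \<and>
     ((\<exists>r' :: 'a rterm \<Rightarrow> 'a rterm \<Rightarrow> bool. domain_congruence r' \<and> obstructed r') \<longrightarrow> obstructed r)"
    using domain_congruence_int by blast
  note some = someI_ex[OF ex, folded the_congruence_def]
  show "domain_congruence (the_congruence :: 'a rterm \<Rightarrow> 'a rterm \<Rightarrow> bool)"
    using some by (rule conjunct1)
  show "domain_congruence r' \<Longrightarrow> obstructed r' \<Longrightarrow> obstructed (the_congruence :: 'a rterm \<Rightarrow> 'a rterm \<Rightarrow> bool)"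
    using conjunct2[OF some] by blast
qed

section \<open>The integral domain of the chosen congruence\<close>

interpretation the: domain_congruence the_congruence
  by (rule the_congruence(1))

quotient_type 'a rdom = "'a rterm" / the_congruence
  by (rule the.equivp)

instantiation rdom :: (type) comm_ring_1
begin

lift_definition zero_rdom :: "'a rdom" is RZero .
lift_definition one_rdom :: "'a rdom" is ROne .
lift_definition plus_rdom :: "'a rdom \<Rightarrow> 'a rdom \<Rightarrow> 'a rdom" is RAdd by (rule the.add_cong)
lift_definition times_rdom :: "'a rdom \<Rightarrow> 'a rdom \<Rightarrow> 'a rdom" is RMul by (rule the.mul_cong)
lift_definition uminus_rdom :: "'a rdom \<Rightarrow> 'a rdom" is RNeg by (rule the.neg_cong)
definition minus_rdom :: "'a rdom \<Rightarrow> 'a rdom \<Rightarrow> 'a rdom" where "minus_rdom x y = x + - y"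

instance
proof
  fix x y z :: "'a rdom"
  show "x + y + z = x + (y + z)" by transfer (rule the.add_assoc)
  show "x + y = y + x" by transfer (rule the.add_comm)
  show "0 + x = x" by transfer (rule the.add_zero)
  show "- x + x = 0" by transfer (rule the.add_neg)
  show "x - y = x + - y" by (rule minus_rdom_def)
  show "x * y * z = x * (y * z)" by transfer (rule the.mul_assoc)
  show "x * y = y * x" by transfer (rule the.mul_comm)
  show "1 * x = x" by transfer (rule the.mul_one)
  show "(x + y) * z = x * z + y * z" by transfer (rule the.distrib)
  show "(0::'a rdom) \<noteq> 1" by transfer (rule the.zero_one)
qed

end

instance rdom :: (type) idom
proof
  fix x y :: "'a rdom"
  assume "x \<noteq> 0" "y \<noteq> 0"
  then show "x * y \<noteq> 0" by transfer (use the.no_zero_divisors in blast)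
qed

text \<open>Leads into an algebraically closed field, as \<open>localization_not_solvable\<close>
  requires.\<close>

definition rdom_embed :: "'a rdom \<Rightarrow> 'a rdom fract alg_closure" where
  "rdom_embed x = to_ac (Fract x 1)"

lemma rdom_embed_simps:
  "rdom_embed (x + y) = rdom_embed x + rdom_embed y"
  "rdom_embed (x * y) = rdom_embed x * rdom_embed y"
  "rdom_embed x = rdom_embed y \<longleftrightarrow> x = y" "rdom_embed 0 = 0" "rdom_embed 1 = 1"
  by (simp_all add: rdom_embed_def eq_fract Zero_fract_def[symmetric] One_fract_def[symmetric]
      flip: to_ac_add to_ac_mult)

text \<open>The obstruction for the chosen congruence becomes a character and a derivation with
  values in a field, and \<open>localization_not_solvable\<close> contradicts
  \<open>solvable_localization\<close>.\<close>

theorem no_obstruction: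
  assumes "domain_congruence (r :: 'a rterm \<Rightarrow> 'a rterm \<Rightarrow> bool)" "obstructed r"
  shows False
proof -
  let ?r = "the_congruence :: 'a rterm \<Rightarrow> 'a rterm \<Rightarrow> bool"
  obtain G \<pi> S num den a where "obstruction G \<pi> ?r S num den a"
    using the_congruence(2)[OF assms] unfolding obstructed_def by blast
  then interpret obstruction G \<pi> ?r S num den a .
  define c where "c e = rdom_embed (abs_rdom e)" for e :: "'a rterm"
  have c_eq: "c e = c f \<longleftrightarrow> ?r e f" for e f by (simp add: c_def rdom_embed_simps rdom.abs_eq_iff)
  have c_simps: "c RZero = 0" "c ROne = 1" "c (RAdd e f) = c e + c f" "c (RMul e f) = c e * c f" for e f
    by (simp_all add: c_def zero_rdom.abs_eq[symmetric] one_rdom.abs_eq[symmetric]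
        plus_rdom.abs_eq[symmetric] times_rdom.abs_eq[symmetric] rdom_embed_simps)
  have c_pow: "c (rpow n e) = c e ^ n" for n e by (induction n) (simp_all add: c_simps)
  have c_geo: "c (rgeo n e) = (\<Sum>i<n. c e ^ i)" for n e by (induction n) (simp_all add: c_simps c_pow)
  define \<chi> where "\<chi> x = c (RGen x)" for x
  define \<delta> where "\<delta> x = c (num x) / c (den x)" for x
  have \<chi>: "\<chi> (x \<otimes>\<^bsub>G\<^esub> y) = \<chi> x * \<chi> y" if "x \<in> carrier G" "y \<in> carrier G" for x y
    using gen_mult[OF that] by (simp add: \<chi>_def c_eq[symmetric] c_simps)
  have \<chi>1: "\<chi> \<one>\<^bsub>G\<^esub> = 1" using gen_one by (simp add: \<chi>_def c_eq[symmetric] c_simps)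
  have \<chi>0: "\<chi> x \<noteq> 0" if "x \<in> carrier G" for x
  proof
    assume "\<chi> x = 0"
    then have "\<chi> (x \<otimes>\<^bsub>G\<^esub> inv\<^bsub>G\<^esub> x) = 0" using \<chi>[OF that, of "inv\<^bsub>G\<^esub> x"] that by simp
    then show False using that \<chi>1 by simp
  qed
  have den0: "c (den x) \<noteq> 0" if "x \<in> carrier G" for x
    using den[OF that] by (simp add: c_eq[symmetric] c_simps)
  have \<delta>: "\<delta> (x \<otimes>\<^bsub>G\<^esub> y) = \<delta> x + \<chi> x * \<delta> y" if xy: "x \<in> carrier G" "y \<in> carrier G" for x y
  proof -
    have "c (num (x \<otimes>\<^bsub>G\<^esub> y)) * (c (den x) * c (den y)) =
        c (den (x \<otimes>\<^bsub>G\<^esub> y)) * (c (num x) * c (den y) + \<chi> x * (c (num y) * c (den x)))"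
      using num_mult[OF xy] by (simp add: \<chi>_def c_eq[symmetric] c_simps)
    then show ?thesis using den0[OF xy(1)] den0[OF xy(2)] den0[OF m_closed[OF xy]]
      by (simp add: \<delta>_def field_simps)
  qed
  have geo: "(\<Sum>i<q. \<chi> x ^ i) \<noteq> 0" if "prime q" "q \<notin> \<pi>" "x \<in> carrier G" for q x
    using norm[OF that] by (simp add: \<chi>_def c_eq[symmetric] c_simps c_geo)
  have a': "\<chi> a = 1" "\<delta> a \<noteq> 0"
    using a den0 by (auto simp: \<chi>_def \<delta>_def c_eq[symmetric] c_simps)
  have "\<not> solvable (term_localization \<pi> G)"
  proof (rule localization_not_solvable[OF group_axioms S finite_primes pi_localization_exists[OF group_axioms] \<chi> \<chi>0 \<delta> _ _ _ a(1) a'])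
    \<comment> \<open>The norm of the identity element has the value \<open>q\<close>.\<close>
    show "of_nat q \<noteq> (0 :: 'a rdom fract alg_closure)" if "prime q" "q \<notin> \<pi>" for q
      using geo[OF that one_closed] by (simp add: \<chi>1)
    show "\<chi> x = 1" if "prime q" "q \<notin> \<pi>" "x \<in> carrier G" "\<chi> x ^ q = 1" for q x
      using power_diff_1_eq[of "\<chi> x" q] geo[OF that(1-3)] that(4) by simp
    show "\<exists>x \<in> carrier G. \<chi> x ^ m \<noteq> 1" if "m > 0" for m
      using exponent[OF that] by (auto simp: \<chi>_def c_eq[symmetric] c_simps c_pow)
  qed
  then show False using solvable_localization by simp
qed

section \<open>The action of a group on its derived subgroup\<close>

lemma (in group) inv_cancel: "x \<in> carrier G \<Longrightarrow> y \<in> carrier G \<Longrightarrow> inv x \<otimes> (x \<otimes> y) = y"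
  "x \<in> carrier G \<Longrightarrow> y \<in> carrier G \<Longrightarrow> x \<otimes> (inv x \<otimes> y) = y"
  by (simp_all add: m_assoc[symmetric])

definition (in group) comm :: "'a \<Rightarrow> 'a \<Rightarrow> 'a" where "comm x y = x \<otimes> y \<otimes> inv x \<otimes> inv y"

context group
begin

lemma conj_group_hom: "g \<in> carrier G \<Longrightarrow> group_hom G G (\<lambda>x. g \<otimes> x \<otimes> inv g)"
  by (auto simp: group_hom_def group_hom_axioms_def is_group hom_def m_assoc inv_cancel)

lemma comm_mult_left: "x \<in> carrier G \<Longrightarrow> y \<in> carrier G \<Longrightarrow> z \<in> carrier G \<Longrightarrow>
    comm (x \<otimes> y) z = (x \<otimes> comm y z \<otimes> inv x) \<otimes> comm x z"
  by (simp add: comm_def m_assoc inv_mult_group inv_cancel)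

lemma comm_inv_left: "x \<in> carrier G \<Longrightarrow> z \<in> carrier G \<Longrightarrow>
    comm (inv x) z = inv x \<otimes> inv (comm x z) \<otimes> inv (inv x)"
  by (simp add: comm_def m_assoc inv_mult_group inv_cancel)

lemma comm_swap: "x \<in> carrier G \<Longrightarrow> y \<in> carrier G \<Longrightarrow> comm y x = inv (comm x y)"
  by (simp add: comm_def m_assoc inv_mult_group)

lemma comm_conj_left: "g \<in> carrier G \<Longrightarrow> x \<in> carrier G \<Longrightarrow> y \<in> carrier G \<Longrightarrow>
    comm (g \<otimes> x \<otimes> inv g) y = g \<otimes> comm x (inv g \<otimes> y \<otimes> g) \<otimes> inv g"
  by (simp add: comm_def m_assoc inv_mult_group inv_cancel)

text \<open>By \<open>comm_mult_left\<close>, \<open>g \<mapsto> comm g h\<close> is a crossed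
  homomorphism, and \<open>N\<close> is normalized by \<open>T\<close>. Commutator conditions modulo
  \<open>N\<close> thus extend from generators to the group.\<close>

lemma subgroup_comm_mod:
  assumes T: "subgroup T G" and N: "subgroup N G" and h: "h \<in> carrier G"
    and conj: "\<And>g n. g \<in> T \<Longrightarrow> n \<in> N \<Longrightarrow> g \<otimes> n \<otimes> inv g \<in> N"
  shows "subgroup {g \<in> T. comm g h \<in> N} G"
proof (rule subgroupI)
  note Tc = subgroup.mem_carrier[OF T]
  show "{g \<in> T. comm g h \<in> N} \<subseteq> carrier G" using Tc by blast
  have "\<one> \<in> {g \<in> T. comm g h \<in> N}"
    using h subgroup.one_closed[OF N] subgroup.one_closed[OF T] by (simp add: comm_def)
  then show "{g \<in> T. comm g h \<in> N} \<noteq> {}" by blast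
  fix x assume "x \<in> {g \<in> T. comm g h \<in> N}"
  then have x: "x \<in> T" "comm x h \<in> N" by auto
  have iT: "inv x \<in> T" by (rule subgroup.m_inv_closed[OF T x(1)])
  then show "inv x \<in> {g \<in> T. comm g h \<in> N}"
    using conj[OF iT subgroup.m_inv_closed[OF N x(2)]] Tc[OF x(1)] h by (simp add: comm_inv_left)
  fix y assume "y \<in> {g \<in> T. comm g h \<in> N}"
  then have y: "y \<in> T" "comm y h \<in> N" by auto
  show "x \<otimes> y \<in> {g \<in> T. comm g h \<in> N}"
    using subgroup.m_closed[OF T x(1) y(1)] subgroup.m_closed[OF N conj[OF x(1) y(2)] x(2)]
      Tc[OF x(1)] Tc[OF y(1)] h by (simp add: comm_mult_left)
qed

end

section \<open>Ring terms as endomorphisms of the derived subgroup\<close>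

primrec reval :: "('b, 'n) monoid_scheme \<Rightarrow> ('a \<Rightarrow> 'b) \<Rightarrow> 'a rterm \<Rightarrow> 'b \<Rightarrow> 'b" where
  "reval L \<phi> RZero x = \<one>\<^bsub>L\<^esub>"
| "reval L \<phi> ROne x = x"
| "reval L \<phi> (RGen g) x = \<phi> g \<otimes>\<^bsub>L\<^esub> x \<otimes>\<^bsub>L\<^esub> inv\<^bsub>L\<^esub> \<phi> g"
| "reval L \<phi> (RAdd e f) x = reval L \<phi> e x \<otimes>\<^bsub>L\<^esub> reval L \<phi> f x"
| "reval L \<phi> (RMul e f) x = reval L \<phi> e (reval L \<phi> f x)"
| "reval L \<phi> (RNeg e) x = inv\<^bsub>L\<^esub> reval L \<phi> e x"

text \<open>The terms act on a multiplicatively written abelian group, so \<open>RAdd\<close> is a product and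
  \<open>rdiff t n\<close> is the endomorphism \<open>t\<^sup>n - 1\<close>.\<close>

definition rdiff :: "'a \<Rightarrow> nat \<Rightarrow> 'a rterm" where
  "rdiff t n = RAdd (rpow n (RGen t)) (RNeg ROne)"

locale metabelian_image = group L for L :: "('b, 'n) monoid_scheme" (structure) +
  fixes G :: "('a, 'm) monoid_scheme" and \<phi> :: "'a \<Rightarrow> 'b" and S :: "'a set" and \<pi> :: "nat set"
  assumes local: "pi_local \<pi> L"
    and G: "group G" and \<phi>: "\<phi> \<in> hom G L"
    and S: "finite S" "S \<subseteq> carrier G" "generate G S = carrier G"
    and commutators_commute: "\<And>x y. x \<in> derived L (\<phi> ` carrier G) \<Longrightarrow> y \<in> derived L (\<phi> ` carrier G) \<Longrightarrow> x \<otimes> y = y \<otimes> x"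
begin

definition A :: "'b set" where "A = derived L (\<phi> ` carrier G)"

text \<open>Defaulting to \<open>\<one>\<close> outside \<open>G\<close> lets every ring term act on \<open>A\<close>.\<close>

definition rep :: "'a \<Rightarrow> 'b" where "rep g = (if g \<in> carrier G then \<phi> g else \<one>)"

abbreviation ev :: "'a rterm \<Rightarrow> 'b \<Rightarrow> 'b" where "ev \<equiv> reval L rep"

sublocale \<phi>: group_hom G L \<phi>
  using G \<phi> group_axioms by (simp add: group_hom_def group_hom_axioms_def)

lemma image_closed: "\<phi> ` carrier G \<subseteq> carrier L"
  using \<phi>.hom_closed by blast

lemma subgroup_A: "subgroup A L"
  unfolding A_def by (rule derived_is_subgroup[OF image_closed])

lemma A_closed [simp]: "a \<in> A \<Longrightarrow> a \<in> carrier L"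
  by (rule subgroup.mem_carrier[OF subgroup_A])

lemma A_group [simp]:
  "\<one> \<in> A" "a \<in> A \<Longrightarrow> b \<in> A \<Longrightarrow> a \<otimes> b \<in> A" "a \<in> A \<Longrightarrow> inv a \<in> A"
  using subgroup.one_closed[OF subgroup_A] subgroup.m_closed[OF subgroup_A]
    subgroup.m_inv_closed[OF subgroup_A] by blast+

lemma A_comm: "a \<in> A \<Longrightarrow> b \<in> A \<Longrightarrow> a \<otimes> b = b \<otimes> a"
  unfolding A_def by (rule commutators_commute)

lemma A_lcomm: "a \<in> A \<Longrightarrow> b \<in> A \<Longrightarrow> c \<in> A \<Longrightarrow> a \<otimes> (b \<otimes> c) = b \<otimes> (a \<otimes> c)"
  using A_comm[of a b] by (simp add: m_assoc[symmetric])

lemmas A_ac = m_assoc A_comm A_lcomm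

lemma A_inv_mult: "a \<in> A \<Longrightarrow> b \<in> A \<Longrightarrow> inv (a \<otimes> b) = inv a \<otimes> inv b"
  by (simp add: inv_mult_group A_comm)

lemma rep_in_image: "rep g \<in> \<phi> ` carrier G"
  using imageI[OF \<phi>.G.one_closed, of \<phi>] by (simp add: rep_def)

lemma rep_closed [simp]: "rep g \<in> carrier L"
  using rep_in_image image_closed by blast

lemma rep_eq [simp]: "g \<in> carrier G \<Longrightarrow> rep g = \<phi> g"
  by (simp add: rep_def)

lemma comm_in_A: "comm (rep g) (rep h) \<in> A"
  unfolding A_def derived_def comm_def 
  using rep_in_image[of g] rep_in_image[of h] by (intro generate.incl UN_I) auto

lemma conj_hom: "g \<in> carrier L \<Longrightarrow> x \<in> carrier L \<Longrightarrow> y \<in> carrier L \<Longrightarrow>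
    g \<otimes> (x \<otimes> y) \<otimes> inv g = (g \<otimes> x \<otimes> inv g) \<otimes> (g \<otimes> y \<otimes> inv g)"
  by (simp add: m_assoc inv_cancel)

lemma A_subset_image: "A \<subseteq> \<phi> ` carrier G"
  unfolding A_def using \<phi>.img_is_subgroup by (intro derived_incl) auto

lemma conj_A: "rep g \<otimes> a \<otimes> inv rep g \<in> A" if a: "a \<in> A"
proof -
  obtain h where h: "h \<in> carrier G" "a = \<phi> h" using a A_subset_image by blast
  have "rep g \<otimes> a \<otimes> inv rep g = comm (rep g) (rep h) \<otimes> a"
    using h by (simp add: comm_def m_assoc inv_cancel)
  then show ?thesis using comm_in_A[of g h] a by simp
qed

lemma ev_closed [simp]: "a \<in> A \<Longrightarrow> ev e a \<in> A"
  by (induction e arbitrary: a) (auto simp: conj_A)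

lemma ev_mult: "a \<in> A \<Longrightarrow> b \<in> A \<Longrightarrow> ev e (a \<otimes> b) = ev e a \<otimes> ev e b"
proof (induction e arbitrary: a b)
  case (RGen g)
  then show ?case by (simp add: conj_hom)
next
  case (RAdd e f)
  then show ?case by (simp add: A_ac)
next
  case (RNeg e)
  then show ?case by (simp add: A_inv_mult)
qed simp_all

lemma ev_one [simp]: "ev e \<one> = \<one>"
  using ev_mult[of \<one> \<one> e] ev_closed[of \<one> e] by (metis A_closed A_group(1) l_cancel_one' r_one)

lemma ev_inv: "a \<in> A \<Longrightarrow> ev e (inv a) = inv (ev e a)"
  using ev_mult[of "inv a" a e] by (simp add: inv_equality)

text \<open>The images of \<open>g\<close> and \<open>h\<close> commute up to an element of
  \<open>A\<close>, which acts trivially on the abelian group \<open>A\<close>.\<close>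

lemma ev_commute_gen: "a \<in> A \<Longrightarrow> ev (RGen g) (ev (RGen h) a) = ev (RGen h) (ev (RGen g) a)"
proof -
  assume a: "a \<in> A"
  define b where "b = ev (RGen h) (ev (RGen g) a)"
  define c where "c = comm (rep g) (rep h)"
  have bc: "b \<in> A" "c \<in> A" using a comm_in_A by (simp_all add: b_def c_def conj_A)
  have "ev (RGen g) (ev (RGen h) a) \<otimes> c = c \<otimes> b"
    using a by (simp add: b_def c_def comm_def m_assoc inv_mult_group inv_cancel)
  then have "ev (RGen g) (ev (RGen h) a) \<otimes> c = b \<otimes> c" using bc by (simp add: A_comm)
  then show ?thesis using bc a by (simp add: conj_A b_def)
qed

text \<open>Commutation extends from generators to terms, so \<open>A\<close> is a module over a
  commutative ring.\<close>

lemma ev_commute: "a \<in> A \<Longrightarrow> ev e (ev f a) = ev f (ev e a)"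
proof -
  have gen: "ev (RGen g) (ev f a) = ev f (ev (RGen g) a)" if "a \<in> A" for g f a
    using that
  proof (induction f arbitrary: a)
    case (RGen h)
    show ?case by (rule ev_commute_gen[OF RGen])
  next
    case (RAdd e f)
    have "ev (RGen g) (ev e a \<otimes> ev f a) = ev (RGen g) (ev e a) \<otimes> ev (RGen g) (ev f a)"
      by (rule ev_mult) (use RAdd.prems in simp_all)
    then show ?case using RAdd.IH[OF RAdd.prems] by simp
  next
    case (RMul e f)
    have "ev (RGen g) (ev e (ev f a)) = ev e (ev (RGen g) (ev f a))"
      by (rule RMul.IH) (use RMul.prems in simp)
    then show ?case using RMul.IH(2)[OF RMul.prems] by simp
  next
    case (RNeg e)
    have "ev (RGen g) (inv (ev e a)) = inv (ev (RGen g) (ev e a))"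
      by (rule ev_inv) (use RNeg.prems in simp)
    then show ?case using RNeg.IH[OF RNeg.prems] by simp
  qed simp_all
  show "ev e (ev f a) = ev f (ev e a)" if "a \<in> A"
    using that
  proof (induction e arbitrary: a)
    case (RGen g)
    show ?case by (rule gen[OF RGen])
  next
    case (RMul e e')
    then have "ev e (ev e' (ev f a)) = ev e (ev f (ev e' a))" by simp
    also have "\<dots> = ev f (ev e (ev e' a))" by (rule RMul.IH(1)) (use RMul.prems in simp)
    finally show ?case by simp
  qed (simp_all add: ev_mult ev_inv)
qed

section \<open>Submodules \<open>N\<close> of \<open>A\<close>, and congruence modulo
  \<open>N\<close>\<close>

definition invariant :: "'b set \<Rightarrow> bool" where
  "invariant N \<longleftrightarrow> subgroup N L \<and> N \<subseteq> A \<and> (\<forall>g \<in> carrier G. \<forall>n \<in> N. \<phi> g \<otimes> n \<otimes> inv \<phi> g \<in> N)"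

lemma invariantI:
  assumes "N \<subseteq> A" "\<one> \<in> N" "\<And>x y. x \<in> N \<Longrightarrow> y \<in> N \<Longrightarrow> x \<otimes> y \<in> N" "\<And>x. x \<in> N \<Longrightarrow> inv x \<in> N"
    and "\<And>e x. x \<in> N \<Longrightarrow> ev e x \<in> N"
  shows "invariant N"
  unfolding invariant_def
proof (intro conjI ballI)
  show "subgroup N L" using assms A_closed by (intro subgroup.intro) auto
  show "\<phi> g \<otimes> n \<otimes> inv \<phi> g \<in> N" if "g \<in> carrier G" "n \<in> N" for g n
    using assms(5)[OF that(2), of "RGen g"] that(1) by simp
qed (rule assms(1))

context
  fixes N assumes N: "invariant N"
begin

lemma invariant_subset: "x \<in> N \<Longrightarrow> x \<in> A"
  using N by (auto simp: invariant_def)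

lemma invariant_group: "\<one> \<in> N" "x \<in> N \<Longrightarrow> y \<in> N \<Longrightarrow> x \<otimes> y \<in> N" "x \<in> N \<Longrightarrow> inv x \<in> N"
  using N subgroup.one_closed[of N L] subgroup.m_closed[of N L] subgroup.m_inv_closed[of N L]
  unfolding invariant_def by blast+

lemma invariant_ev: "x \<in> N \<Longrightarrow> ev e x \<in> N"
proof (induction e arbitrary: x)
  case (RGen g)
  then show ?case
    using N invariant_subset[OF RGen] by (simp add: invariant_def rep_def)
qed (simp_all add: invariant_group)

definition eqv :: "'b \<Rightarrow> 'b \<Rightarrow> bool" where "eqv a b \<longleftrightarrow> a \<in> A \<and> b \<in> A \<and> a \<otimes> inv b \<in> N"

lemma eqv_refl: "a \<in> A \<Longrightarrow> eqv a a"
  by (simp add: eqv_def invariant_group)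

lemma eqv_sym: "eqv a b \<Longrightarrow> eqv b a"
  using invariant_group(3)[of "a \<otimes> inv b"] by (auto simp: eqv_def A_inv_mult A_comm)

lemma eqv_trans: "eqv a b \<Longrightarrow> eqv b c \<Longrightarrow> eqv a c"
  using invariant_group(2)[of "a \<otimes> inv b" "b \<otimes> inv c"] by (auto simp: eqv_def m_assoc inv_cancel)

lemma eqv_mult: "eqv a b \<Longrightarrow> eqv c d \<Longrightarrow> eqv (a \<otimes> c) (b \<otimes> d)"
  using invariant_group(2)[of "a \<otimes> inv b" "c \<otimes> inv d"] by (auto simp: eqv_def A_inv_mult A_ac)

lemma eqv_inv: "eqv a b \<Longrightarrow> eqv (inv a) (inv b)"
  using invariant_group(3)[of "a \<otimes> inv b"] by (auto simp: eqv_def A_inv_mult)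

lemma eqv_ev: "eqv a b \<Longrightarrow> eqv (ev e a) (ev e b)"
  using invariant_ev[of "a \<otimes> inv b" e] by (auto simp: eqv_def ev_mult ev_inv)

lemma eqv_one_iff: "a \<in> A \<Longrightarrow> eqv a \<one> \<longleftrightarrow> a \<in> N"
  by (simp add: eqv_def)

lemma eqv_in: "eqv a b \<Longrightarrow> b \<in> N \<Longrightarrow> a \<in> N"
  using invariant_group(2)[of "a \<otimes> inv b" b] by (auto simp: eqv_def m_assoc)

text \<open>The quotient by this congruence is the ring of endomorphisms of \<open>A / N\<close>
  induced by terms.\<close>

definition rel :: "'a rterm \<Rightarrow> 'a rterm \<Rightarrow> bool" where
  "rel e f \<longleftrightarrow> (\<forall>a \<in> A. eqv (ev e a) (ev f a))"

lemma rel_zero_iff: "rel e RZero \<longleftrightarrow> (\<forall>a \<in> A. ev e a \<in> N)"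
  by (simp add: rel_def eqv_one_iff)

text \<open>By \<open>zd\<close>, terms that are nonzero on \<open>A / N\<close> are injective
  there, so a product of two of them does not vanish.\<close>

lemma domain_congruence_rel:
  assumes "\<not> A \<subseteq> N" and zd: "\<And>e a. \<not> rel e RZero \<Longrightarrow> a \<in> A \<Longrightarrow> ev e a \<in> N \<Longrightarrow> a \<in> N"
  shows "domain_congruence rel"
proof
  show "equivp rel"
    by (rule equivpI; unfold reflp_def symp_def transp_def rel_def)
       (use eqv_refl eqv_sym eqv_trans ev_closed in blast)+
  show "\<not> rel RZero ROne"
  proof
    assume "rel RZero ROne"
    then have "eqv \<one> a" if "a \<in> A" for a using that by (simp add: rel_def)
    then have "A \<subseteq> N" using eqv_sym eqv_one_iff by blast
    then show False using assms(1) by simp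
  qed
  show "rel e RZero \<or> rel f RZero" if "rel (RMul e f) RZero" for e f
  proof (cases "rel e RZero")
    case False
    have "ev f a \<in> N" if a: "a \<in> A" for a
      using zd[OF False, of "ev f a"] \<open>rel (RMul e f) RZero\<close> a by (simp add: rel_zero_iff)
    then show ?thesis by (simp add: rel_zero_iff)
  qed simp
  show "rel (RMul e f) (RMul e' f')" if "rel e e'" "rel f f'" for e e' f f'
    using that eqv_trans[OF eqv_ev] by (fastforce simp: rel_def)
qed (auto simp: rel_def eqv_refl eqv_mult eqv_inv A_ac ev_mult ev_commute)

end

lemma ev_rpow: "a \<in> A \<Longrightarrow> g \<in> carrier G \<Longrightarrow> ev (rpow n (RGen g)) a = \<phi> g [^] n \<otimes> a \<otimes> inv (\<phi> g [^] n)"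
proof (induction n)
  case (Suc n)
  have "\<phi> g [^] Suc n = \<phi> g \<otimes> \<phi> g [^] n" using Suc.prems by (metis \<phi>.hom_closed nat_pow_Suc2)
  then show ?case using Suc by (simp add: inv_mult_group m_assoc del: nat_pow_Suc)
qed simp

lemma norm_pow_eq: "a \<in> A \<Longrightarrow> g \<in> carrier G \<Longrightarrow> (a \<otimes> \<phi> g) [^] n = ev (rgeo n (RGen g)) a \<otimes> \<phi> g [^] (n::nat)"
proof (induction n)
  case (Suc n)
  have "(a \<otimes> \<phi> g) [^] Suc n = ev (rgeo n (RGen g)) a \<otimes> (\<phi> g [^] n \<otimes> a \<otimes> inv (\<phi> g [^] n)) \<otimes> \<phi> g [^] n \<otimes> \<phi> g"
    using Suc by (simp add: m_assoc inv_cancel)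
  then show ?case using Suc.prems by (simp add: ev_rpow m_assoc inv_cancel)
qed simp

text \<open>By \<open>norm_pow_eq\<close> the elements \<open>a \<otimes> \<phi> g\<close> and
  \<open>\<phi> g\<close> have the same \<open>q\<close>-th power, and roots are unique in
  \<open>L\<close>.\<close>

lemma norm_injective:
  assumes "prime q" "q \<notin> \<pi>" "g \<in> carrier G" "a \<in> A" "ev (rgeo q (RGen g)) a = \<one>"
  shows "a = \<one>"
proof -
  have "(a \<otimes> \<phi> g) [^] q = \<phi> g [^] q" using norm_pow_eq[of a g q] assms by simp
  moreover have "inj_on (\<lambda>x. x [^] q) (carrier L)" using local assms by (simp add: pi_local_def bij_betw_def)
  ultimately have "a \<otimes> \<phi> g = \<phi> g"
    using inj_onD[of "\<lambda>x. x [^] q" "carrier L" "a \<otimes> \<phi> g" "\<phi> g"] assms(3,4) by simp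
  then show ?thesis using assms(3,4) by simp
qed

section \<open>The image \<open>T\<close> of \<open>G\<close>, and generators of \<open>A\<close> as
  a module\<close>

definition T :: "'b set" where "T = \<phi> ` carrier G"

lemma subgroup_T: "subgroup T L"
  unfolding T_def by (rule \<phi>.img_is_subgroup)

lemma T_closed [simp]: "g \<in> T \<Longrightarrow> g \<in> carrier L"
  by (rule subgroup.mem_carrier[OF subgroup_T])

lemma A_subset_T: "A \<subseteq> T"
  unfolding T_def by (rule A_subset_image)

definition gen_comms :: "'b set" where
  "gen_comms = (\<lambda>(s, s'). comm (\<phi> s) (\<phi> s')) ` (S \<times> S)"

lemma finite_gen_comms: "finite gen_comms"
  using S(1) by (simp add: gen_comms_def)

lemma comm_image_in_A: "g \<in> carrier G \<Longrightarrow> h \<in> carrier G \<Longrightarrow> comm (\<phi> g) (\<phi> h) \<in> A"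
  using comm_in_A[of g h] by simp

lemma gen_comms_subset: "gen_comms \<subseteq> A"
  using S(2) by (auto simp: gen_comms_def intro: comm_image_in_A)

lemma invariant_conj: "invariant N \<Longrightarrow> g \<in> carrier G \<Longrightarrow> n \<in> N \<Longrightarrow> \<phi> g \<otimes> n \<otimes> inv \<phi> g \<in> N"
  by (simp add: invariant_def)

lemma comm_T: "g \<in> T \<Longrightarrow> h \<in> T \<Longrightarrow> comm g h \<in> A"
  using comm_image_in_A by (auto simp: T_def)

lemma invariant_conj_T: "invariant N \<Longrightarrow> g \<in> T \<Longrightarrow> x \<in> N \<Longrightarrow> g \<otimes> x \<otimes> inv g \<in> N"
  using invariant_conj by (auto simp: T_def)

lemma T_generated: "T = generate L (\<phi> ` S)"
  unfolding T_def \<phi>.generate_img[OF S(2)] S(3) ..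

text \<open>A commutator condition modulo \<open>N\<close> passes from the generators to all of
  \<open>T\<close> by \<open>subgroup_comm_mod\<close>, first in the left argument and after a swap
  in the other. So \<open>A\<close> is a finitely generated module.\<close>

lemma gen_comms_generate:
  assumes N: "invariant N" and M: "gen_comms \<subseteq> N"
  shows "A \<subseteq> N"
proof -
  have sN: "subgroup N L" using N by (simp add: invariant_def)
  have all: "comm g h \<in> N" if h: "h \<in> carrier L" and s: "\<And>s. s \<in> S \<Longrightarrow> comm (\<phi> s) h \<in> N" and g: "g \<in> T" for g h
  proof -
    have "\<phi> ` S \<subseteq> {g \<in> T. comm g h \<in> N}" using s S(2) by (auto simp: T_def)
    then have "generate L (\<phi> ` S) \<subseteq> {g \<in> T. comm g h \<in> N}"
      by (rule generate_subgroup_incl) (rule subgroup_comm_mod[OF subgroup_T sN h invariant_conj_T[OF N]])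
    then show ?thesis using g T_generated by blast
  qed
  have 1: "comm g (\<phi> s') \<in> N" if "g \<in> T" "s' \<in> S" for g s'
    by (rule all) (use that S(2) M in \<open>auto simp: gen_comms_def\<close>)
  have 2: "comm g h \<in> N" if gh: "g \<in> T" "h \<in> T" for g h
  proof (rule all[OF _ _ gh(1)])
    fix s assume s: "s \<in> S"
    then have "inv (comm h (\<phi> s)) \<in> N" using 1[OF gh(2)] invariant_group(3)[OF N] by blast
    then show "comm (\<phi> s) h \<in> N" using s S(2) gh by (subst comm_swap) auto
  qed (use gh in simp)
  show ?thesis
    unfolding A_def derived_def
    by (rule generate_subgroup_incl[OF _ sN]) (use 2 in \<open>auto simp: comm_def T_def\<close>)
qed

section \<open>Elements on which a power of \<open>t\<close> acts unipotently\<close>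

lemma ev_rpow_add: "ev (rpow (n + k) e) a = ev (rpow n e) (ev (rpow k e) a)"
  by (induction n) simp_all

lemma ev_rdiff: "ev (rdiff t n) a = ev (rpow n (RGen t)) a \<otimes> inv a"
  by (simp add: rdiff_def)

text \<open>Induction by \<open>t^(n (m + 1)) - 1 = t^n (t^(n m) - 1) + (t^n - 1)\<close>.\<close>

lemma rdiff_dvd: "\<exists>e. \<forall>a \<in> A. ev (rdiff t (n * m)) a = ev e (ev (rdiff t n) a)"
proof (induction m)
  case 0
  have "\<forall>a \<in> A. ev (rdiff t (n * 0)) a = ev RZero (ev (rdiff t n) a)" by (simp add: ev_rdiff)
  then show ?case by blast
next
  case (Suc m)
  then obtain e where e: "\<And>a. a \<in> A \<Longrightarrow> ev (rdiff t (n * m)) a = ev e (ev (rdiff t n) a)" by blast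
  let ?P = "\<lambda>n. ev (rpow n (RGen t))"
  have "ev (rdiff t (n * Suc m)) a = ev (RAdd (RMul (rpow n (RGen t)) e) ROne) (ev (rdiff t n) a)" if a: "a \<in> A" for a
  proof -
    have "?P n (ev (rdiff t (n * m)) a) = ?P n (?P (n * m) a) \<otimes> inv (?P n a)"
      using a by (simp add: ev_rdiff ev_mult ev_inv)
    then have "?P n (ev (rdiff t (n * m)) a) \<otimes> ev (rdiff t n) a = ?P n (?P (n * m) a) \<otimes> inv a"
      using a by (simp add: ev_rdiff m_assoc inv_cancel)
    then show ?thesis using e[OF a] ev_rpow_add[of n "n * m" "RGen t" a] by (simp add: ev_rdiff)
  qed
  then show ?case by blast
qed

text \<open>Some positive power of \<open>t\<close> acts unipotently on the submodule generated by
  \<open>a\<close>.\<close>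

definition killed :: "'a \<Rightarrow> 'b \<Rightarrow> bool" where
  "killed t a \<longleftrightarrow> (\<exists>n k. n > 0 \<and> ev (rpow k (rdiff t n)) a = \<one>)"

lemma ev_rpow_mult:
  assumes "\<And>a. a \<in> A \<Longrightarrow> ev f a = ev e (ev d a)" "a \<in> A"
  shows "ev (rpow k f) a = ev (rpow k e) (ev (rpow k d) a)"
proof (induction k)
  case (Suc k)
  have "ev (rpow (Suc k) f) a = ev e (ev d (ev (rpow k e) (ev (rpow k d) a)))"
    using assms Suc by simp
  also have "ev d (ev (rpow k e) (ev (rpow k d) a)) = ev (rpow k e) (ev d (ev (rpow k d) a))"
    by (rule ev_commute) (simp add: assms)
  finally show ?case by simp
qed simp

text \<open>This monotonicity gives common parameters \<open>n\<close> and \<open>k\<close> for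
  finitely many elements.\<close>

lemma killed_dvd:
  assumes "a \<in> A" "ev (rpow k (rdiff t n)) a = \<one>"
  shows "ev (rpow (j + k) (rdiff t (n * m))) a = \<one>"
proof -
  obtain e where "\<And>a. a \<in> A \<Longrightarrow> ev (rdiff t (n * m)) a = ev e (ev (rdiff t n) a)" using rdiff_dvd by blast
  then have "ev (rpow k (rdiff t (n * m))) a = \<one>"
    using ev_rpow_mult[of "rdiff t (n * m)" e "rdiff t n" a k] assms by simp
  then show ?thesis by (simp add: ev_rpow_add)
qed

lemma killed_common:
  assumes "a \<in> A" "b \<in> A" "killed t a" "killed t b"
  obtains n k where "n > 0" "ev (rpow k (rdiff t n)) a = \<one>" "ev (rpow k (rdiff t n)) b = \<one>"
proof -
  obtain n k n' k' where n: "n > 0" "ev (rpow k (rdiff t n)) a = \<one>" "n' > 0" "ev (rpow k' (rdiff t n')) b = \<one>"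
    using assms by (auto simp: killed_def)
  show ?thesis
  proof (rule that[of "n * n'" "k' + k"])
    show "ev (rpow (k' + k) (rdiff t (n * n'))) a = \<one>" by (rule killed_dvd) (use assms n in auto)
    show "ev (rpow (k' + k) (rdiff t (n * n'))) b = \<one>"
      using killed_dvd[of b k' t n' k n] assms n by (simp add: mult.commute add.commute)
  qed (use n in simp)
qed

lemma invariant_killed: "invariant {a \<in> A. killed t a}"
proof (rule invariantI)
  show "\<one> \<in> {a \<in> A. killed t a}" 
  proof -
    have "killed t \<one>" unfolding killed_def by (rule exI[of _ 1], rule exI[of _ 0]) simp
    then show ?thesis by simp
  qed
  fix x assume x: "x \<in> {a \<in> A. killed t a}"
  then obtain n k where n: "n > 0" "ev (rpow k (rdiff t n)) x = \<one>" by (auto simp: killed_def)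
  show "inv x \<in> {a \<in> A. killed t a}" using x n by (auto simp: killed_def ev_inv)
  show "ev e x \<in> {a \<in> A. killed t a}" for e
  proof -
    have "ev (rpow k (rdiff t n)) (ev e x) = ev e (ev (rpow k (rdiff t n)) x)" by (rule ev_commute) (use x in simp)
    then show ?thesis using x n by (auto simp: killed_def)
  qed
  fix y assume y: "y \<in> {a \<in> A. killed t a}"
  obtain n k where "n > 0" "ev (rpow k (rdiff t n)) x = \<one>" "ev (rpow k (rdiff t n)) y = \<one>"
    using killed_common[of x y t] x y by blast
  moreover from this have "ev (rpow k (rdiff t n)) (x \<otimes> y) = \<one>" using x y by (simp add: ev_mult)
  ultimately show "x \<otimes> y \<in> {a \<in> A. killed t a}" using x y unfolding killed_def by auto
qed simp

section \<open>Saturated submodules: the norms and all \<open>t^n - 1\<close> are injective on the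
  quotient\<close>

definition saturated :: "'a \<Rightarrow> 'b set \<Rightarrow> bool" where
  "saturated t N \<longleftrightarrow> invariant N \<and>
     (\<forall>q g a. prime q \<and> q \<notin> \<pi> \<and> g \<in> carrier G \<and> a \<in> A \<and> ev (rgeo q (RGen g)) a \<in> N \<longrightarrow> a \<in> N) \<and>
     (\<forall>n a. n > 0 \<and> a \<in> A \<and> ev (rdiff t n) a \<in> N \<longrightarrow> a \<in> N)"

lemma saturatedD:
  assumes "saturated t N"
  shows "invariant N"
    and "prime q \<Longrightarrow> q \<notin> \<pi> \<Longrightarrow> g \<in> carrier G \<Longrightarrow> a \<in> A \<Longrightarrow> ev (rgeo q (RGen g)) a \<in> N \<Longrightarrow> a \<in> N"
    and "n > 0 \<Longrightarrow> a \<in> A \<Longrightarrow> ev (rdiff t n) a \<in> N \<Longrightarrow> a \<in> N"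
  using assms unfolding saturated_def by blast+

text \<open>Terms commute, so \<open>(t^n - 1)^k\<close> can be moved past a norm, which is
  injective by \<open>norm_injective\<close>. As \<open>t^m - 1\<close> divides
  \<open>t^(m n) - 1\<close>, applying it is absorbed by one more factor in the power.\<close>

lemma saturated_killed: "saturated t {a \<in> A. killed t a}"
  unfolding saturated_def
proof (intro conjI allI impI invariant_killed; elim conjE)
  fix q g a assume q: "prime q" "q \<notin> \<pi>" "g \<in> carrier G" and a: "a \<in> A"
    and "ev (rgeo q (RGen g)) a \<in> {a \<in> A. killed t a}"
  then obtain n k where n: "n > 0" "ev (rpow k (rdiff t n)) (ev (rgeo q (RGen g)) a) = \<one>" by (auto simp: killed_def)
  have "ev (rgeo q (RGen g)) (ev (rpow k (rdiff t n)) a) = \<one>"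
    unfolding n(2)[symmetric] by (rule ev_commute[OF a])
  then have "ev (rpow k (rdiff t n)) a = \<one>" using norm_injective[OF q] a by simp
  then show "a \<in> {a \<in> A. killed t a}" using a n(1) by (auto simp: killed_def)
next
  fix m :: nat and a assume m: "m > 0" and a: "a \<in> A" and "ev (rdiff t m) a \<in> {a \<in> A. killed t a}"
  then obtain n k where n: "n > 0" "ev (rpow k (rdiff t n)) (ev (rdiff t m) a) = \<one>" by (auto simp: killed_def)
  obtain e where e: "\<And>a. a \<in> A \<Longrightarrow> ev (rdiff t (m * n)) a = ev e (ev (rdiff t m) a)" using rdiff_dvd by blast
  have "ev (rpow (0 + k) (rdiff t (n * m))) (ev (rdiff t m) a) = \<one>"
    by (rule killed_dvd) (use n a in simp_all)
  then have 1: "ev (rpow k (rdiff t (m * n))) (ev (rdiff t m) a) = \<one>" by (simp add: mult.commute)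
  have "ev (rpow k (rdiff t (m * n))) (ev e (ev (rdiff t m) a)) = ev e (ev (rpow k (rdiff t (m * n))) (ev (rdiff t m) a))"
    by (rule ev_commute) (use a in simp)
  also have "\<dots> = \<one>" unfolding 1 by simp
  finally have "ev (rpow (k + 1) (rdiff t (m * n))) a = \<one>" unfolding ev_rpow_add using e[OF a] by simp
  then show "a \<in> {a \<in> A. killed t a}" using a n(1) m unfolding killed_def
    by (metis (mono_tags, lifting) mem_Collect_eq nat_0_less_mult_iff)
qed

lemma saturated_Union:
  assumes "\<C> \<noteq> {}" and sat: "\<And>N. N \<in> \<C> \<Longrightarrow> saturated t N"
    and lin: "\<And>N N'. N \<in> \<C> \<Longrightarrow> N' \<in> \<C> \<Longrightarrow> N \<subseteq> N' \<or> N' \<subseteq> N"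
  shows "saturated t (\<Union>\<C>)"
proof -
  obtain N0 where N0: "N0 \<in> \<C>" using assms(1) by blast
  have inv: "invariant N" if "N \<in> \<C>" for N using saturatedD(1)[OF sat[OF that]] .
  have "invariant (\<Union>\<C>)"
  proof (rule invariantI)
    show "\<Union>\<C> \<subseteq> A" using invariant_subset[OF inv] by blast
    show "\<one> \<in> \<Union>\<C>" using N0 invariant_group(1)[OF inv] by blast
    show "inv x \<in> \<Union>\<C>" if "x \<in> \<Union>\<C>" for x using that invariant_group(3)[OF inv] by blast
    show "ev e x \<in> \<Union>\<C>" if "x \<in> \<Union>\<C>" for e x using that invariant_ev[OF inv] by blast
    fix x y assume "x \<in> \<Union>\<C>" "y \<in> \<Union>\<C>"
    then obtain B C where "B \<in> \<C>" "C \<in> \<C>" "x \<in> B" "y \<in> C" by blast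
    then obtain N where "N \<in> \<C>" "x \<in> N" "y \<in> N" using lin by blast
    then show "x \<otimes> y \<in> \<Union>\<C>" using invariant_group(2)[OF inv] by blast
  qed
  moreover have "a \<in> \<Union>\<C>" if "prime q" "q \<notin> \<pi>" "g \<in> carrier G" "a \<in> A" "ev (rgeo q (RGen g)) a \<in> \<Union>\<C>" for q g a
    using that saturatedD(2)[OF sat] by blast
  moreover have "a \<in> \<Union>\<C>" if "n > 0" "a \<in> A" "ev (rdiff t n) a \<in> \<Union>\<C>" for n a
    using that saturatedD(3)[OF sat] by blast
  ultimately show ?thesis unfolding saturated_def by blast
qed

text \<open>Zorn's lemma for saturated submodules that do not contain \<open>gen_comms\<close>, a
  condition inherited by unions of chains because \<open>gen_comms\<close> is finite. The elements
  killed by \<open>t\<close> provide the start, and a properly larger saturated submodule contains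
  the generators of \<open>A\<close>.\<close>

lemma maximal_saturated:
  assumes "a0 \<in> gen_comms" "\<not> killed t a0"
  obtains N where "saturated t N" "\<not> A \<subseteq> N"
    and "\<And>N'. saturated t N' \<Longrightarrow> N \<subseteq> N' \<Longrightarrow> N' \<noteq> N \<Longrightarrow> A \<subseteq> N'"
proof -
  define \<N> where "\<N> = {N. saturated t N \<and> \<not> gen_comms \<subseteq> N}"
  have start: "{a \<in> A. killed t a} \<in> \<N>"
    using assms saturated_killed unfolding \<N>_def by blast
  have chain: "\<Union>\<C> \<in> \<N>" if \<C>: "\<C> \<noteq> {}" "subset.chain \<N> \<C>" for \<C>
  proof -
    have sub: "\<C> \<subseteq> \<N>" and lin: "\<And>B C. B \<in> \<C> \<Longrightarrow> C \<in> \<C> \<Longrightarrow> B \<subseteq> C \<or> C \<subseteq> B"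
      using \<C>(2) by (auto simp: subset.chain_def)
    have "saturated t (\<Union>\<C>)" by (rule saturated_Union[OF \<C>(1) _ lin]) (use sub in \<open>auto simp: \<N>_def\<close>)
    moreover have "\<not> gen_comms \<subseteq> \<Union>\<C>"
    proof
      assume "gen_comms \<subseteq> \<Union>\<C>"
      then obtain B where "B \<in> \<C>" "gen_comms \<subseteq> B"
        using finite_subset_Union_chain[OF finite_gen_comms _ \<C>] by blast
      then show False using sub by (auto simp: \<N>_def)
    qed
    ultimately show ?thesis by (simp add: \<N>_def)
  qed
  have "\<exists>N \<in> \<N>. \<forall>N' \<in> \<N>. N \<subseteq> N' \<longrightarrow> N' = N"
    by (rule subset_Zorn_nonempty) (use start chain in auto)
  then obtain N where N: "N \<in> \<N>" and max: "\<And>N'. N' \<in> \<N> \<Longrightarrow> N \<subseteq> N' \<Longrightarrow> N' = N" by blast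
  show ?thesis
  proof (rule that)
    show "saturated t N" using N by (simp add: \<N>_def)
    show "\<not> A \<subseteq> N" using N gen_comms_subset by (auto simp: \<N>_def)
    show "A \<subseteq> N'" if "saturated t N'" "N \<subseteq> N'" "N' \<noteq> N" for N'
    proof -
      have "gen_comms \<subseteq> N'" using max[of N'] that unfolding \<N>_def by blast
      then show ?thesis by (rule gen_comms_generate[OF saturatedD(1)[OF that(1)]])
    qed
  qed
qed

section \<open>The quotient by a maximal saturated submodule: torsion-free of rank one\<close>

context
  fixes t N
  assumes t: "t \<in> carrier G" and sat: "saturated t N" and proper: "\<not> A \<subseteq> N"
    and max: "\<And>N'. saturated t N' \<Longrightarrow> N \<subseteq> N' \<Longrightarrow> N' \<noteq> N \<Longrightarrow> A \<subseteq> N'"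
begin

lemma inv_N: "invariant N"
  using saturatedD(1)[OF sat] .

text \<open>The preimage \<open>N'\<close> of \<open>N\<close> under \<open>e\<close> contains
  \<open>N\<close> and is saturated, because \<open>e\<close> commutes with the terms tested. By
  maximality it is \<open>N\<close> or all of \<open>A\<close>, and in the latter case
  \<open>e\<close> is zero on \<open>A / N\<close>.\<close>

lemma ev_nonzero:
  assumes e: "\<not> rel N e RZero" and a: "a \<in> A" "ev e a \<in> N"
  shows "a \<in> N"
proof -
  define N' where "N' = {x \<in> A. ev e x \<in> N}"
  have "invariant N'"
  proof (rule invariantI)
    show "\<one> \<in> N'" using invariant_group(1)[OF inv_N] by (simp add: N'_def)
    show "x \<otimes> y \<in> N'" if "x \<in> N'" "y \<in> N'" for x y
      using that invariant_group(2)[OF inv_N] by (simp add: N'_def ev_mult)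
    show "inv x \<in> N'" if "x \<in> N'" for x
      using that invariant_group(3)[OF inv_N] by (simp add: N'_def ev_inv)
    show "ev f x \<in> N'" if "x \<in> N'" for f x
      using that invariant_ev[OF inv_N, of "ev e x" f] ev_commute[of x e f] by (simp add: N'_def)
  qed (auto simp: N'_def)
  moreover have "x \<in> N'" if "x \<in> A" "ev f x \<in> N'" and f: "\<And>y. y \<in> A \<Longrightarrow> ev f y \<in> N \<Longrightarrow> y \<in> N" for f x
    using that(1,2) f[of "ev e x"] ev_commute[of x e f] by (simp add: N'_def)
  ultimately have "saturated t N'"
    unfolding saturated_def using saturatedD(2,3)[OF sat] by blast
  moreover have "N \<subseteq> N'"
    using invariant_subset[OF inv_N] invariant_ev[OF inv_N] by (auto simp: N'_def)
  moreover have "\<not> A \<subseteq> N'" using e by (auto simp: rel_zero_iff[OF inv_N] N'_def)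
  ultimately have "N' = N" using max by blast
  then show ?thesis using a by (auto simp: N'_def)
qed

lemma nonzero_mult:
  assumes "\<not> rel N e RZero" "\<not> rel N f RZero"
  shows "\<not> rel N (RMul e f) RZero"
proof -
  obtain b where b: "b \<in> A" "ev f b \<notin> N" using assms(2) by (auto simp: rel_zero_iff[OF inv_N])
  then have "ev e (ev f b) \<notin> N" using ev_nonzero[OF assms(1), of "ev f b"] by auto
  then show ?thesis using b(1) by (auto simp: rel_zero_iff[OF inv_N])
qed

lemma rgeo_nonzero:
  assumes "prime q" "q \<notin> \<pi>" "g \<in> carrier G"
  shows "\<not> rel N (rgeo q (RGen g)) RZero"
  using saturatedD(2)[OF sat assms] proper by (auto simp: rel_zero_iff[OF inv_N])

lemma rdiff_nonzero: "n > 0 \<Longrightarrow> \<not> rel N (rdiff t n) RZero"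
  using saturatedD(3)[OF sat] proper by (auto simp: rel_zero_iff[OF inv_N])

text \<open>The elements that some nonzero term maps, modulo \<open>N\<close>, into the submodule
  generated by \<open>v\<close> form a saturated submodule properly containing \<open>N\<close>,
  hence all of \<open>A\<close>.\<close>

lemma rank_one:
  assumes v: "v \<in> A" "v \<notin> N" and w: "w \<in> A"
  shows "\<exists>d n. \<not> rel N d RZero \<and> eqv N (ev d w) (ev n v)"
proof -
  note eq = eqv_refl[OF inv_N] eqv_sym[OF inv_N] eqv_trans[OF inv_N] eqv_mult[OF inv_N]
    eqv_inv[OF inv_N] eqv_ev[OF inv_N]
  define N' where "N' = {w \<in> A. \<exists>d n. \<not> rel N d RZero \<and> eqv N (ev d w) (ev n v)}"
  have one: "\<not> rel N ROne RZero" using proper by (auto simp: rel_zero_iff[OF inv_N])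
  have "invariant N'"
  proof (rule invariantI)
    have "eqv N (ev ROne \<one>) (ev RZero v)" using eq(1)[of \<one>] by simp
    then show "\<one> \<in> N'" unfolding N'_def using one A_group(1) by blast
    fix x assume "x \<in> N'"
    then obtain d n where x: "x \<in> A" "\<not> rel N d RZero" "eqv N (ev d x) (ev n v)" by (auto simp: N'_def)
    show "inv x \<in> N'"
    proof -
      have "eqv N (ev d (inv x)) (ev (RNeg n) v)" using x eq(5)[OF x(3)] by (simp add: ev_inv)
      then show ?thesis unfolding N'_def using x(1,2) A_group(3) by blast
    qed
    show "ev e x \<in> N'" for e
    proof -
      have "eqv N (ev d (ev e x)) (ev (RMul e n) v)"
        using eq(6)[OF x(3), of e] ev_commute[OF x(1), of d e] by simp
      then show ?thesis unfolding N'_def using x(1,2) ev_closed by blast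
    qed
    fix y assume "y \<in> N'"
    then obtain d' n' where y: "y \<in> A" "\<not> rel N d' RZero" "eqv N (ev d' y) (ev n' v)" by (auto simp: N'_def)
    have "eqv N (ev d (ev d' x) \<otimes> ev d (ev d' y)) (ev d' (ev n v) \<otimes> ev d (ev n' v))"
      using eq(4)[OF eq(6)[OF x(3), of d'] eq(6)[OF y(3), of d]] x(1) ev_commute[of x d d'] by simp
    then have "eqv N (ev (RMul d d') (x \<otimes> y)) (ev (RAdd (RMul d' n) (RMul d n')) v)"
      using x(1) y(1) by (simp add: ev_mult)
    then show "x \<otimes> y \<in> N'" unfolding N'_def using nonzero_mult[OF x(2) y(2)] x(1) y(1) A_group(2) by blast
  qed (auto simp: N'_def)
  moreover have sat': "x \<in> N'" if x: "x \<in> A" "ev f x \<in> N'" and f: "\<not> rel N f RZero" for f x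
  proof -
    obtain d n where "\<not> rel N d RZero" "eqv N (ev d (ev f x)) (ev n v)" using x by (auto simp: N'_def)
    then have "\<not> rel N (RMul d f) RZero \<and> eqv N (ev (RMul d f) x) (ev n v)"
      using nonzero_mult f by simp
    then show ?thesis using x(1) unfolding N'_def by blast
  qed
  ultimately have "saturated t N'"
    unfolding saturated_def using rgeo_nonzero rdiff_nonzero by blast
  moreover have "N \<subseteq> N'"
  proof
    fix x assume x: "x \<in> N"
    then have "eqv N (ev ROne x) (ev RZero v)" using eqv_one_iff[OF inv_N] invariant_subset[OF inv_N] by simp
    then show "x \<in> N'" using one x invariant_subset[OF inv_N x] unfolding N'_def by blast
  qed
  moreover have "v \<in> N'"
  proof -
    have "eqv N (ev ROne v) (ev ROne v)" using v(1) eq(1) by simp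
    then show ?thesis unfolding N'_def using one v(1) by blast
  qed
  ultimately have "A \<subseteq> N'" using max v(2) by blast
  then show ?thesis using w by (auto simp: N'_def)
qed

text \<open>The difference of the terms maps \<open>v\<close> into \<open>N\<close>; were it nonzero
  on \<open>A / N\<close>, it would be injective there.\<close>

lemma rel_if_eqv_at:
  assumes v: "v \<in> A" "v \<notin> N" and ef: "eqv N (ev e v) (ev f v)"
  shows "rel N e f"
proof -
  have "ev (RAdd e (RNeg f)) v \<in> N" using ef by (simp add: eqv_def[OF inv_N])
  then have "rel N (RAdd e (RNeg f)) RZero" using ev_nonzero v by blast
  then show ?thesis by (simp add: rel_zero_iff[OF inv_N]) (simp add: rel_def[OF inv_N] eqv_def[OF inv_N])
qed

lemma comm_product: "x \<in> carrier G \<Longrightarrow> y \<in> carrier G \<Longrightarrow>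
    comm (\<phi> (x \<otimes>\<^bsub>G\<^esub> y)) (\<phi> t) = ev (RGen x) (comm (\<phi> y) (\<phi> t)) \<otimes> comm (\<phi> x) (\<phi> t)"
  using t by (simp add: comm_mult_left)

text \<open>This is the rule \<open>comm_product\<close>, written additively with coordinates
  \<open>n / d\<close> relative to \<open>v\<close> and multiplied by all denominators. By
  \<open>rel_if_eqv_at\<close> it may be evaluated at \<open>v\<close>.\<close>

lemma derivation_identity:
  assumes v: "v \<in> A" "v \<notin> N" and xy: "x \<in> carrier G" "y \<in> carrier G"
    and eqs: "eqv N (ev d (comm (\<phi> (x \<otimes>\<^bsub>G\<^esub> y)) (\<phi> t))) (ev n v)"
      "eqv N (ev d1 (comm (\<phi> x) (\<phi> t))) (ev n1 v)"
      "eqv N (ev d2 (comm (\<phi> y) (\<phi> t))) (ev n2 v)"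
  shows "rel N (RMul n (RMul d1 d2)) (RMul d (RAdd (RMul n1 d2) (RMul (RGen x) (RMul n2 d1))))"
proof (rule rel_if_eqv_at[OF v])
  note eq = eqv_sym[OF inv_N] eqv_trans[OF inv_N] eqv_mult[OF inv_N] eqv_ev[OF inv_N]
  define w1 w2 where "w1 = comm (\<phi> x) (\<phi> t)" and "w2 = comm (\<phi> y) (\<phi> t)"
  have w: "w1 \<in> A" "w2 \<in> A" using xy t by (simp_all add: w1_def w2_def comm_image_in_A)
  let ?g = "ev (RGen x)"
  have "ev n (ev d1 (ev d2 v)) = ev d1 (ev d2 (ev n v))"
    using v(1) ev_commute[of "ev d2 v" n d1] ev_commute[of v n d2] ev_closed by metis
  moreover have "eqv N (ev d1 (ev d2 (ev n v))) (ev d1 (ev d2 (ev d (?g w2 \<otimes> w1))))"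
    using eq(1)[OF eq(4)[OF eq(4)[OF eqs(1)]]] unfolding comm_product[OF xy] w1_def w2_def .
  moreover have "ev d1 (ev d2 (ev d (?g w2 \<otimes> w1))) = ev d (ev d1 (ev d2 (?g w2 \<otimes> w1)))"
    using w ev_commute[of "?g w2 \<otimes> w1" d d2] ev_commute[of "ev d2 (?g w2 \<otimes> w1)" d d1] ev_closed A_group(2) by metis
  moreover have "ev d1 (ev d2 (?g w2 \<otimes> w1)) = ev d1 (ev d2 (?g w2)) \<otimes> ev d1 (ev d2 w1)"
    using w by (metis ev_mult ev_closed)
  ultimately have lhs: "eqv N (ev n (ev d1 (ev d2 v))) (ev d (ev d1 (ev d2 (?g w2)) \<otimes> ev d1 (ev d2 w1)))"
    by simp
  have "ev d2 (ev d1 w1) = ev d1 (ev d2 w1)" using w by (metis ev_commute)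
  moreover have "ev d2 (ev n1 v) = ev n1 (ev d2 v)" using v(1) by (metis ev_commute)
  ultimately have r1: "eqv N (ev d1 (ev d2 w1)) (ev n1 (ev d2 v))"
    using eq(4)[OF eqs(2), of d2] unfolding w1_def by simp
  have "?g (ev d1 (ev d2 w2)) = ev d1 (ev d2 (?g w2))" using w by (metis ev_commute ev_closed)
  moreover have "?g (ev d1 (ev n2 v)) = ?g (ev n2 (ev d1 v))" using v(1) by (metis ev_commute)
  ultimately have r2: "eqv N (ev d1 (ev d2 (?g w2))) (?g (ev n2 (ev d1 v)))"
    using eq(4)[OF eq(4)[OF eqs(3), of d1], of "RGen x"] unfolding w2_def by metis
  have "eqv N (ev d (ev d1 (ev d2 (?g w2)) \<otimes> ev d1 (ev d2 w1))) (ev d (?g (ev n2 (ev d1 v)) \<otimes> ev n1 (ev d2 v)))"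
    using eq(4)[OF eq(3)[OF r2 r1]] .
  moreover have "?g (ev n2 (ev d1 v)) \<otimes> ev n1 (ev d2 v) = ev n1 (ev d2 v) \<otimes> ?g (ev n2 (ev d1 v))"
    using v(1) by (intro A_comm ev_closed)
  ultimately show "eqv N (ev (RMul n (RMul d1 d2)) v) (ev (RMul d (RAdd (RMul n1 d2) (RMul (RGen x) (RMul n2 d1)))) v)"
    using eq(2)[OF lhs] by simp
qed

end

end

text \<open>In the rank-one module \<open>A / N\<close>, the commutators with \<open>t\<close> have
  coordinates \<open>num x / den x\<close> relative to \<open>v\<close>. These form the derivation
  of an obstruction, and the action on \<open>A / N\<close> yields its character.\<close>

lemma not_killed_imp_not_solvable:
  fixes G :: "'a monoid" and L :: "('b, 'n) monoid_scheme"
  assumes "metabelian_image L G \<phi> S \<pi>" and \<pi>: "finite \<pi>" and t: "t \<in> carrier G"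
    and a0: "a0 \<in> metabelian_image.gen_comms L \<phi> S" "\<not> metabelian_image.killed L G \<phi> t a0"
  shows "\<not> solvable (term_localization \<pi> G)"
proof
  assume sol: "solvable (term_localization \<pi> G)"
  interpret metabelian_image L G \<phi> S \<pi> by fact
  obtain N where sat: "saturated t N" and proper: "\<not> A \<subseteq> N"
    and max: "\<And>N'. saturated t N' \<Longrightarrow> N \<subseteq> N' \<Longrightarrow> N' \<noteq> N \<Longrightarrow> A \<subseteq> N'"
    using maximal_saturated[OF a0] by blast
  have iN: "invariant N" by (rule saturatedD(1)[OF sat])
  obtain v where v: "v \<in> A" "v \<notin> N" using proper by blast
  \<comment> \<open>Besides being the base vector, \<open>v\<close> acts trivially on
    \<open>A\<close>, and the derivation will not vanish at its preimage \<open>a\<close>.\<close>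
  obtain a where a: "a \<in> carrier G" "v = \<phi> a" using v(1) A_subset_image by blast
  have "\<forall>x \<in> carrier G. \<exists>d n. \<not> rel N d RZero \<and> eqv N (ev d (comm (\<phi> x) (\<phi> t))) (ev n v)"
    using rank_one[OF t sat proper max v] comm_image_in_A t by blast
  then obtain den num where dn: "\<And>x. x \<in> carrier G \<Longrightarrow> \<not> rel N (den x) RZero"
    "\<And>x. x \<in> carrier G \<Longrightarrow> eqv N (ev (den x) (comm (\<phi> x) (\<phi> t))) (ev (num x) v)" by metis
  have "domain_congruence (rel N)"
    by (rule domain_congruence_rel[OF iN proper]) (rule ev_nonzero[OF t sat proper max])
  moreover have "obstruction G \<pi> (rel N) S num den a"
  proof (intro obstruction.intro obstruction_axioms.intro G S \<pi> sol a(1) dn(1))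
    show "rel N (RGen (x \<otimes>\<^bsub>G\<^esub> y)) (RMul (RGen x) (RGen y))" if "x \<in> carrier G" "y \<in> carrier G" for x y
      unfolding rel_def[OF iN]
    proof
      fix b assume b: "b \<in> A"
      then have "ev (RGen (x \<otimes>\<^bsub>G\<^esub> y)) b = ev (RMul (RGen x) (RGen y)) b"
        using that by (simp add: m_assoc inv_mult_group)
      then show "eqv N (ev (RGen (x \<otimes>\<^bsub>G\<^esub> y)) b) (ev (RMul (RGen x) (RGen y)) b)"
        using eqv_refl[OF iN ev_closed[OF b]] by metis
    qed
    show "rel N (RGen \<one>\<^bsub>G\<^esub>) ROne" by (simp add: rel_def[OF iN] eqv_refl[OF iN])
    show "\<not> rel N (rgeo q (RGen x)) RZero" if "prime q" "q \<notin> \<pi>" "x \<in> carrier G" for q x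
      using rgeo_nonzero[OF t sat proper max that] .
    show "\<exists>x \<in> carrier G. \<not> rel N (rpow m (RGen x)) ROne" if "m > 0" for m
    proof
      show "\<not> rel N (rpow m (RGen t)) ROne"
        using rdiff_nonzero[OF t sat proper max that]
        by (auto simp: rel_def[OF iN] eqv_def[OF iN] ev_rdiff)
    qed (rule t)
    show "rel N (RMul (num (x \<otimes>\<^bsub>G\<^esub> y)) (RMul (den x) (den y)))
        (RMul (den (x \<otimes>\<^bsub>G\<^esub> y)) (RAdd (RMul (num x) (den y)) (RMul (RGen x) (RMul (num y) (den x)))))"
      if "x \<in> carrier G" "y \<in> carrier G" for x y
      by (rule derivation_identity[OF t sat proper max v that
            dn(2)[OF \<phi>.G.m_closed[OF that]] dn(2)[OF that(1)] dn(2)[OF that(2)]])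
    show "rel N (RGen a) ROne"
      unfolding rel_def[OF iN]
    proof
      fix b assume b: "b \<in> A"
      have "ev (RGen a) b = b \<otimes>\<^bsub>L\<^esub> (v \<otimes>\<^bsub>L\<^esub> inv\<^bsub>L\<^esub> v)"
        using a A_comm[OF v(1) b] A_closed[OF v(1)] A_closed[OF b] by (simp add: m_assoc)
      then show "eqv N (ev (RGen a) b) (ev ROne b)" using v(1) b by (simp add: eqv_refl[OF iN])
    qed
    show "\<not> rel N (num a) RZero"
    proof
      assume "rel N (num a) RZero"
      then have "ev (num a) v \<in> N" using v(1) by (simp add: rel_zero_iff[OF iN])
      then have "ev (den a) (comm v (\<phi> t)) \<in> N" using eqv_in[OF iN dn(2)[OF a(1)]] a(2) by simp
      moreover have c: "comm v (\<phi> t) \<in> A" using comm_image_in_A[OF a(1) t] a(2) by simp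
      ultimately have "comm v (\<phi> t) \<in> N" using ev_nonzero[OF t sat proper max dn(1)[OF a(1)]] by blast
      then have "inv\<^bsub>L\<^esub> (comm v (\<phi> t)) \<in> N" by (rule invariant_group(3)[OF iN])
      \<comment> \<open>The inverse commutator is \<open>(t - 1) v\<close>, so saturation would
        force \<open>v\<close> into \<open>N\<close>.\<close>
      moreover have "inv\<^bsub>L\<^esub> (comm v (\<phi> t)) = ev (rdiff t 1) v"
        using v(1) t by (simp add: ev_rdiff comm_def inv_mult_group m_assoc)
      ultimately have "v \<in> N" using saturatedD(3)[OF sat, of 1 v] v(1) by simp
      then show False using v(2) by simp
    qed
  qed
  ultimately show False using no_obstruction unfolding obstructed_def by blast
qed

section \<open>Nilpotent subgroups of local groups\<close>

primrec upper_central :: "('a, 'm) monoid_scheme \<Rightarrow> nat \<Rightarrow> 'a set" where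
  "upper_central G 0 = {\<one>\<^bsub>G\<^esub>}"
| "upper_central G (Suc n) =
     {x \<in> carrier G. \<forall>y \<in> carrier G. x \<otimes>\<^bsub>G\<^esub> y \<otimes>\<^bsub>G\<^esub> inv\<^bsub>G\<^esub> x \<otimes>\<^bsub>G\<^esub> inv\<^bsub>G\<^esub> y \<in> upper_central G n}"

definition root_closed :: "nat set \<Rightarrow> ('a, 'm) monoid_scheme \<Rightarrow> 'a set \<Rightarrow> bool" where
  "root_closed \<pi> G H \<longleftrightarrow> subgroup H G \<and>
     (\<forall>q x. prime (q::nat) \<and> q \<notin> \<pi> \<and> x \<in> carrier G \<and> x [^]\<^bsub>G\<^esub> q \<in> H \<longrightarrow> x \<in> H)"

text \<open>The local counterpart of a generating set; the image of a group in its localization has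
  this property.\<close>

definition root_dense :: "nat set \<Rightarrow> ('a, 'm) monoid_scheme \<Rightarrow> 'a set \<Rightarrow> bool" where
  "root_dense \<pi> G B \<longleftrightarrow> (\<forall>H. root_closed \<pi> G H \<and> B \<subseteq> H \<longrightarrow> H = carrier G)"

context group
begin

lemma normal_r_coset_eq_iff:
  assumes "N \<lhd> G" "x \<in> carrier G" "y \<in> carrier G"
  shows "N #> x = N #> y \<longleftrightarrow> x \<otimes> inv y \<in> N"
proof -
  interpret N: normal N G by fact
  show ?thesis
    using assms(2,3) N.rcos_const N.rcos_module rcos_self repr_independence N.subgroup_axioms is_group
    by (metis (no_types, lifting))
qed

lemma upper_central_Suc: "upper_central G (Suc n) = {x \<in> carrier G. \<forall>y \<in> carrier G. comm x y \<in> upper_central G n}"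
  by (simp add: comm_def)

lemma upper_central_normal_mono:
  "upper_central G n \<lhd> G \<and> upper_central G n \<subseteq> upper_central G (Suc n)"
proof (induction n)
  case 0
  have "{\<one>} \<lhd> G" by (rule normal_invI[OF triv_subgroup]) simp
  then show ?case by simp
next
  case (Suc n)
  let ?U = "upper_central G n" and ?V = "upper_central G (Suc n)"
  have sU: "subgroup ?U G" and conj: "\<And>g u. g \<in> carrier G \<Longrightarrow> u \<in> ?U \<Longrightarrow> g \<otimes> u \<otimes> inv g \<in> ?U"
    using Suc by (simp_all add: normal_inv_iff)
  have "subgroup (\<Inter>y\<in>carrier G. {x \<in> carrier G. comm x y \<in> ?U}) G"
    by (rule subgroups_Inter) (use subgroup_comm_mod[OF subgroup_self sU _ conj] in auto)
  moreover have "(\<Inter>y\<in>carrier G. {x \<in> carrier G. comm x y \<in> ?U}) = ?V"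
    unfolding upper_central_Suc using one_closed by blast
  ultimately have sV: "subgroup ?V G" by simp
  have normal: "?V \<lhd> G"
  proof (rule normal_invI[OF sV])
    fix g x assume g: "g \<in> carrier G" and x: "x \<in> ?V"
    then have "comm x (inv g \<otimes> y \<otimes> g) \<in> ?U" if "y \<in> carrier G" for y
      using that unfolding upper_central_Suc by simp
    then show "g \<otimes> x \<otimes> inv g \<in> ?V"
      using g x conj[OF g] unfolding upper_central_Suc by (simp add: comm_conj_left)
  qed
  have "?V \<subseteq> upper_central G (Suc (Suc n))"
  proof
    fix x assume x: "x \<in> ?V"
    then have xc: "x \<in> carrier G" by simp
    have "comm x y \<in> ?V" if y: "y \<in> carrier G" for y
    proof -
      have "y \<otimes> inv x \<otimes> inv y \<in> ?V"
        using normal y subgroup.m_inv_closed[OF sV x] by (simp only: normal_inv_iff)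
      then have "x \<otimes> (y \<otimes> inv x \<otimes> inv y) \<in> ?V" by (rule subgroup.m_closed[OF sV x])
      then show ?thesis using xc y by (simp only: comm_def m_assoc m_closed inv_closed)
    qed
    then show "x \<in> upper_central G (Suc (Suc n))" using xc by (simp only: upper_central_Suc[of "Suc n"]) blast
  qed
  then show ?case using normal by blast
qed

lemma upper_central_normal: "upper_central G n \<lhd> G"
  and upper_central_mono: "upper_central G n \<subseteq> upper_central G (Suc n)"
  using upper_central_normal_mono by blast+

lemma r_coset_group_hom: "N \<lhd> G \<Longrightarrow> group_hom G (G Mod N) (\<lambda>x. N #> x)"
  by (simp add: group_hom_def group_hom_axioms_def is_group normal.factorgroup_is_group normal.r_coset_hom_Mod)

text \<open>In the induction step, \<open>w = x^q y^(-q)\<close> has a root \<open>v\<close>. The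
  conjugates of \<open>v\<close> have \<open>q\<close>-th powers congruent to \<open>w\<close>
  modulo the \<open>n\<close>-th term, so \<open>v\<close> is central modulo this term by the
  induction hypothesis. Then \<open>(v y)^q\<close> is congruent to \<open>x^q\<close>, hence
  \<open>v y\<close> to \<open>x\<close>, and \<open>x y^(-1)\<close> lies with \<open>v\<close> in
  the next term.\<close>

lemma upper_central_root_unique:
  assumes loc: "pi_local \<pi> G" and q: "prime (q::nat)" "q \<notin> \<pi>"
  shows "x \<in> carrier G \<Longrightarrow> y \<in> carrier G \<Longrightarrow> x [^] q \<otimes> inv (y [^] q) \<in> upper_central G n \<Longrightarrow>
    x \<otimes> inv y \<in> upper_central G n"
proof (induction n arbitrary: x y)
  case 0
  have "x [^] q = y [^] q" using 0 by (simp add: inv_equality) (metis inv_equality inv_inv inv_closed nat_pow_closed)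
  moreover have "inj_on (\<lambda>x. x [^] q) (carrier G)" using loc q by (simp add: pi_local_def bij_betw_def)
  ultimately have "x = y" using 0(1,2) by (auto dest: inj_onD)
  then show ?case using 0 by simp
next
  case (Suc n)
  let ?U = "upper_central G n"
  let ?Q = "G Mod ?U"
  interpret h: group_hom G ?Q "\<lambda>x. ?U #> x" by (rule r_coset_group_hom[OF upper_central_normal])
  note eq_iff = normal_r_coset_eq_iff[OF upper_central_normal[of n]]
  have sS: "subgroup (upper_central G (Suc n)) G"
    using upper_central_normal by (rule normal_imp_subgroup)
  have root: "?U #> a = ?U #> b" if "a \<in> carrier G" "b \<in> carrier G" "?U #> (a [^] q) = ?U #> (b [^] q)" for a b
    using Suc.IH[OF that(1,2)] that eq_iff by simp
  define w where "w = x [^] q \<otimes> inv (y [^] q)"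
  have w: "w \<in> carrier G" "w \<in> upper_central G (Suc n)" using Suc.prems by (simp_all add: w_def)
  have "w \<in> (\<lambda>x. x [^] q) ` carrier G" using loc q w(1) by (simp add: pi_local_def bij_betw_def)
  then obtain v where v: "v \<in> carrier G" "v [^] q = w" by blast
  have central: "?U #> (z \<otimes> v \<otimes> inv z) = ?U #> v" if z: "z \<in> carrier G" for z
  proof (rule root)
    interpret c: group_hom G G "\<lambda>v. z \<otimes> v \<otimes> inv z" by (rule conj_group_hom[OF z])
    have "(z \<otimes> v \<otimes> inv z) [^] q = z \<otimes> w \<otimes> inv z"
      unfolding v(2)[symmetric] using c.hom_nat_pow[OF v(1), of q] by simp
    moreover have "w \<otimes> z \<otimes> inv w \<otimes> inv z \<in> ?U" using w(2) z by simp
    then have "z \<otimes> w \<otimes> inv z \<otimes> inv w \<in> ?U"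
      using subgroup.m_inv_closed[OF normal_imp_subgroup[OF upper_central_normal], of "w \<otimes> z \<otimes> inv w \<otimes> inv z" n] w z
      by (simp add: inv_mult_group m_assoc)
    then have "?U #> (z \<otimes> w \<otimes> inv z) = ?U #> w" using z w(1) by (subst eq_iff) simp_all
    ultimately show "?U #> ((z \<otimes> v \<otimes> inv z) [^] q) = ?U #> (v [^] q)" by (simp only: v(2))
  qed (use v z in simp_all)
  have vU: "v \<in> upper_central G (Suc n)"
  proof -
    have "v \<otimes> z \<otimes> inv v \<otimes> inv z \<in> ?U" if z: "z \<in> carrier G" for z
      using central[OF z] z v(1) eq_iff[of v "z \<otimes> v \<otimes> inv z"] by (simp add: inv_mult_group m_assoc)
    then show ?thesis using v(1) by simp
  qed
  have com: "(?U #> v) \<otimes>\<^bsub>?Q\<^esub> (?U #> y) = (?U #> y) \<otimes>\<^bsub>?Q\<^esub> (?U #> v)"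
  proof -
    have "?U #> (v \<otimes> y) = ?U #> (y \<otimes> v)"
      using vU Suc.prems(2) v(1) eq_iff[of "v \<otimes> y" "y \<otimes> v"] by (simp add: inv_mult_group m_assoc)
    then show ?thesis using v(1) Suc.prems(2) by (simp only: h.hom_mult)
  qed
  have "?U #> ((v \<otimes> y) [^] q) = ((?U #> v) \<otimes>\<^bsub>?Q\<^esub> (?U #> y)) [^]\<^bsub>?Q\<^esub> q"
    using v(1) Suc.prems(2) by (simp only: h.hom_nat_pow h.hom_mult m_closed)
  also have "\<dots> = (?U #> v) [^]\<^bsub>?Q\<^esub> q \<otimes>\<^bsub>?Q\<^esub> (?U #> y) [^]\<^bsub>?Q\<^esub> q"
    by (rule h.H.pow_mult_distrib[OF com h.hom_closed[OF v(1)] h.hom_closed[OF Suc.prems(2)]])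
  also have "\<dots> = ?U #> (w \<otimes> y [^] q)"
    using v(1) Suc.prems(2) w(1) by (simp only: h.hom_nat_pow[symmetric] v(2) h.hom_mult nat_pow_closed)
  also have "w \<otimes> y [^] q = x [^] q" using Suc.prems by (simp add: w_def m_assoc)
  finally have "?U #> (v \<otimes> y) = ?U #> x"
    using root[of "v \<otimes> y" x] v(1) Suc.prems by simp
  then have "x \<otimes> inv (v \<otimes> y) \<in> ?U" using eq_iff[of x "v \<otimes> y"] v(1) Suc.prems by simp
  then have "x \<otimes> inv (v \<otimes> y) \<in> upper_central G (Suc n)" using upper_central_mono by blast
  then have "(x \<otimes> inv (v \<otimes> y)) \<otimes> v \<in> upper_central G (Suc n)" using vU by (rule subgroup.m_closed[OF sS])
  then show ?case using v(1) Suc.prems(1,2) by (simp add: inv_mult_group m_assoc del: upper_central.simps)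
qed

lemma root_closed_upper_central:
  assumes "pi_local \<pi> G"
  shows "root_closed \<pi> G (upper_central G n)"
proof -
  have "x \<in> upper_central G n" if "prime (q::nat)" "q \<notin> \<pi>" "x \<in> carrier G" "x [^] q \<in> upper_central G n" for q x
    using upper_central_root_unique[OF assms that(1,2,3) one_closed, of n] that(3,4) by simp
  then show ?thesis
    unfolding root_closed_def using normal_imp_subgroup[OF upper_central_normal] by blast
qed

lemma lower_central_subgroup: "lower_central G n \<subseteq> carrier G \<and> subgroup (lower_central G n) G"
proof (induction n)
  case (Suc n)
  then have "{x \<otimes> y \<otimes> inv x \<otimes> inv y | x y. x \<in> lower_central G n \<and> y \<in> carrier G} \<subseteq> carrier G" by auto
  from generate_is_subgroup[OF this] generate_incl[OF this] show ?case by simp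
qed (simp add: subgroup_self)

text \<open>If \<open>y [^] q\<close> commutes with \<open>x\<close> modulo the upper central term,
  then \<open>y\<close> and its conjugate by \<open>x\<close> have congruent \<open>q\<close>-th
  powers, so they are congruent by uniqueness of roots.\<close>

lemma root_closed_centralizer_mod:
  assumes loc: "pi_local \<pi> G" and x: "x \<in> carrier G"
  shows "root_closed \<pi> G {y \<in> carrier G. comm y x \<in> upper_central G n}"
    (is "root_closed \<pi> G ?C")
proof -
  let ?U = "upper_central G n"
  have sU: "subgroup ?U G" and conj: "\<And>g u. g \<in> carrier G \<Longrightarrow> u \<in> ?U \<Longrightarrow> g \<otimes> u \<otimes> inv g \<in> ?U"
    using upper_central_normal by (simp_all add: normal_inv_iff)
  have "y \<in> ?C" if q: "prime (q::nat)" "q \<notin> \<pi>" and y: "y \<in> carrier G" "y [^] q \<in> ?C" for q y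
  proof -
    interpret c: group_hom G G "\<lambda>v. x \<otimes> v \<otimes> inv x" by (rule conj_group_hom[OF x])
    have "inv (comm (y [^] q) x) \<in> ?U" using y(2) subgroup.m_inv_closed[OF sU] by blast
    then have "(x \<otimes> y \<otimes> inv x) [^] q \<otimes> inv (y [^] q) \<in> ?U"
      using c.hom_nat_pow[OF y(1), of q] x y(1) by (simp add: comm_def inv_mult_group m_assoc)
    then have "inv ((x \<otimes> y \<otimes> inv x) \<otimes> inv y) \<in> ?U"
      using upper_central_root_unique[OF loc q] x y(1) subgroup.m_inv_closed[OF sU] by simp
    then show ?thesis using x y(1) by (simp add: comm_def inv_mult_group m_assoc)
  qed
  then show ?thesis
    unfolding root_closed_def using subgroup_comm_mod[OF subgroup_self sU x conj] by blast
qed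

text \<open>The lower central series of \<open>N\<close>, counted from its end, lies in the upper
  central series of \<open>G\<close>: centralizers modulo terms of the latter are root-closed, so
  they are all of \<open>G\<close> once they contain \<open>N\<close>. Thus \<open>N\<close> lies in
  \<open>upper_central G c\<close>, and by density so does \<open>G\<close>.\<close>

lemma nilpotent_if_root_dense:
  assumes loc: "pi_local \<pi> G" and N: "subgroup N G" "root_dense \<pi> G N"
    and c: "lower_central (G\<lparr>carrier := N\<rparr>) c = {\<one>}"
  shows "lower_central G c = {\<one>}"
proof -
  interpret N: group "G\<lparr>carrier := N\<rparr>" by (rule subgroup_imp_group[OF N(1)])
  let ?g = "lower_central (G\<lparr>carrier := N\<rparr>)"
  have gN: "?g j \<subseteq> N" for j using N.lower_central_subgroup by simp
  have dense: "C = carrier G" if "root_closed \<pi> G C" "N \<subseteq> C" for C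
    using that N(2) unfolding root_dense_def by blast
  have up: "?g (c - i) \<subseteq> upper_central G i" if "i \<le> c" for i
    using that
  proof (induction i)
    case (Suc i)
    define j where "j = c - Suc i"
    have j: "c - i = Suc j" using Suc.prems by (simp add: j_def)
    show ?case
    proof
      fix x assume "x \<in> ?g (c - Suc i)"
      then have x: "x \<in> ?g j" by (simp add: j_def)
      then have xN: "x \<in> N" "x \<in> carrier G" using gN subgroup.mem_carrier[OF N(1)] by blast+
      have "comm y x \<in> upper_central G i" if y: "y \<in> N" for y
      proof -
        have "x \<otimes> y \<otimes> inv x \<otimes> inv y \<in> ?g (Suc j)"
          unfolding lower_central.simps
          by (rule generate.incl) (use x y xN(1) N(1) in \<open>force simp: m_inv_consistent\<close>)
        then have "comm x y \<in> upper_central G i" using Suc.IH Suc.prems j by (auto simp: comm_def)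
        then show ?thesis
          using subgroup.m_inv_closed[OF normal_imp_subgroup[OF upper_central_normal]]
            xN(2) subgroup.mem_carrier[OF N(1) y] by (subst comm_swap) auto
      qed
      then have "N \<subseteq> {y \<in> carrier G. comm y x \<in> upper_central G i}"
        using subgroup.mem_carrier[OF N(1)] by blast
      then have C: "{y \<in> carrier G. comm y x \<in> upper_central G i} = carrier G"
        by (rule dense[OF root_closed_centralizer_mod[OF loc xN(2)]])
      have "comm x y \<in> upper_central G i" if y: "y \<in> carrier G" for y
        using C y xN(2) subgroup.m_inv_closed[OF normal_imp_subgroup[OF upper_central_normal], of "comm y x" i]
        by (subst comm_swap) auto
      then show "x \<in> upper_central G (Suc i)" using xN(2) by (simp add: comm_def)
    qed
  qed (simp add: c)
  have "N \<subseteq> upper_central G c" using up[of c] by simp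
  then have top: "upper_central G c = carrier G" by (rule dense[OF root_closed_upper_central[OF loc]])
  have "lower_central G i \<subseteq> upper_central G (c - i)" if "i \<le> c" for i
    using that
  proof (induction i)
    case (Suc i)
    have s: "c - i = Suc (c - Suc i)" using Suc.prems by simp
    have "{x \<otimes> y \<otimes> inv x \<otimes> inv y | x y. x \<in> lower_central G i \<and> y \<in> carrier G} \<subseteq> upper_central G (c - Suc i)"
      using Suc.IH Suc.prems unfolding s by auto
    then show ?case
      unfolding lower_central.simps
      by (rule generate_subgroup_incl) (rule normal_imp_subgroup[OF upper_central_normal])
  qed (simp add: top)
  from this[of c] have "lower_central G c \<subseteq> {\<one>}" by simp
  moreover have "\<one> \<in> lower_central G c" using lower_central_subgroup subgroup.one_closed by blast
  ultimately show ?thesis by blast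
qed

section \<open>Root closures and subgroups of finite index\<close>

definition root_closure :: "nat set \<Rightarrow> 'a set \<Rightarrow> 'a set" where
  "root_closure \<pi> B = \<Inter>{H. root_closed \<pi> G H \<and> B \<subseteq> H}"

lemma root_closed_root_closure: "root_closed \<pi> G (root_closure \<pi> B)" if "B \<subseteq> carrier G"
proof -
  have "root_closed \<pi> G (carrier G)" by (simp add: root_closed_def subgroup_self)
  then have ne: "{H. root_closed \<pi> G H \<and> B \<subseteq> H} \<noteq> {}" using that by blast
  have "subgroup (root_closure \<pi> B) G"
    unfolding root_closure_def by (rule subgroups_Inter[OF _ ne]) (simp add: root_closed_def)
  then show ?thesis unfolding root_closed_def[of _ _ "root_closure \<pi> B"]
    by (auto simp: root_closure_def root_closed_def)
qed

lemma root_closure_superset: "B \<subseteq> root_closure \<pi> B"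
  by (auto simp: root_closure_def)

lemma root_closure_least: "root_closed \<pi> G H \<Longrightarrow> B \<subseteq> H \<Longrightarrow> root_closure \<pi> B \<subseteq> H"
  by (auto simp: root_closure_def)

lemma pi_local_root_closed:
  assumes loc: "pi_local \<pi> G" and R: "root_closed \<pi> G R"
  shows "pi_local \<pi> (G\<lparr>carrier := R\<rparr>)"
proof (rule pi_local_subgroupI[OF is_group])
  show sR: "subgroup R G" using R by (simp add: root_closed_def)
  fix q :: nat and x assume q: "prime q" "q \<notin> \<pi>" and x: "x \<in> R"
  have xc: "x \<in> carrier G" using x by (rule subgroup.mem_carrier[OF sR])
  have bij: "bij_betw (\<lambda>x. x [^] q) (carrier G) (carrier G)" using loc q by (simp add: pi_local_def)
  show "x = y" if "y \<in> R" "x [^] q = y [^] q" for y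
    using bij that xc subgroup.mem_carrier[OF sR that(1)] by (auto simp: bij_betw_def dest: inj_onD)
  have "x \<in> (\<lambda>x. x [^] q) ` carrier G" using bij xc by (simp add: bij_betw_def)
  then obtain y where "y \<in> carrier G" "y [^] q = x" by blast
  then show "\<exists>y \<in> R. y [^] q = x" using R q x unfolding root_closed_def by blast
qed

lemma root_dense_root_closure:
  assumes B: "B \<subseteq> carrier G"
  shows "root_dense \<pi> (G\<lparr>carrier := root_closure \<pi> B\<rparr>) B"
  unfolding root_dense_def
proof (intro allI impI, elim conjE)
  let ?R = "root_closure \<pi> B"
  have R: "root_closed \<pi> G ?R" by (rule root_closed_root_closure[OF B])
  then have sR: "subgroup ?R G" by (simp add: root_closed_def)
  fix H assume H: "root_closed \<pi> (G\<lparr>carrier := ?R\<rparr>) H" and BH: "B \<subseteq> H"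
  have HR: "H \<subseteq> ?R" using H subgroup.subset by (fastforce simp: root_closed_def)
  have "subgroup H G"
    using H incl_subgroup[OF sR] by (simp add: root_closed_def)
  moreover have "x \<in> H" if "prime (q::nat)" "q \<notin> \<pi>" "x \<in> carrier G" "x [^] q \<in> H" for q x
  proof -
    have "x \<in> ?R" using R that HR unfolding root_closed_def by blast
    then show ?thesis using H that by (simp add: root_closed_def nat_pow_def)
  qed
  ultimately have "root_closed \<pi> G H" unfolding root_closed_def by blast
  then have "?R \<subseteq> H" by (rule root_closure_least[OF _ BH])
  then show "H = carrier (G\<lparr>carrier := ?R\<rparr>)" using HR by simp
qed

lemma root_closedD:
  assumes "root_closed \<pi> G H" "prime (q::nat)" "q \<notin> \<pi>" "x \<in> carrier G" "x [^] q \<in> H"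
  shows "x \<in> H"
  using assms unfolding root_closed_def by blast

lemma coprime_power_in_subgroup:
  assumes M: "subgroup M G" and x: "x \<in> carrier G" "x [^] (k::nat) \<in> M" "x [^] (q::nat) \<in> M" and "coprime k q"
  shows "x \<in> M"
proof -
  obtain u v where uv: "u * int k + v * int q = 1"
    using assms(5) bezout_int[of "int k" "int q"] by (auto simp: gcd_int_int_eq)
  have "x = x [^] (int k * u + int q * v)" using uv x(1) by (simp add: mult.commute)
  also have "\<dots> = (x [^] k) [^] u \<otimes> (x [^] q) [^] v"
    using x(1) by (simp add: int_pow_mult int_pow_pow flip: int_pow_int)
  also have "\<dots> \<in> M" using M x by (intro subgroup.m_closed[OF M] subgroup_int_pow_closed)
  finally show ?thesis .
qed

text \<open>A root-closed subgroup of finite index in \<open>M\<close> contains a power of each element of \<open>M\<close>, and the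
  exponent can be chosen coprime to a given prime outside \<open>\<pi>\<close>.\<close>

lemma root_closed_finite_index:
  assumes R: "root_closed \<pi> G R" and M: "subgroup M G" "R \<subseteq> M"
    and P: "finite P" "P \<subseteq> carrier G" "M \<subseteq> (\<Union>p\<in>P. R #> p)"
  shows "root_closed \<pi> G M"
  unfolding root_closed_def
proof (intro conjI allI impI M(1), elim conjE)
  have sR: "subgroup R G" using R by (simp add: root_closed_def)
  fix q :: nat and y assume q: "prime q" "q \<notin> \<pi>" and y: "y \<in> carrier G" "y [^] q \<in> M"
  define x where "x = y [^] q"
  have x: "x \<in> carrier G" "x \<in> M" using y by (simp_all add: x_def)
  have "\<exists>p \<in> P. x [^] i \<in> R #> p" for i :: nat
    using subgroup_nat_pow_closed[OF M(1) x(2), of i] P(3) by blast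
  then obtain p where p: "\<And>i::nat. p i \<in> P \<and> x [^] i \<in> R #> p i" by metis
  have "\<not> inj p"
  proof
    assume "inj p"
    moreover have "finite (range p)" using p finite_subset[OF _ P(1)] by blast
    ultimately show False using finite_imageD[of p UNIV] by simp
  qed
  then obtain i j where "p i = p j" "i \<noteq> j" by (auto simp: inj_on_def)
  then obtain i j where ij: "p i = p j" "i < j" by (metis linorder_neqE_nat)
  have "\<exists>k>0. x [^] (k::nat) \<in> R"
  proof -
    obtain r r' where r: "r \<in> R" "x [^] i = r \<otimes> p i" and r': "r' \<in> R" "x [^] j = r' \<otimes> p i"
      using p[of i] p[of j] ij(1) by (auto simp: r_coset_def)
    have rc: "r \<in> carrier G" "r' \<in> carrier G" using r(1) r'(1) subgroup.mem_carrier[OF sR] by auto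
    have pc: "p i \<in> carrier G" using p[of i] P(2) by blast
    have "r' \<otimes> p i = x [^] (j - i) \<otimes> (r \<otimes> p i)"
      using ij(2) x(1) by (simp add: r(2)[symmetric] r'(2)[symmetric] nat_pow_mult)
    then have "r' = x [^] (j - i) \<otimes> r" using rc pc x(1) by (simp add: m_assoc[symmetric])
    then have "x [^] (j - i) = r' \<otimes> inv r" using rc x(1) by (simp add: m_assoc)
    then have "x [^] (j - i) \<in> R"
      using subgroup.m_closed[OF sR r'(1) subgroup.m_inv_closed[OF sR r(1)]] by simp
    then show ?thesis using ij(2) by (intro exI[of _ "j - i"]) simp
  qed
  define k where "k = (LEAST k. k > 0 \<and> x [^] (k::nat) \<in> R)"
  have k: "k > 0 \<and> x [^] k \<in> R" unfolding k_def using \<open>\<exists>k>0. x [^] (k::nat) \<in> R\<close> by (rule LeastI_ex)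
  have "\<not> q dvd k"
  proof
    assume "q dvd k"
    then obtain m where m: "k = m * q" by (metis dvd_def mult.commute)
    have "(x [^] m) [^] q \<in> R" using k x(1) by (simp add: m nat_pow_pow)
    then have "x [^] m \<in> R" using R q x(1) unfolding root_closed_def by blast
    moreover have "m > 0" "m < k" using k m prime_gt_1_nat[OF q(1)] by auto
    ultimately show False using not_less_Least[of m] unfolding k_def by blast
  qed
  then have "coprime k q" using prime_imp_coprime[OF q(1)] coprime_commute by blast
  \<comment> \<open>This power is \<open>x [^] k\<close>, so \<open>y [^] k\<close> lies in
    \<open>R\<close>; together with \<open>y [^] q\<close> in \<open>M\<close> and coprime
    exponents, this gives \<open>y\<close> in \<open>M\<close>.\<close>
  moreover have "(y [^] k) [^] q \<in> R" using k y(1) by (simp add: x_def nat_pow_pow mult.commute)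
  then have "y [^] k \<in> R" using R q y(1) unfolding root_closed_def by blast
  ultimately show "y \<in> M" using coprime_power_in_subgroup[OF M(1) y(1) _ y(2)] M(2) by blast
qed

text \<open>The root closure \<open>R\<close> of \<open>T0\<close> is normalized by
  \<open>T\<close>, so \<open>R T\<close> is a subgroup, covered by finitely many cosets of
  \<open>R\<close>. It is root-closed by \<open>root_closed_finite_index\<close> and hence
  everything. \<open>R\<close> inherits nilpotency from \<open>T0\<close> by
  \<open>nilpotent_if_root_dense\<close>.\<close>

lemma virtually_nilpotentI:
  assumes loc: "pi_local \<pi> G" and T: "subgroup T G" "root_dense \<pi> G T"
    and T0: "subgroup T0 G" "T0 \<subseteq> T" and conj: "\<And>g x. g \<in> T \<Longrightarrow> x \<in> T0 \<Longrightarrow> g \<otimes> x \<otimes> inv g \<in> T0"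
    and P: "finite P" "P \<subseteq> carrier G" "T \<subseteq> (\<Union>p\<in>P. T0 #> p)"
    and nil: "lower_central (G\<lparr>carrier := T0\<rparr>) c = {\<one>}"
  shows "virtually_nilpotent G"
proof -
  define R where "R = root_closure \<pi> T0"
  have T0c: "T0 \<subseteq> carrier G" by (rule subgroup.subset[OF T0(1)])
  have Tc: "\<And>g. g \<in> T \<Longrightarrow> g \<in> carrier G" by (rule subgroup.mem_carrier[OF T(1)])
  have R: "root_closed \<pi> G R" unfolding R_def by (rule root_closed_root_closure[OF T0c])
  have sR: "subgroup R G" using R by (simp add: root_closed_def)
  have Rc: "\<And>g. g \<in> R \<Longrightarrow> g \<in> carrier G" by (rule subgroup.mem_carrier[OF sR])
  have T0R: "T0 \<subseteq> R" unfolding R_def by (rule root_closure_superset)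
  have conjR: "g \<otimes> x \<otimes> inv g \<in> R" if g: "g \<in> T" and x: "x \<in> R" for g x
  proof -
    interpret c: group_hom G G "\<lambda>v. g \<otimes> v \<otimes> inv g" by (rule conj_group_hom[OF Tc[OF g]])
    \<comment> \<open>The preimage of \<open>R\<close> under conjugation by \<open>g\<close> is
      root-closed and contains \<open>T0\<close>, so it contains \<open>R\<close>.\<close>
    have "subgroup {x \<in> carrier G. g \<otimes> x \<otimes> inv g \<in> R} G"
    proof (rule subgroupI)
      have "\<one> \<in> {x \<in> carrier G. g \<otimes> x \<otimes> inv g \<in> R}"
        using c.hom_one subgroup.one_closed[OF sR] by simp
      then show "{x \<in> carrier G. g \<otimes> x \<otimes> inv g \<in> R} \<noteq> {}" by blast
    next
      fix a assume a: "a \<in> {x \<in> carrier G. g \<otimes> x \<otimes> inv g \<in> R}"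
      then have "inv (g \<otimes> a \<otimes> inv g) \<in> R" using subgroup.m_inv_closed[OF sR] by blast
      then show "inv a \<in> {x \<in> carrier G. g \<otimes> x \<otimes> inv g \<in> R}" using c.hom_inv[of a] a by simp
      fix b assume b: "b \<in> {x \<in> carrier G. g \<otimes> x \<otimes> inv g \<in> R}"
      have "(g \<otimes> a \<otimes> inv g) \<otimes> (g \<otimes> b \<otimes> inv g) \<in> R" using subgroup.m_closed[OF sR] a b by blast
      then show "a \<otimes> b \<in> {x \<in> carrier G. g \<otimes> x \<otimes> inv g \<in> R}" 
        using c.hom_mult[of a b] a b by simp
    qed auto
    moreover have "x \<in> {x \<in> carrier G. g \<otimes> x \<otimes> inv g \<in> R}"
      if "prime (q::nat)" "q \<notin> \<pi>" "x \<in> carrier G" "x [^] q \<in> {x \<in> carrier G. g \<otimes> x \<otimes> inv g \<in> R}" for q x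
    proof -
      have "(g \<otimes> x \<otimes> inv g) [^] q \<in> R" using c.hom_nat_pow[OF that(3), of q] that(4) by simp
      then have "g \<otimes> x \<otimes> inv g \<in> R"
        using root_closedD[OF R that(1,2)] that(3) Tc[OF g] by simp
      then show ?thesis using that(3) by simp
    qed
    ultimately have "root_closed \<pi> G {x \<in> carrier G. g \<otimes> x \<otimes> inv g \<in> R}" unfolding root_closed_def by blast
    moreover have "T0 \<subseteq> {x \<in> carrier G. g \<otimes> x \<otimes> inv g \<in> R}" using conj[OF g] T0R T0c by blast
    ultimately have "R \<subseteq> {x \<in> carrier G. g \<otimes> x \<otimes> inv g \<in> R}" unfolding R_def by (rule root_closure_least)
    then show ?thesis using x by blast
  qed
  define M where "M = {r \<otimes> g | r g. r \<in> R \<and> g \<in> T}"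
  have sM: "subgroup M G"
  proof (rule subgroupI)
    show "M \<subseteq> carrier G" using Rc Tc by (auto simp: M_def)
    show "M \<noteq> {}" unfolding M_def using subgroup.one_closed[OF sR] subgroup.one_closed[OF T(1)] by blast
    fix a assume "a \<in> M"
    then obtain r g where a: "a = r \<otimes> g" "r \<in> R" "g \<in> T" by (auto simp: M_def)
    have "inv a = (inv g \<otimes> inv r \<otimes> inv (inv g)) \<otimes> inv g"
      using a Rc Tc by (simp add: inv_mult_group m_assoc)
    moreover have "inv g \<otimes> inv r \<otimes> inv (inv g) \<in> R"
      using conjR subgroup.m_inv_closed[OF sR a(2)] subgroup.m_inv_closed[OF T(1) a(3)] by blast
    ultimately show "inv a \<in> M" unfolding M_def using subgroup.m_inv_closed[OF T(1) a(3)] by blast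
    fix b assume "b \<in> M"
    then obtain r' g' where b: "b = r' \<otimes> g'" "r' \<in> R" "g' \<in> T" by (auto simp: M_def)
    have "a \<otimes> b = (r \<otimes> (g \<otimes> r' \<otimes> inv g)) \<otimes> (g \<otimes> g')"
      using a b Rc Tc by (simp add: m_assoc inv_cancel)
    moreover have "r \<otimes> (g \<otimes> r' \<otimes> inv g) \<in> R" using subgroup.m_closed[OF sR a(2) conjR[OF a(3) b(2)]] .
    ultimately show "a \<otimes> b \<in> M" unfolding M_def using subgroup.m_closed[OF T(1) a(3) b(3)] by blast
  qed
  have RM: "R \<subseteq> M"
  proof
    fix r assume r: "r \<in> R"
    then have "r = r \<otimes> \<one>" using Rc by simp
    then show "r \<in> M" unfolding M_def using r subgroup.one_closed[OF T(1)] by blast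
  qed
  have TM: "T \<subseteq> M"
  proof
    fix g assume g: "g \<in> T"
    then have "g = \<one> \<otimes> g" using Tc by simp
    then show "g \<in> M" unfolding M_def using g subgroup.one_closed[OF sR] by blast
  qed
  have MP: "M \<subseteq> (\<Union>p\<in>P. R #> p)"
  proof
    fix a assume "a \<in> M"
    then obtain r g where a: "a = r \<otimes> g" "r \<in> R" "g \<in> T" by (auto simp: M_def)
    then obtain p h where p: "p \<in> P" "h \<in> T0" "g = h \<otimes> p" using P(3) by (auto simp: r_coset_def)
    have "a = (r \<otimes> h) \<otimes> p" using a p Rc T0c P(2) by (metis m_assoc subsetD)
    moreover have "r \<otimes> h \<in> R" using subgroup.m_closed[OF sR a(2)] p(2) T0R by blast
    ultimately show "a \<in> (\<Union>p\<in>P. R #> p)" using p(1) by (auto simp: r_coset_def)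
  qed
  have "root_closed \<pi> G M" by (rule root_closed_finite_index[OF R sM RM P(1,2) MP])
  then have "M = carrier G" using T(2) TM unfolding root_dense_def by blast
  then have top: "carrier G \<subseteq> (\<Union>p\<in>P. R #> p)" using MP by blast
  have "rcosets R \<subseteq> (\<lambda>p. R #> p) ` P"
  proof
    fix C assume "C \<in> rcosets R"
    then obtain x where x: "x \<in> carrier G" "C = R #> x" by (auto simp: RCOSETS_def)
    then obtain p where p: "p \<in> P" "x \<in> R #> p" using top by blast
    have "R #> p = R #> x" using repr_independence[OF p(2) _ sR] p(1) P(2) by blast
    then show "C \<in> (\<lambda>p. R #> p) ` P" using x(2) p(1) by blast
  qed
  then have fin: "finite (rcosets R)" using P(1) finite_surj by blast
  interpret R: group "G\<lparr>carrier := R\<rparr>" by (rule subgroup_imp_group[OF sR])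
  have "lower_central (G\<lparr>carrier := R\<rparr>) c = {\<one>\<^bsub>G\<lparr>carrier := R\<rparr>\<^esub>}"
  proof (rule R.nilpotent_if_root_dense)
    show "pi_local \<pi> (G\<lparr>carrier := R\<rparr>)" by (rule pi_local_root_closed[OF loc R])
    show "subgroup T0 (G\<lparr>carrier := R\<rparr>)" by (rule subgroup_incl[OF T0(1) sR T0R])
    show "root_dense \<pi> (G\<lparr>carrier := R\<rparr>) T0" unfolding R_def by (rule root_dense_root_closure[OF T0c])
  qed (simp add: nil)
  then have "nilpotent_group (G\<lparr>carrier := R\<rparr>)"
    using R.is_group unfolding nilpotent_group_def by blast
  then show ?thesis unfolding virtually_nilpotent_def using is_group sR fin by blast
qed

end

section \<open>A nilpotent normal subgroup of finite index in the image of \<open>G\<close>\<close>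

lemma finite_uniform_bounds:
  fixes P :: "'x \<Rightarrow> nat \<Rightarrow> nat \<Rightarrow> bool"
  assumes "finite B" and ex: "\<And>x. x \<in> B \<Longrightarrow> \<exists>n>0. \<exists>k. P x n k"
    and mono: "\<And>x n k m j. x \<in> B \<Longrightarrow> P x n k \<Longrightarrow> P x (n * m) (j + k)"
  shows "\<exists>n>0. \<exists>k. \<forall>x \<in> B. P x n k"
  using assms
proof (induction B rule: finite_induct)
  case (insert x B)
  have "\<exists>n>0. \<exists>k. \<forall>x \<in> B. P x n k" by (rule insert.IH) (use insert.prems in auto)
  then obtain n k where n: "n > 0" "\<And>y. y \<in> B \<Longrightarrow> P y n k" by blast
  obtain m j where m: "m > 0" "P x m j" using insert.prems(1)[of x] by auto
  have "P y (n * m) (j + k)" if "y \<in> B" for y using insert.prems(2) n(2) that by blast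
  moreover have "P x (m * n) (k + j)" using insert.prems(2) m(2) by blast
  ultimately show ?case using n(1) m(1)
    by (intro exI[of _ "n * m"] conjI exI[of _ "j + k"]) (auto simp: mult.commute add.commute)
qed auto

text \<open>A product of factors \<open>s^n - 1\<close>, one for each letter of the word.\<close>

primrec rword :: "nat \<Rightarrow> 'a list \<Rightarrow> 'a rterm" where
  "rword n [] = ROne"
| "rword n (s # w) = RMul (rdiff s n) (rword n w)"

context metabelian_image
begin

lemma invariant_kernel: "invariant {a \<in> A. ev e a = \<one>}"
proof (rule invariantI)
  show "ev f x \<in> {a \<in> A. ev e a = \<one>}" if "x \<in> {a \<in> A. ev e a = \<one>}" for f x
    using that ev_commute[of x e f] by simp
qed (auto simp: ev_mult ev_inv)

lemma ev_rword_append: "ev (rword n (u @ w)) a = ev (rword n u) (ev (rword n w) a)"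
  by (induction u) simp_all

lemma ev_rword_filter:
  "a \<in> A \<Longrightarrow> ev (rword n w) a = ev (rword n (filter P w)) (ev (rword n (filter (\<lambda>s. \<not> P s) w)) a)"
proof (induction w)
  case (Cons s w)
  then show ?case
    using ev_commute[of "ev (rword n (filter (\<lambda>s. \<not> P s) w)) a" "rdiff s n" "rword n (filter P w)"] by simp
qed simp

lemma ev_rword_replicate: "ev (rword n (replicate k s)) a = ev (rpow k (rdiff s n)) a"
  by (induction k) simp_all

text \<open>The factors commute. In a long word either the letter \<open>s\<close> occurs
  \<open>k\<close> times or the other letters form a long word over \<open>S'\<close>.\<close>

lemma long_words_vanish:
  assumes k: "\<And>s a. s \<in> S \<Longrightarrow> a \<in> A \<Longrightarrow> ev (rpow k (rdiff s n)) a = \<one>"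
    and "finite S'" "S' \<subseteq> S"
  shows "\<exists>c. \<forall>w a. set w \<subseteq> S' \<and> length w \<ge> c \<and> a \<in> A \<longrightarrow> ev (rword n w) a = \<one>"
  using assms(2,3)
proof (induction S' rule: finite_induct)
  case empty
  show ?case by (intro exI[of _ 1]) auto
next
  case (insert s S')
  then obtain c where c: "\<And>w a. set w \<subseteq> S' \<Longrightarrow> length w \<ge> c \<Longrightarrow> a \<in> A \<Longrightarrow> ev (rword n w) a = \<one>" by auto
  show ?case
  proof (intro exI[of _ "k + c"] allI impI, elim conjE)
    fix w a assume w: "set w \<subseteq> insert s S'" "k + c \<le> length w" and a: "a \<in> A"
    let ?u = "filter (\<lambda>x. x = s) w" and ?v = "filter (\<lambda>x. \<not> x = s) w"
    have split: "ev (rword n w) a = ev (rword n ?u) (ev (rword n ?v) a)" by (rule ev_rword_filter[OF a])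
    show "ev (rword n w) a = \<one>"
    proof (cases "length ?v \<ge> c")
      case True
      then have "ev (rword n ?v) a = \<one>" using w(1) a by (intro c) auto
      then show ?thesis unfolding split by simp
    next
      case False
      have "length ?u \<ge> k" using False w(2) sum_length_filter_compl[of "\<lambda>x. x = s" w] by simp
      moreover have "?u = replicate (length ?u) s" by (simp add: replicate_length_same)
      ultimately obtain j where "?u = replicate (j + k) s" by (metis add.commute le_Suc_ex)
      then have "ev (rword n ?u) b = ev (rpow j (rdiff s n)) (ev (rpow k (rdiff s n)) b)" for b
        by (simp add: ev_rword_replicate ev_rpow_add)
      then show ?thesis unfolding split using k insert.prems a by simp
    qed
  qed
qed

text \<open>An ascending series of submodules in the role of an upper central series: each
  \<open>s^n - 1\<close> with \<open>s\<close> in \<open>S\<close> maps a member into the preceding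
  one.\<close>

definition word_kernel :: "nat \<Rightarrow> nat \<Rightarrow> 'b set" where
  "word_kernel n j = {a \<in> A. \<forall>w. set w \<subseteq> S \<and> length w = j \<longrightarrow> ev (rword n w) a = \<one>}"

lemma invariant_word_kernel: "invariant (word_kernel n j)"
proof (rule invariantI)
  show "ev f x \<in> word_kernel n j" if "x \<in> word_kernel n j" for f x
    using that ev_commute[of x _ f] by (simp add: word_kernel_def)
qed (auto simp: word_kernel_def ev_mult ev_inv)

lemma word_kernel_0: "word_kernel n 0 = {\<one>}"
  by (auto simp: word_kernel_def)

lemma ev_rdiff_word_kernel:
  assumes "s \<in> S" "a \<in> word_kernel n (Suc j)"
  shows "ev (rdiff s n) a \<in> word_kernel n j"
proof -
  have "ev (rword n w) (ev (rdiff s n) a) = \<one>" if "set w \<subseteq> S" "length w = j" for w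
  proof -
    have "ev (rword n (w @ [s])) a = \<one>" using assms that by (simp add: word_kernel_def)
    then show ?thesis by (simp add: ev_rword_append)
  qed
  then show ?thesis using assms by (simp add: word_kernel_def)
qed

text \<open>Intended for an \<open>n\<close> such that the powers \<open>\<phi> s [^] n\<close> act
  unipotently on \<open>A\<close>. As it contains \<open>A\<close>, this subgroup is normal in
  \<open>T\<close>.\<close>

definition unipotent_part :: "nat \<Rightarrow> 'b set" where
  "unipotent_part n = generate L (A \<union> (\<lambda>s. \<phi> s [^] n) ` S)"

lemma unipotent_part_gens: "A \<union> (\<lambda>s. \<phi> s [^] (n::nat)) ` S \<subseteq> T"
proof -
  have "\<phi> s [^] n \<in> T" if "s \<in> S" for s
    by (rule subgroup_nat_pow_closed[OF subgroup_T]) (use that S(2) in \<open>auto simp: T_def\<close>)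
  then show ?thesis using A_subset_T by blast
qed

lemma subgroup_unipotent_part: "subgroup (unipotent_part n) L"
  unfolding unipotent_part_def by (rule generate_is_subgroup) (use unipotent_part_gens[of n] T_closed in blast)

lemma unipotent_part_subset: "unipotent_part n \<subseteq> T"
  unfolding unipotent_part_def by (rule generate_subgroup_incl[OF unipotent_part_gens subgroup_T])

lemma A_subset_unipotent_part: "A \<subseteq> unipotent_part n"
  unfolding unipotent_part_def by (auto intro: generate.incl)

lemma subgroup_containing_A_normal:
  assumes H: "subgroup H L" "A \<subseteq> H" "H \<subseteq> T" and g: "g \<in> T" and x: "x \<in> H"
  shows "g \<otimes> x \<otimes> inv g \<in> H"
proof -
  have xT: "x \<in> T" using x H(3) by blast
  have "g \<otimes> x \<otimes> inv g = comm g x \<otimes> x" using g xT by (simp add: comm_def m_assoc)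
  then show ?thesis using subgroup.m_closed[OF H(1) _ x] comm_T[OF g xT] H(2) by auto
qed

text \<open>It suffices to treat generators: elements of \<open>A\<close> commute with
  \<open>a\<close>, and the commutator of \<open>\<phi> s [^] n\<close> with \<open>a\<close> is
  \<open>(s^n - 1) a\<close>.\<close>

lemma comm_word_kernel:
  assumes g: "g \<in> unipotent_part n" and a: "a \<in> word_kernel n (Suc j)"
  shows "comm g a \<in> word_kernel n j"
proof -
  let ?Z = "word_kernel n j"
  note Z = invariant_word_kernel[of n j]
  have aL: "a \<in> A" "a \<in> carrier L" using a by (simp_all add: word_kernel_def)
  have sZ: "subgroup ?Z L" using Z by (simp add: invariant_def)
  have "b \<in> {g \<in> T. comm g a \<in> ?Z}" if b: "b \<in> A" for b
  proof -
    have "comm b a = \<one>" using A_comm[OF b aL(1)] b aL by (simp add: comm_def m_assoc)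
    then show ?thesis using b A_subset_T invariant_group(1)[OF Z] by auto
  qed
  moreover have "\<phi> s [^] n \<in> {g \<in> T. comm g a \<in> ?Z}" if s: "s \<in> S" for s
  proof -
    have "comm (\<phi> s [^] n) a \<in> ?Z"
      using ev_rdiff_word_kernel[OF s a] aL s S(2) by (auto simp: ev_rdiff ev_rpow comm_def)
    moreover have "\<phi> s [^] n \<in> T" using unipotent_part_gens s by blast
    ultimately show ?thesis by simp
  qed
  ultimately have "unipotent_part n \<subseteq> {g \<in> T. comm g a \<in> ?Z}"
    unfolding unipotent_part_def
    by (intro generate_subgroup_incl subgroup_comm_mod[OF subgroup_T sZ aL(2) invariant_conj_T[OF Z]]) auto
  then show ?thesis using g by blast
qed

text \<open>The first commutator subgroup lies in \<open>A = word_kernel n c\<close>, and each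
  further step lowers the index \<open>c\<close> by one, whence \<open>Suc c\<close>.\<close>

lemma unipotent_part_nilpotent:
  assumes c: "word_kernel n c = A"
  shows "lower_central (L\<lparr>carrier := unipotent_part n\<rparr>) (Suc c) = {\<one>}"
proof -
  let ?T0 = "unipotent_part n"
  let ?K = "L\<lparr>carrier := ?T0\<rparr>"
  interpret K: group ?K by (rule subgroup_imp_group[OF subgroup_unipotent_part])
  have sub: "generate ?K B = generate L B" if "B \<subseteq> ?T0" for B
    using generate_consistent[OF that subgroup_unipotent_part] by simp
  have inv: "inv\<^bsub>?K\<^esub> x = inv x" if "x \<in> ?T0" for x using m_inv_consistent[OF subgroup_unipotent_part that] .
  have gT0: "lower_central ?K i \<subseteq> ?T0" for i using K.lower_central_subgroup by simp
  have step: "lower_central ?K (Suc i) \<subseteq> Z" if Z: "invariant Z"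
    and com: "\<And>x y. x \<in> lower_central ?K i \<Longrightarrow> y \<in> ?T0 \<Longrightarrow> comm x y \<in> Z" for i Z
  proof -
    have ZT: "Z \<subseteq> ?T0" using invariant_subset[OF Z] A_subset_unipotent_part by blast
    have B: "{x \<otimes>\<^bsub>?K\<^esub> y \<otimes>\<^bsub>?K\<^esub> inv\<^bsub>?K\<^esub> x \<otimes>\<^bsub>?K\<^esub> inv\<^bsub>?K\<^esub> y | x y. x \<in> lower_central ?K i \<and> y \<in> carrier ?K} \<subseteq> Z"
    proof clarify
      fix x y assume x: "x \<in> lower_central ?K i" and y: "y \<in> carrier ?K"
      have "x \<in> ?T0" "y \<in> ?T0" using x y gT0 by auto
      then show "x \<otimes>\<^bsub>?K\<^esub> y \<otimes>\<^bsub>?K\<^esub> inv\<^bsub>?K\<^esub> x \<otimes>\<^bsub>?K\<^esub> inv\<^bsub>?K\<^esub> y \<in> Z"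
        using com[OF x, of y] by (simp add: inv comm_def)
    qed
    show ?thesis
      unfolding lower_central.simps sub[OF subset_trans[OF B ZT]]
      by (rule generate_subgroup_incl[OF B]) (use Z in \<open>simp add: invariant_def\<close>)
  qed
  have "lower_central ?K (Suc i) \<subseteq> word_kernel n (c - i)" if "i \<le> c" for i
    using that
  proof (induction i)
    case 0
    show ?case
    proof (rule step[OF invariant_word_kernel])
      fix x y assume "x \<in> lower_central ?K 0" "y \<in> ?T0"
      then have "x \<in> T" "y \<in> T" using unipotent_part_subset[of n] by auto
      then show "comm x y \<in> word_kernel n (c - 0)" using comm_T c by simp
    qed
  next
    case (Suc i)
    have s: "c - i = Suc (c - Suc i)" using Suc.prems by simp
    show ?case
    proof (rule step[OF invariant_word_kernel])
      fix x y assume x: "x \<in> lower_central ?K (Suc i)" and y: "y \<in> ?T0"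
      have xZ: "x \<in> word_kernel n (Suc (c - Suc i))" using Suc x unfolding s by auto
      then have "inv (comm y x) \<in> word_kernel n (c - Suc i)"
        using comm_word_kernel[OF y] invariant_group(3)[OF invariant_word_kernel] by blast
      moreover have "x \<in> carrier L" "y \<in> carrier L"
        using xZ y unipotent_part_subset[of n] by (auto simp: word_kernel_def)
      ultimately show "comm x y \<in> word_kernel n (c - Suc i)" by (subst comm_swap) auto
    qed
  qed
  from this[of c] have "lower_central ?K (Suc c) \<subseteq> {\<one>}" by (simp add: word_kernel_0 del: lower_central.simps)
  moreover have "\<one> \<in> lower_central ?K (Suc c)"
    using subgroup.one_closed[OF conjunct2[OF K.lower_central_subgroup[of "Suc c"]]]
    by (simp del: lower_central.simps)
  ultimately show ?thesis by blast
qed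

text \<open>Since \<open>H\<close> contains \<open>A\<close>, it is normalized by \<open>g\<close>,
  and the products of elements of \<open>H\<close> with powers of \<open>g\<close> form a subgroup.
  Exponents are reduced modulo \<open>n\<close>.\<close>

lemma finite_cosets_adjoin:
  assumes H: "subgroup H L" "A \<subseteq> H" "H \<subseteq> T" and g: "g \<in> T" and n: "n > 0" "g [^] (n::nat) \<in> H"
  shows "generate L (insert g H) \<subseteq> (\<Union>i<n. H #> (g [^] i))"
proof -
  have gc: "g \<in> carrier L" using g by simp
  have Hc: "x \<in> carrier L" if "x \<in> H" for x by (rule subgroup.mem_carrier[OF H(1) that])
  define M where "M = {h \<otimes> g [^] (i::int) | h i. h \<in> H}"
  have conj: "g [^] i \<otimes> x \<otimes> inv (g [^] i) \<in> H" if "x \<in> H" for x and i :: int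
    using subgroup_containing_A_normal[OF H subgroup_int_pow_closed[OF subgroup_T g] that] .
  have "subgroup M L"
  proof (rule subgroupI)
    show "M \<subseteq> carrier L" using Hc gc by (auto simp: M_def)
    show "M \<noteq> {}" unfolding M_def using subgroup.one_closed[OF H(1)] by blast
    fix a assume "a \<in> M"
    then obtain h i where a: "h \<in> H" "a = h \<otimes> g [^] (i::int)" by (auto simp: M_def)
    have "inv a = (g [^] (-i) \<otimes> inv h \<otimes> inv (g [^] (-i))) \<otimes> g [^] (-i)"
      using a Hc[OF a(1)] gc by (simp add: int_pow_neg inv_mult_group m_assoc)
    then show "inv a \<in> M" unfolding M_def using conj[OF subgroup.m_inv_closed[OF H(1) a(1)]] by blast
    fix b assume "b \<in> M"
    then obtain h' j where b: "h' \<in> H" "b = h' \<otimes> g [^] (j::int)" by (auto simp: M_def)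
    have "a \<otimes> b = (h \<otimes> (g [^] i \<otimes> h' \<otimes> inv (g [^] i))) \<otimes> g [^] (i + j)"
      using a b Hc gc by (simp add: int_pow_mult m_assoc inv_cancel)
    then show "a \<otimes> b \<in> M" unfolding M_def using subgroup.m_closed[OF H(1) a(1) conj[OF b(1)]] by blast
  qed
  moreover have "h \<in> M" if "h \<in> H" for h
    unfolding M_def using that Hc[OF that] by (intro CollectI exI[of _ h] exI[of _ "0::int"]) simp
  moreover have "g \<in> M"
    unfolding M_def using subgroup.one_closed[OF H(1)] gc by (intro CollectI exI[of _ \<one>] exI[of _ "1::int"]) simp
  ultimately have "generate L (insert g H) \<subseteq> M" by (intro generate_subgroup_incl) auto
  also have "M \<subseteq> (\<Union>i<n. H #> (g [^] i))"
  proof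
    fix a assume "a \<in> M"
    then obtain h i where a: "h \<in> H" "a = h \<otimes> g [^] (i::int)" by (auto simp: M_def)
    define j where "j = nat (i mod int n)"
    have j: "j < n" "i = int n * (i div int n) + int j" using n(1) by (auto simp: j_def nat_less_iff)
    have "g [^] i = g [^] (int n * (i div int n)) \<otimes> g [^] int j"
      using gc j(2) by (metis int_pow_mult)
    also have "g [^] (int n * (i div int n)) = (g [^] n) [^] (i div int n)"
      unfolding int_pow_int[symmetric] using gc by (simp only: int_pow_pow)
    finally have gi: "g [^] i = (g [^] n) [^] (i div int n) \<otimes> g [^] j" by (simp only: int_pow_int)
    have k: "(g [^] n) [^] (i div int n) \<in> H" using n(2) by (rule subgroup_int_pow_closed[OF H(1)])
    have "a = (h \<otimes> (g [^] n) [^] (i div int n)) \<otimes> g [^] j"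
      unfolding a(2) gi using Hc[OF a(1)] Hc[OF k] gc by (simp only: m_assoc nat_pow_closed)
    then have "a \<in> H #> (g [^] j)" using subgroup.m_closed[OF H(1) a(1) k] by (auto simp: r_coset_def)
    then show "a \<in> (\<Union>i<n. H #> (g [^] i))" using j(1) by blast
  qed
  finally show ?thesis .
qed

text \<open>One generator is adjoined at a time, which multiplies the number of cosets by at most
  \<open>n\<close>.\<close>

lemma finite_cosets_unipotent_part:
  assumes n: "n > 0" and "finite S'" "S' \<subseteq> S"
  shows "\<exists>P. finite P \<and> P \<subseteq> T \<and> generate L (unipotent_part n \<union> \<phi> ` S') \<subseteq> (\<Union>p\<in>P. unipotent_part n #> p)"
  using assms(2,3)
proof (induction S' rule: finite_induct)
  case empty
  have "generate L (unipotent_part n) \<subseteq> unipotent_part n"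
    by (rule generate_subgroup_incl[OF subset_refl subgroup_unipotent_part])
  moreover have "unipotent_part n #> \<one> = unipotent_part n"
    using subgroup.subset[OF subgroup_unipotent_part] by (rule coset_mult_one)
  ultimately show ?case using subgroup.one_closed[OF subgroup_T] by (intro exI[of _ "{\<one>}"]) simp
next
  case (insert s S')
  let ?T0 = "unipotent_part n"
  have gens: "?T0 \<union> \<phi> ` S' \<subseteq> T" "\<phi> s \<in> T"
    using insert.prems S(2) unipotent_part_subset[of n] by (auto simp: T_def)
  define H where "H = generate L (?T0 \<union> \<phi> ` S')"
  obtain P where P: "finite P" "P \<subseteq> T" "H \<subseteq> (\<Union>p\<in>P. ?T0 #> p)"
    using insert unfolding H_def by auto
  have incl: "?T0 \<union> \<phi> ` S' \<subseteq> H" unfolding H_def by (auto intro: generate.incl)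
  have H: "subgroup H L" "A \<subseteq> H" "H \<subseteq> T"
  proof -
    show "subgroup H L" unfolding H_def by (rule generate_is_subgroup) (use gens(1) T_closed in blast)
    show "A \<subseteq> H" using A_subset_unipotent_part[of n] incl by blast
    show "H \<subseteq> T" unfolding H_def by (rule generate_subgroup_incl[OF gens(1) subgroup_T])
  qed
  have "\<phi> s [^] n \<in> ?T0" unfolding unipotent_part_def using insert.prems by (intro generate.incl) auto
  then have "\<phi> s [^] n \<in> H" using incl by blast
  from finite_cosets_adjoin[OF H gens(2) n this]
  have cos: "generate L (insert (\<phi> s) H) \<subseteq> (\<Union>i<n. H #> (\<phi> s [^] i))" .
  define P' where "P' = (\<lambda>(p, i). p \<otimes> \<phi> s [^] i) ` (P \<times> {..<n})"
  have powT: "\<phi> s [^] i \<in> T" for i :: nat by (rule subgroup_nat_pow_closed[OF subgroup_T gens(2)])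
  have "generate L (?T0 \<union> \<phi> ` insert s S') \<subseteq> generate L (insert (\<phi> s) H)"
    by (rule mono_generate) (use incl in auto)
  also note cos
  also have "(\<Union>i<n. H #> (\<phi> s [^] i)) \<subseteq> (\<Union>p\<in>P'. ?T0 #> p)"
  proof
    fix x assume "x \<in> (\<Union>i<n. H #> (\<phi> s [^] i))"
    then obtain i h where i: "i < n" "h \<in> H" "x = h \<otimes> \<phi> s [^] i" by (auto simp: r_coset_def)
    obtain p u where p: "p \<in> P" "u \<in> ?T0" "h = u \<otimes> p" using P(3) i(2) by (auto simp: r_coset_def)
    have "u \<in> carrier L" "p \<in> carrier L" "\<phi> s [^] i \<in> carrier L"
      using p P(2) powT[of i] unipotent_part_subset[of n] T_closed by blast+
    then have "x = u \<otimes> (p \<otimes> \<phi> s [^] i)" using i(3) p(3) by (simp only: m_assoc)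
    then show "x \<in> (\<Union>p\<in>P'. ?T0 #> p)" using p(1,2) i(1) unfolding P'_def r_coset_def by force
  qed
  finally have "generate L (?T0 \<union> \<phi> ` insert s S') \<subseteq> (\<Union>p\<in>P'. ?T0 #> p)" .
  moreover have "finite P'" using P(1) by (simp add: P'_def)
  moreover have "P' \<subseteq> T" unfolding P'_def using P(2) powT subgroup.m_closed[OF subgroup_T] by auto
  ultimately show ?case by blast
qed

text \<open>Finiteness of \<open>S\<close> and \<open>gen_comms\<close> gives common values of
  \<open>n\<close> and \<open>k\<close>. Kernels of terms are submodules, so these values work on
  all of \<open>A\<close>.\<close>

lemma killed_imp_virtually_nilpotent:
  assumes dense: "root_dense \<pi> L T"
    and killed: "\<And>s a. s \<in> S \<Longrightarrow> a \<in> gen_comms \<Longrightarrow> killed s a"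
  shows "virtually_nilpotent L"
proof -
  have "\<exists>n>0. \<exists>k. \<forall>x \<in> S \<times> gen_comms. ev (rpow k (rdiff (fst x) n)) (snd x) = \<one>"
  proof (rule finite_uniform_bounds)
    show "finite (S \<times> gen_comms)" using S(1) finite_gen_comms by blast
    show "\<exists>n>0. \<exists>k. ev (rpow k (rdiff (fst x) n)) (snd x) = \<one>" if "x \<in> S \<times> gen_comms" for x
      using killed[of "fst x" "snd x"] that unfolding killed_def by auto
    show "ev (rpow (j + k) (rdiff (fst x) (n * m))) (snd x) = \<one>"
      if "x \<in> S \<times> gen_comms" "ev (rpow k (rdiff (fst x) n)) (snd x) = \<one>" for x n k m j
      using killed_dvd[OF _ that(2)] that(1) gen_comms_subset by auto
  qed
  then obtain n k where n: "n > 0"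
    and "\<forall>x \<in> S \<times> gen_comms. ev (rpow k (rdiff (fst x) n)) (snd x) = \<one>" by blast
  then have k: "ev (rpow k (rdiff s n)) a = \<one>" if "s \<in> S" "a \<in> gen_comms" for s a using that by auto
  have kA: "ev (rpow k (rdiff s n)) a = \<one>" if "s \<in> S" "a \<in> A" for s a
    using gen_comms_generate[OF invariant_kernel[of "rpow k (rdiff s n)"]] k[OF that(1)] that(2) gen_comms_subset by blast
  obtain c where "\<And>w a. set w \<subseteq> S \<Longrightarrow> length w \<ge> c \<Longrightarrow> a \<in> A \<Longrightarrow> ev (rword n w) a = \<one>"
    using long_words_vanish[of k n S] kA S(1) by blast
  then have c: "word_kernel n c = A" by (auto simp: word_kernel_def)
  obtain P where P: "finite P" "P \<subseteq> T" "generate L (unipotent_part n \<union> \<phi> ` S) \<subseteq> (\<Union>p\<in>P. unipotent_part n #> p)"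
    using finite_cosets_unipotent_part[OF n S(1) subset_refl] by blast
  have "T \<subseteq> generate L (unipotent_part n \<union> \<phi> ` S)" unfolding T_generated by (rule mono_generate) simp
  also note P(3)
  finally have TP: "T \<subseteq> (\<Union>p\<in>P. unipotent_part n #> p)" .
  show ?thesis
  proof (rule virtually_nilpotentI[OF local subgroup_T dense subgroup_unipotent_part unipotent_part_subset _ P(1) _ TP
        unipotent_part_nilpotent[OF c]])
    show "g \<otimes> x \<otimes> inv g \<in> unipotent_part n" if "g \<in> T" "x \<in> unipotent_part n" for g x
      by (rule subgroup_containing_A_normal[OF subgroup_unipotent_part A_subset_unipotent_part unipotent_part_subset that])
    show "P \<subseteq> carrier L" using P(2) T_closed by blast
  qed
qed

end

section \<open>Density of the image in the localization, and the conclusion\<close>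

text \<open>A root-closed \<open>H\<close> is local, so the universal property yields a map from
  \<open>L\<close> to \<open>H\<close>. Followed by the inclusion it is the identity by uniqueness,
  so \<open>H\<close> is all of \<open>L\<close>.\<close>

lemma pi_localization_root_dense:
  assumes G: "group G" and loc: "pi_localization \<pi> G L \<phi>"
  shows "root_dense \<pi> L (\<phi> ` carrier G)"
  unfolding root_dense_def
proof (intro allI impI, elim conjE)
  have locL: "pi_local \<pi> L" and \<phi>: "\<phi> \<in> hom G L" using loc by (auto simp: pi_localization_def)
  interpret L: group L using locL by (simp add: pi_local_def)
  fix H assume H: "root_closed \<pi> L H" and \<phi>H: "\<phi> ` carrier G \<subseteq> H"
  have Hc: "H \<subseteq> carrier L" using H subgroup.subset unfolding root_closed_def by blast
  have "\<phi> \<in> hom G (L\<lparr>carrier := H\<rparr>)" using \<phi> \<phi>H by (auto simp: hom_def)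
  from pi_localization_lift[OF G loc L.pi_local_root_closed[OF locL H] this]
  obtain \<psi> where \<psi>: "group_hom L (L\<lparr>carrier := H\<rparr>) \<psi>" "\<And>x. x \<in> carrier G \<Longrightarrow> \<psi> (\<phi> x) = \<phi> x" by blast
  interpret \<psi>: group_hom L "L\<lparr>carrier := H\<rparr>" \<psi> by (rule \<psi>(1))
  have "restrict \<psi> (carrier L) \<in> hom L L \<inter> extensional (carrier L)"
    "restrict id (carrier L) \<in> hom L L \<inter> extensional (carrier L)"
    using \<psi>.hom_closed \<psi>.hom_mult Hc by (auto simp: hom_def)
  moreover have "restrict \<psi> (carrier L) (\<phi> x) = \<phi> x" "restrict id (carrier L) (\<phi> x) = \<phi> x" if "x \<in> carrier G" for x
    using that \<phi> \<psi>(2) by (auto simp: hom_def)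
  ultimately have eq: "restrict \<psi> (carrier L) = restrict id (carrier L)"
    using pi_localization_universal[OF G loc locL \<phi>] by blast
  have "carrier L \<subseteq> H"
  proof
    fix x assume x: "x \<in> carrier L"
    then have "\<psi> x = x" using fun_cong[OF eq, of x] by simp
    then show "x \<in> H" using \<psi>.hom_closed[OF x] by simp
  qed
  then show "H = carrier L" using Hc by blast
qed

lemma virtually_nilpotent_if_solvable_localization:
  fixes G :: "'a monoid" and L :: "('b, 'n) monoid_scheme"
  assumes fg: "finitely_generated_group G" and met: "metabelian_group G" and \<pi>: "finite \<pi>"
    and loc: "pi_localization \<pi> G L \<phi>" and sol: "solvable L"
  shows "virtually_nilpotent L"
proof -
  have G: "group G" using fg by (simp add: finitely_generated_group_def)
  obtain S where S: "finite S" "S \<subseteq> carrier G" "generate G S = carrier G"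
    using fg by (auto simp: finitely_generated_group_def)
  have locL: "pi_local \<pi> L" and \<phi>: "\<phi> \<in> hom G L" using loc by (auto simp: pi_localization_def)
  have L: "group L" using locL by (simp add: pi_local_def)
  interpret \<phi>: group_hom G L \<phi> using G L \<phi> by (simp add: group_hom_def group_hom_axioms_def)
  interpret D: comm_group "G\<lparr>carrier := derived G (carrier G)\<rparr>" using met by (simp add: metabelian_group_def)
  interpret metabelian_image L G \<phi> S \<pi>
  proof (intro metabelian_image.intro metabelian_image_axioms.intro L locL G \<phi> S)
    fix x y assume "x \<in> derived L (\<phi> ` carrier G)" "y \<in> derived L (\<phi> ` carrier G)"
    then obtain u v where uv: "u \<in> derived G (carrier G)" "x = \<phi> u" "v \<in> derived G (carrier G)" "y = \<phi> v"
      unfolding \<phi>.derived_img[OF subset_refl] by blast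
    have c: "u \<in> carrier G" "v \<in> carrier G" using uv \<phi>.G.derived_in_carrier[OF subset_refl] by auto
    have "u \<otimes>\<^bsub>G\<^esub> v = v \<otimes>\<^bsub>G\<^esub> u" using D.m_comm uv by simp
    then have "\<phi> (u \<otimes>\<^bsub>G\<^esub> v) = \<phi> (v \<otimes>\<^bsub>G\<^esub> u)" by simp
    then show "x \<otimes>\<^bsub>L\<^esub> y = y \<otimes>\<^bsub>L\<^esub> x" using c uv by simp
  qed
  \<comment> \<open>Obstructions refer to \<open>term_localization\<close>, whose type depends on
    that of \<open>G\<close> alone, so solubility is transferred to it.\<close>
  obtain f where f: "f \<in> iso L (term_localization \<pi> G)"
    using pi_localization_iso_term_localization[OF G loc] by blast
  have "group_hom L (term_localization \<pi> G) f"
    using f L group_term_localization by (auto simp: group_hom_def group_hom_axioms_def iso_def)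
  moreover have "f ` carrier L = carrier (term_localization \<pi> G)" using f by (auto simp: iso_def bij_betw_def)
  ultimately have sol': "solvable (term_localization \<pi> G)" using sol by (rule group_hom.surj_hom_imp_solvable)
  have "killed s a" if "s \<in> S" "a \<in> gen_comms" for s a
  proof (rule ccontr)
    assume "\<not> killed s a"
    then show False
      using not_killed_imp_not_solvable[OF metabelian_image_axioms \<pi> _ that(2)] sol' that(1) S(2) by blast
  qed
  then show ?thesis
    using killed_imp_virtually_nilpotent pi_localization_root_dense[OF G loc] unfolding T_def by blast
qed

text \<open>In the trivial group every element has all roots, so the condition on centralizers is
  void.\<close>

lemma P_group_trivial:
  assumes "group H" "carrier H = {\<one>\<^bsub>H\<^esub>}"
  shows "P_group \<pi> H"
proof -
  interpret H: group H by fact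
  have "\<exists>y \<in> carrier H. y [^]\<^bsub>H\<^esub> (m::int) = x" if "x \<in> carrier H" for m x
    using that assms(2) by simp
  then show ?thesis using assms by (auto simp: P_group_def U_group_def inj_on_def)
qed

theorem corollary3p2:
  fixes G :: "('a, 'm) monoid_scheme" and L :: "('b, 'n) monoid_scheme"
    and \<pi> :: "nat set" and \<phi> :: "'a \<Rightarrow> 'b"
  assumes "group G" and "finitely_generated_group G" and "metabelian_group G"
    and "finite \<pi>" and "\<forall>p \<in> \<pi>. Factorial_Ring.prime p"
    and "pi_localization \<pi> G L \<phi>"
  shows "((\<exists>N. N \<lhd> G \<and> P_group \<pi> (G Mod N)) \<and> \<not> solvable L) \<or> virtually_nilpotent L"
proof -
  interpret G: group G by fact
  have N: "carrier G \<lhd> G" by (rule G.normal_invI[OF G.subgroup_self]) simp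
  have "carrier G #>\<^bsub>G\<^esub> x = carrier G" if "x \<in> carrier G" for x
    by (rule G.coset_join2[OF that G.subgroup_self that])
  then have "carrier (G Mod carrier G) = {\<one>\<^bsub>G Mod carrier G\<^esub>}"
    unfolding carrier_FactGroup one_FactGroup using G.one_closed by blast
  then have P: "P_group \<pi> (G Mod carrier G)"
    by (rule P_group_trivial[OF normal.factorgroup_is_group[OF N]])
  \<comment> \<open>Obstructions quantify over plain monoid records, so possible further fields of
    the record \<open>G\<close> are dropped.\<close>
  define G' where "G' = \<lparr>carrier = carrier G, mult = mult G, one = \<one>\<^bsub>G\<^esub>\<rparr>"
  have G'[simp]: "carrier G' = carrier G" "mult G' = mult G" "\<one>\<^bsub>G'\<^esub> = \<one>\<^bsub>G\<^esub>" by (simp_all add: G'_def)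
  have grp: "group G'"
  proof (rule groupI)
    show "\<exists>y \<in> carrier G'. y \<otimes>\<^bsub>G'\<^esub> x = \<one>\<^bsub>G'\<^esub>" if "x \<in> carrier G'" for x
      using G.l_inv_ex that by simp
  qed (simp_all add: G.m_assoc)
  have loc': "pi_localization \<pi> G' L \<phi>"
  proof -
    have h1: "hom G' L = hom G L" by (simp add: hom_def)
    have h2: "hom G' H = hom G H" for H :: "(nat + 'a + 'b) list monoid" by (simp add: hom_def)
    show ?thesis
      unfolding pi_localization_def h1 h2 G'(1) by (rule assms(6)[unfolded pi_localization_def])
  qed
  interpret id: group_hom G G' "\<lambda>x. x"
    using grp by (auto simp: group_hom_def group_hom_axioms_def hom_def G.is_group)
  have gen: "generate G' B = generate G B" if "B \<subseteq> carrier G" for B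
    using id.generate_img[OF that] by simp
  have "finitely_generated_group G'"
    using assms(2) grp gen unfolding finitely_generated_group_def by auto
  moreover have "metabelian_group G'"
    unfolding metabelian_group_def
  proof
    interpret D: comm_group "G\<lparr>carrier := derived G (carrier G)\<rparr>" using assms(3) by (simp add: metabelian_group_def)
    have der: "derived G' (carrier G') = derived G (carrier G)"
      using id.derived_img[OF subset_refl] by simp
    show "comm_group (G'\<lparr>carrier := derived G' (carrier G')\<rparr>)"
    proof (rule group.group_comm_groupI)
      show "group (G'\<lparr>carrier := derived G' (carrier G')\<rparr>)"
        by (rule group.subgroup_imp_group[OF grp group.derived_is_subgroup[OF grp subset_refl]])
    qed (use D.m_comm der in simp)
  qed (rule grp)
  ultimately have "solvable L \<Longrightarrow> virtually_nilpotent L"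
    using virtually_nilpotent_if_solvable_localization[OF _ _ assms(4) loc'] by blast
  then show ?thesis using N P by blast
qed

end
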